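(* Let $\Bbbk$ be a field. Let $\mathbb{X}(\overline{\mathrm{OP}})$ be the group of $\Bbbk$-valued characters, under convolution, of the Hopf monoid $\overline{\mathrm{OP}}$ of normal equivalence classes of orbit polytopes. Let $G$ be the group, under multiplication, of invertible elements $\sum_\alpha c_\alpha R_\alpha$ of the completion $\overline{NSym}$ of the algebra of noncommutative symmetric functions over $\Bbbk$ such that $c_\varnothing=1$ and $n!\,c_{(n)}=c_{(1)}^n$ for all $n>1$. Then the character group $\mathbb{X}(\overline{\mathrm{OP}})$ is isomorphic to $G$.
   Context: Compositions. A composition of an integer $n\ge 0$ is a finite sequence of positive integers with sum $n$; $\varnothing$ is the unique composition of $0$. For $\beta=(\beta_1,\dots,\beta_k)$ and $\gamma=(\gamma_1,\dots,\gamma_\ell)$, the concatenation is $\beta\cdot\gamma=(\beta_1,\dots,\beta_k,\gamma_1,\dots,\gamma_\ell)$, and for nonempty $\beta,\gamma$ the near-concatenation is $\beta\odot\gamma=(\beta_1,\dots,\beta_{k-1},\beta_k+\gamma_1,\gamma_2,\dots,\gamma_\ell)$. $NSym$. $NSym$ has $\Bbbk$-basis the noncommutative ribbon functions $R_\alpha$ indexed by all compositions $\alpha$, with $R_\varnothing=1$ and $R_\beta R_\gamma=R_{\beta\cdot\gamma}+R_{\beta\odot\gamma}$ for nonempty $\beta,\gamma$. Its completion $\overline{NSym}$ is the ring of formal (possibly infinite) sums $\sum_\alpha c_\alpha R_\alpha$, $c_\alpha\in\Bbbk$, over all compositions $\alpha$, with the induced product. An element is invertible iff $c_\varnothing\neq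 0$. Orbit polytopes. For a finite set $I$, $\mathbb{R}I$ is the real vector space with basis $\{e_i:i\in I\}$ and $\mathbb{R}^I$ its dual. The symmetric group $\mathfrak{S}_I$ acts on $\mathbb{R}I$ by $\sigma(p)_i=p_{\sigma^{-1}(i)}$, and $\mathcal{O}(p)=\operatorname{conv}\{\sigma(p):\sigma\in\mathfrak{S}_I\}$ is the orbit polytope of $p\in\mathbb{R}I$. For polytopes $P\subset\mathbb{R}S$, $Q\subset\mathbb{R}T$ with $S\cap T=\varnothing$, $P\cdot Q=\{(p,q):p\in P,q\in Q\}\subset\mathbb{R}(S\sqcup T)$. For a face $F\le P$, $\mathcal{N}_P(F)$ is the cone of $y\in\mathbb{R}^I$ attaining their maximum over $P$ at every point of $F$; $\mathcal{N}_P=\{\mathcal{N}_P(F):F\le P\}$ is the normal fan; $P,Q$ are normally equivalent if $\mathcal{N}_P=\mathcal{N}_Q$. The Hopf monoid $\overline{\mathrm{OP}}$. $\overline{\mathrm{OP}}[I]$ is the set of normal equivalence classes of finite products of orbit polytopes lying in $\mathbb{R}I$ (products along partitions of $I$); a bijection $\sigma:I\to J$ acts by relabeling basis vectors. The product $\mu_{S,T}$ is induced by $P\cdot Q$. For $I=S\sqcup T$ and $P$ a finite product of orbit polytopes in $\mathbb{R}I$, the face of $P$ maximizing $\mathbf{1}_S(x)=\sum_{s\in S}x_s$ is uniquely of the form $P|_S\cdot P/_S$ with $P|_S\subset\mathbb{R}S$ and $P/_S\subset\mathbb{R}T$ finite products of orbit polytopes, and the coproduct $\Delta_{S,T}$ is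 induced by $P\mapsto(P|_S,P/_S)$. These operations are well defined on normal equivalence classes. $\overline{\mathrm{OP}}[\varnothing]$ has one element, denoted $1$. Characters. A character $\zeta$ of $\overline{\mathrm{OP}}$ is a collection of maps $\zeta_I:\overline{\mathrm{OP}}[I]\to\Bbbk$, one for each finite set $I$, natural with respect to bijections (i.e. $\zeta_J\circ\overline{\mathrm{OP}}[\sigma]=\zeta_I$ for $\sigma:I\to J$), with $\zeta_\varnothing(1)=1$ and $\zeta_{S\sqcup T}(\mu_{S,T}(x,y))=\zeta_S(x)\zeta_T(y)$. The set $\mathbb{X}(\overline{\mathrm{OP}})$ of characters is a group under the convolution $(\zeta\star\psi)_I(x)=\sum_{I=S\sqcup T}\zeta_S(x|_S)\psi_T(x/_S)$, the sum being over all ordered pairs $(S,T)$ of disjoint, possibly empty, sets with union $I$, and $\Delta_{S,T}(x)=(x|_S,x/_S)$.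
   Formalization: The field is assumed to have characteristic 0; over any field of characteristic p > 0 the claim fails, since the character group has an element of order p while G has none. *)

theory Defs
  imports
    "HOL-Analysis.Analysis"
    "HOL-Analysis.Finite_Function_Topology"
    "HOL-Algebra.Group"
    "HOL-Algebra.Ring"
    "HOL-Library.Infinite_Typeclass"
begin

section \<open>Orbit polytopes and their products\<close>

text \<open>
  The finite label sets \<open>I\<close> are the finite subsets of an (infinite) label type \<open>'a\<close>.
  The space \<open>\<real>I\<close> with basis \<open>I\<close> is the subspace of the free real vector space
  \<open>'a fvec\<close> of vectors supported on \<open>I\<close>.  Thus for disjoint \<open>S\<close> and \<open>T\<close> the space
  \<open>\<real>(S \<union> T)\<close> is the internal direct sum of \<open>\<real>S\<close> and \<open>\<real>T\<close>, and \<open>(p, q)\<close> is \<open>p + q\<close>.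
\<close>

type_synonym 'a fvec = "('a, real) poly_mapping"

definition real_space :: "'a set \<Rightarrow> 'a fvec set" where
  "real_space I = {x. Poly_Mapping.keys x \<subseteq> I}"

text \<open>The linear extension of \<open>e\<^sub>i \<mapsto> e\<^bsub>\<sigma> i\<^esub>\<close>; for injective \<open>\<sigma>\<close> the coordinate of the image
  at \<open>\<sigma> i\<close> is the coordinate of \<open>p\<close> at \<open>i\<close>.\<close>

definition relabel :: "('a \<Rightarrow> 'a) \<Rightarrow> 'a fvec \<Rightarrow> 'a fvec" where
  "relabel \<sigma> p = (\<Sum>i\<in>Poly_Mapping.keys p. Poly_Mapping.single (\<sigma> i) (Poly_Mapping.lookup p i))"

definition orbit_polytope :: "'a set \<Rightarrow> 'a fvec \<Rightarrow> 'a fvec set" where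
  "orbit_polytope I p = convex hull {relabel \<sigma> p |\<sigma>. \<sigma> permutes I}"

definition polytope_prod :: "'a fvec set \<Rightarrow> 'a fvec set \<Rightarrow> 'a fvec set" where
  "polytope_prod P Q = {p + q |p q. p \<in> P \<and> q \<in> Q}"

text \<open>The empty product is the point \<open>{0}\<close> in \<open>\<real>\<emptyset>\<close>, which is the orbit polytope of \<open>0\<close>.\<close>

inductive orbit_product :: "'a set \<Rightarrow> 'a fvec set \<Rightarrow> bool" where
  orbit: "finite I \<Longrightarrow> p \<in> real_space I \<Longrightarrow> orbit_product I (orbit_polytope I p)"
| prod: "orbit_product S P \<Longrightarrow> orbit_product T Q \<Longrightarrow> S \<inter> T = {} \<Longrightarrow>
    orbit_product (S \<union> T) (polytope_prod P Q)"

section \<open>Normal equivalence\<close>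

text \<open>The dual space \<open>\<real>\<^sup>I\<close> consists of the functions \<open>y \<in> I \<rightarrow>\<^sub>E UNIV\<close>.\<close>

definition pairing :: "'a set \<Rightarrow> ('a \<Rightarrow> real) \<Rightarrow> 'a fvec \<Rightarrow> real" where
  "pairing I y x = (\<Sum>i\<in>I. y i * Poly_Mapping.lookup x i)"

definition normal_cone ::
    "'a set \<Rightarrow> 'a fvec set \<Rightarrow> 'a fvec set \<Rightarrow> ('a \<Rightarrow> real) set" where
  "normal_cone I P F =
     {y \<in> I \<rightarrow>\<^sub>E UNIV. \<forall>x\<in>F. \<forall>z\<in>P. pairing I y z \<le> pairing I y x}"

definition normal_fan :: "'a set \<Rightarrow> 'a fvec set \<Rightarrow> ('a \<Rightarrow> real) set set" where
  "normal_fan I P = {normal_cone I P F |F. F face_of P \<and> F \<noteq> {}}"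

definition normal_equiv :: "'a set \<Rightarrow> ('a fvec set \<times> 'a fvec set) set" where
  "normal_equiv I =
     {(P, Q). orbit_product I P \<and> orbit_product I Q \<and> normal_fan I P = normal_fan I Q}"

section \<open>The Hopf monoid of orbit polytopes\<close>

definition OP :: "'a set \<Rightarrow> 'a fvec set set set" where
  "OP I = {P. orbit_product I P} // normal_equiv I"

abbreviation OP_class :: "'a set \<Rightarrow> 'a fvec set \<Rightarrow> 'a fvec set set" where
  "OP_class I P \<equiv> normal_equiv I `` {P}"

text \<open>Operations on classes are unions, over the representatives, of the classes of the
  results; as the operations on polytopes respect normal equivalence, each union is over
  equal classes.\<close>

definition OP_relabel ::
    "('a \<Rightarrow> 'a) \<Rightarrow> 'a set \<Rightarrow> 'a fvec set set \<Rightarrow> 'a fvec set set" where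
  "OP_relabel \<sigma> J X = (\<Union>P\<in>X. OP_class J (relabel \<sigma> ` P))"

definition OP_one :: "'a fvec set set" where
  "OP_one = OP_class {} {0}"

definition OP_mult ::
    "'a set \<Rightarrow> 'a set \<Rightarrow> 'a fvec set set \<Rightarrow> 'a fvec set set \<Rightarrow> 'a fvec set set" where
  "OP_mult S T X Y = (\<Union>P\<in>X. \<Union>Q\<in>Y. OP_class (S \<union> T) (polytope_prod P Q))"

definition max_face :: "'a set \<Rightarrow> 'a fvec set \<Rightarrow> 'a fvec set" where
  "max_face S P =
     {x \<in> P. \<forall>z\<in>P. (\<Sum>s\<in>S. Poly_Mapping.lookup z s) \<le> (\<Sum>s\<in>S. Poly_Mapping.lookup x s)}"

text \<open>The pair \<open>(P|\<^sub>S, P/\<^sub>S)\<close>.\<close>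

definition face_factors ::
    "'a set \<Rightarrow> 'a set \<Rightarrow> 'a fvec set \<Rightarrow> 'a fvec set \<times> 'a fvec set" where
  "face_factors S T P =
     (THE AB. orbit_product S (fst AB) \<and> orbit_product T (snd AB) \<and>
        max_face S P = polytope_prod (fst AB) (snd AB))"

definition OP_comult ::
    "'a set \<Rightarrow> 'a set \<Rightarrow> 'a fvec set set \<Rightarrow> 'a fvec set set \<times> 'a fvec set set" where
  "OP_comult S T X =
     (\<Union>P\<in>X. OP_class S (fst (face_factors S T P)),
      \<Union>P\<in>X. OP_class T (snd (face_factors S T P)))"

section \<open>The character group\<close>

text \<open>A collection of maps \<open>\<zeta>\<^sub>I : OP I \<rightarrow> 'k\<close>, one for each finite \<open>I\<close>; extensionality makes
  equality of collections coincide with equality in HOL.\<close>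

type_synonym ('a, 'k) collection = "'a set \<Rightarrow> 'a fvec set set \<Rightarrow> 'k"

definition characters :: "('a, 'k::field) collection set" where
  "characters =
     {\<zeta> \<in> (\<Pi>\<^sub>E I\<in>{I. finite I}. OP I \<rightarrow>\<^sub>E UNIV).
        (\<forall>I J \<sigma>. finite I \<longrightarrow> bij_betw \<sigma> I J \<longrightarrow>
           (\<forall>X\<in>OP I. \<zeta> J (OP_relabel \<sigma> J X) = \<zeta> I X)) \<and>
        \<zeta> {} OP_one = 1 \<and>
        (\<forall>S T. finite S \<longrightarrow> finite T \<longrightarrow> S \<inter> T = {} \<longrightarrow>
           (\<forall>X\<in>OP S. \<forall>Y\<in>OP T. \<zeta> (S \<union> T) (OP_mult S T X Y) = \<zeta> S X * \<zeta> T Y))}"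

definition convolution ::
    "('a, 'k::field) collection \<Rightarrow> ('a, 'k) collection \<Rightarrow> ('a, 'k) collection" where
  "convolution \<zeta> \<psi> =
     (\<lambda>I\<in>{I. finite I}. \<lambda>X\<in>OP I.
        \<Sum>(S, T)\<in>{(S, T). S \<union> T = I \<and> S \<inter> T = {}}.
          \<zeta> S (fst (OP_comult S T X)) * \<psi> T (snd (OP_comult S T X)))"

definition counit :: "('a, 'k::field) collection" where
  "counit = (\<lambda>I\<in>{I. finite I}. \<lambda>X\<in>OP I. if I = {} then 1 else 0)"

definition character_group :: "('a, 'k::field) collection monoid" where
  "character_group = \<lparr>carrier = characters, mult = convolution, one = counit\<rparr>"

section \<open>The completion of the noncommutative symmetric functions\<close>

definition composition :: "nat list \<Rightarrow> bool" where
  "composition \<alpha> \<longleftrightarrow> (\<forall>a\<in>set \<alpha>. 0 < a)"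

definition near_concat :: "nat list \<Rightarrow> nat list \<Rightarrow> nat list" where
  "near_concat \<beta> \<gamma> = butlast \<beta> @ [last \<beta> + hd \<gamma>] @ tl \<gamma>"

text \<open>The formal sum \<open>\<Sum>\<^sub>\<alpha> c\<^sub>\<alpha> R\<^sub>\<alpha>\<close> is the coefficient function \<open>c\<close>, zero off compositions.\<close>

definition ribbon :: "nat list \<Rightarrow> nat list \<Rightarrow> 'k::field" where
  "ribbon \<beta> = (\<lambda>\<alpha>. if \<alpha> = \<beta> then 1 else 0)"

definition ribbon_prod :: "nat list \<Rightarrow> nat list \<Rightarrow> nat list \<Rightarrow> 'k::field" where
  "ribbon_prod \<beta> \<gamma> =
     (if \<beta> = [] then ribbon \<gamma>
      else if \<gamma> = [] then ribbon \<beta>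
      else (\<lambda>\<alpha>. ribbon (\<beta> @ \<gamma>) \<alpha> + ribbon (near_concat \<beta> \<gamma>) \<alpha>))"

text \<open>As \<open>R\<^sub>\<beta> R\<^sub>\<gamma>\<close> is homogeneous of degree \<open>|\<beta>| + |\<gamma>|\<close>, only the finitely many pairs with
  \<open>|\<beta>| + |\<gamma>| = |\<alpha>|\<close> contribute to the coefficient of \<open>R\<^sub>\<alpha>\<close> in the product.\<close>

definition NSym_mult ::
    "(nat list \<Rightarrow> 'k::field) \<Rightarrow> (nat list \<Rightarrow> 'k) \<Rightarrow> (nat list \<Rightarrow> 'k)" where
  "NSym_mult c d =
     (\<lambda>\<alpha>. \<Sum>(\<beta>, \<gamma>)\<in>{(\<beta>, \<gamma>). composition \<beta> \<and> composition \<gamma> \<and>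
              sum_list \<beta> + sum_list \<gamma> = sum_list \<alpha>}.
        c \<beta> * d \<gamma> * ribbon_prod \<beta> \<gamma> \<alpha>)"

definition NSym_completion :: "(nat list \<Rightarrow> 'k::field) ring" where
  "NSym_completion =
     \<lparr>carrier = {c. \<forall>\<alpha>. \<not> composition \<alpha> \<longrightarrow> c \<alpha> = 0},
      mult = NSym_mult,
      one = ribbon [],
      zero = (\<lambda>\<alpha>. 0),
      add = (\<lambda>c d \<alpha>. c \<alpha> + d \<alpha>)\<rparr>"

text \<open>Over a field of characteristic \<open>p > 0\<close> this group is not isomorphic to the character
  group.  It has no element of order \<open>p\<close>, because \<open>(1 + x)\<^sup>p = 1 + x\<^sup>p\<close> and the completion has
  no zero divisors.  However, the character that is \<open>1\<close> on the segment (the orbit polytope of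
  \<open>e\<^sub>i\<close> in \<open>\<real>{i, j}\<close>) and \<open>0\<close> on all other product-indecomposable classes has order \<open>p\<close>,
  because \<open>p\<close> divides \<open>(2p)!/2\<^sup>p\<close>.\<close>

definition NSym_group :: "(nat list \<Rightarrow> 'k::field) monoid" where
  "NSym_group =
     \<lparr>carrier = {c \<in> Units NSym_completion.
         c [] = 1 \<and> (\<forall>n>1. of_nat (fact n) * c [n] = c [1] ^ n)},
      mult = mult NSym_completion,
      one = one NSym_completion\<rparr>"

end

theory Submission
  imports Defs
begin

text \<open>
  A product of orbit polytopes is the convex hull of the orbit of one vector \<open>f\<close> under a Young
  subgroup, that is, under the permutations preserving each block of an equivalence relation \<open>r\<close>.
  A vertex \<open>g\<close> maximises a functional \<open>y\<close> iff, within each block, larger coordinates of \<open>g\<close> sit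
  at larger values of \<open>y\<close>. Since every face is exposed, the normal fan is equivalent to the relation
  between functionals ``the maximal face of \<open>y\<close> is contained in that of \<open>y'\<close>'', and for this relation
  all operations of the Hopf monoid are easy to follow. The strict submodular inequalities, which can
  be read off this relation, recover the blocks on which \<open>f\<close> is not constant and the composition of
  \<open>f\<close> on each of them; on a block where \<open>f\<close> is constant the polytope is a product of points.

  A character is therefore determined by its values on orbit polytopes, i.e. by a function on
  compositions whose value at \<open>(n)\<close> is the \<open>n\<close>-th power of its value at \<open>(1)\<close>. The coproduct
  \<open>\<Delta>\<^bsub>S,T\<^esub>\<close> cuts a composition of \<open>n\<close> after \<open>|S|\<close> boxes, so the convolution sums over all cuts with
  binomial weights; dividing the value at a composition of \<open>n\<close> by \<open>n!\<close> removes the weights and leaves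
  the product of ribbon functions.
\<close>

section \<open>Rearrangements within blocks\<close>

text \<open>The map goes from series to characters. Its value at a class is a product over the
  blocks of any pair \<open>(r, f)\<close> representing the class, and such a pair is not unique:
  blocks on which \<open>f\<close> is constant can be merged or split without changing the fan. The
  condition n! c_(n) = c_(1)^n is what makes the product blind to this ambiguity, and it is forced,
  because a point in \<real>I is a product of points on single labels.

  A normal fan is a bare set of cones that does not record which face a cone belongs to, and the
  cones come from all nonempty faces. Hence faces must be shown to be exposed, and the preorder on
  functionals must be recovered from its up-sets alone.

  Characteristic zero enters through the division by n!. The group axioms for characters are not
  checked directly: they are transported from the series along a bijective homomorphism. For series,
  associativity says that repeated cuts are compatible, and inverses come from a recursion on the
  degree.\<close>

definition shuffle :: "'a set \<Rightarrow> 'a rel \<Rightarrow> ('a \<Rightarrow> 'b) \<Rightarrow> ('a \<Rightarrow> 'b) \<Rightarrow> bool" where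
  "shuffle I r g f \<longleftrightarrow>
     (\<exists>\<sigma>. \<sigma> permutes I \<and> (\<forall>i\<in>I. (i, \<sigma> i) \<in> r) \<and> (\<forall>i\<in>I. g i = f (\<sigma> i)))"

definition sorted_by :: "'a rel \<Rightarrow> ('a \<Rightarrow> real) \<Rightarrow> ('a \<Rightarrow> real) \<Rightarrow> bool" where
  "sorted_by r g y \<longleftrightarrow> (\<forall>(i, j)\<in>r. g j < g i \<longrightarrow> y j \<le> y i)"

text \<open>The face of the polytope maximising \<open>y\<close> is contained in the face maximising \<open>y'\<close>.\<close>

definition dominates :: "'a set \<Rightarrow> 'a rel \<Rightarrow> ('a \<Rightarrow> real) \<Rightarrow> ('a \<Rightarrow> real) \<Rightarrow> ('a \<Rightarrow> real) \<Rightarrow> bool" where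
  "dominates I r f y y' \<longleftrightarrow> (\<forall>g. shuffle I r g f \<longrightarrow> sorted_by r g y \<longrightarrow> sorted_by r g y')"

lemma equiv_class_subset: "equiv I r \<Longrightarrow> r `` {a} \<subseteq> I"
  by (auto simp: equiv_def refl_on_def)

lemma equiv_refl: "equiv I r \<Longrightarrow> i \<in> I \<Longrightarrow> (i, i) \<in> r"
  by (auto simp: equiv_def refl_on_def)

lemma equiv_sym: "equiv I r \<Longrightarrow> (i, j) \<in> r \<Longrightarrow> (j, i) \<in> r"
  by (auto simp: equiv_def sym_def)

lemma equiv_trans: "equiv I r \<Longrightarrow> (i, j) \<in> r \<Longrightarrow> (j, k) \<in> r \<Longrightarrow> (i, k) \<in> r"
  by (auto simp: equiv_def trans_def)

lemma equiv_mem: "equiv I r \<Longrightarrow> (i, j) \<in> r \<Longrightarrow> i \<in> I \<and> j \<in> I"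
  by (auto simp: equiv_def refl_on_def)

lemma equiv_level:
  assumes "equiv I r" shows "equiv I (r \<inter> {(i, j). y i = y j})"
proof (rule equivI)
  show "r \<inter> {(i, j). y i = y j} \<subseteq> I \<times> I" using equiv_mem[OF assms] by auto
  show "refl_on I (r \<inter> {(i, j). y i = y j})" using equiv_refl[OF assms] by (auto simp: refl_on_def)
  show "sym (r \<inter> {(i, j). y i = y j})" using equiv_sym[OF assms] by (auto simp: sym_def)
  show "trans (r \<inter> {(i, j). y i = y j})" using equiv_trans[OF assms] by (auto simp: trans_def)
qed

lemma shuffle_refl: "equiv I r \<Longrightarrow> shuffle I r f f"
  unfolding shuffle_def by (rule exI[of _ id]) (auto simp: permutes_id equiv_refl)

lemma shuffle_sym:
  assumes "equiv I r" "shuffle I r g f" shows "shuffle I r f g"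
proof -
  obtain \<sigma> where s: "\<sigma> permutes I" "\<forall>i\<in>I. (i, \<sigma> i) \<in> r" "\<forall>i\<in>I. g i = f (\<sigma> i)"
    using assms(2) unfolding shuffle_def by blast
  show ?thesis unfolding shuffle_def
  proof (intro exI conjI ballI)
    show "Hilbert_Choice.inv \<sigma> permutes I" using s(1) by (rule permutes_inv)
    fix i assume i: "i \<in> I"
    then have "Hilbert_Choice.inv \<sigma> i \<in> I" by (simp add: permutes_in_image[OF permutes_inv[OF s(1)]])
    moreover have "\<sigma> (Hilbert_Choice.inv \<sigma> i) = i" using s(1) by (simp add: permutes_inverses)
    ultimately show "(i, Hilbert_Choice.inv \<sigma> i) \<in> r" "f i = g (Hilbert_Choice.inv \<sigma> i)"
      using s(2,3) equiv_sym[OF assms(1)] by metis+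
  qed
qed

lemma shuffle_trans:
  assumes "equiv I r" "shuffle I r h g" "shuffle I r g f" shows "shuffle I r h f"
proof -
  obtain \<sigma> where s: "\<sigma> permutes I" "\<forall>i\<in>I. (i, \<sigma> i) \<in> r" "\<forall>i\<in>I. h i = g (\<sigma> i)"
    using assms(2) unfolding shuffle_def by blast
  obtain \<tau> where t: "\<tau> permutes I" "\<forall>i\<in>I. (i, \<tau> i) \<in> r" "\<forall>i\<in>I. g i = f (\<tau> i)"
    using assms(3) unfolding shuffle_def by blast
  show ?thesis unfolding shuffle_def
  proof (intro exI conjI ballI)
    show "\<tau> \<circ> \<sigma> permutes I" using s(1) t(1) by (rule permutes_compose)
    fix i assume i: "i \<in> I"
    then have "\<sigma> i \<in> I" by (simp add: permutes_in_image[OF s(1)])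
    then show "(i, (\<tau> \<circ> \<sigma>) i) \<in> r" "h i = f ((\<tau> \<circ> \<sigma>) i)"
      using s(2,3) t(2,3) equiv_trans[OF assms(1)] i by auto
  qed
qed

text \<open>A permutation preserving the classes maps the finite class of \<open>a\<close>
  injectively into itself, hence onto itself. The predicate \<open>Q\<close> is arbitrary so that
  exact values and thresholds are both covered.\<close>

lemma shuffle_card:
  assumes "finite I" "equiv I r" "shuffle I r g f"
  shows "card {b \<in> r `` {a}. Q (g b)} = card {b \<in> r `` {a}. Q (f b)}"
proof -
  obtain \<sigma> where s: "\<sigma> permutes I" "\<forall>i\<in>I. (i, \<sigma> i) \<in> r" "\<forall>i\<in>I. g i = f (\<sigma> i)"
    using assms(3) unfolding shuffle_def by blast
  have sub: "r `` {a} \<subseteq> I" using assms(2) by (rule equiv_class_subset)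
  have inj: "inj_on \<sigma> (r `` {a})" using permutes_inj[OF s(1)] by (simp add: inj_on_def)
  have "\<sigma> ` (r `` {a}) \<subseteq> r `` {a}" using sub s(2) equiv_trans[OF assms(2)] by blast
  then have im: "\<sigma> ` (r `` {a}) = r `` {a}"
    by (rule endo_inj_surj[OF finite_subset[OF sub assms(1)] _ inj])
  have "\<sigma> ` {b \<in> r `` {a}. Q (g b)} = {b \<in> r `` {a}. Q (f b)}"
  proof (rule Set.set_eqI)
    fix b
    have "b \<in> \<sigma> ` {b \<in> r `` {a}. Q (g b)} \<longleftrightarrow> b \<in> \<sigma> ` (r `` {a}) \<and> Q (f b)"
      using s(3) sub by (auto simp: subset_iff)
    then show "b \<in> \<sigma> ` {b \<in> r `` {a}. Q (g b)} \<longleftrightarrow> b \<in> {b \<in> r `` {a}. Q (f b)}"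
      using im by auto
  qed
  then show ?thesis using card_image[of \<sigma> "{b \<in> r `` {a}. Q (g b)}"] inj
    by (metis (no_types, lifting) inj_on_subset mem_Collect_eq subsetI)
qed

text \<open>Tagging each label with the pair of its class and its value turns the blockwise counts
  into one equality of multisets. A permutation of \<open>I\<close> matching the tags respects
  classes because the class is part of the tag.\<close>

lemma shuffleI_card:
  assumes I: "finite I" "equiv I r"
    and c: "\<And>a x. a \<in> I \<Longrightarrow> card {b \<in> r `` {a}. g b = x} = card {b \<in> r `` {a}. f b = x}"
  shows "shuffle I r g f"
proof -
  let ?G = "\<lambda>a. (r `` {a}, g a)" and ?F = "\<lambda>a. (r `` {a}, f a)"
  have *: "{a \<in> I. (r `` {a}, h a) = (r `` {a0}, x)} = {b \<in> r `` {a0}. h b = x}" if "a0 \<in> I" for h :: "'a \<Rightarrow> 'b" and a0 x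
    using that I(2) equiv_class_eq_iff[OF I(2)] by auto
  have "image_mset ?G (mset_set I) = image_mset ?F (mset_set I)"
  proof (rule multiset_eqI)
    fix z :: "'a set \<times> 'b"
    obtain B x where z: "z = (B, x)" by (cases z)
    have "card {a \<in> I. ?G a = z} = card {a \<in> I. ?F a = z}"
    proof (cases "\<exists>a0\<in>I. B = r `` {a0}")
      case True
      then obtain a0 where a0: "a0 \<in> I" "B = r `` {a0}" by blast
      show ?thesis unfolding z a0(2) *[OF a0(1)] by (rule c[OF a0(1)])
    next
      case False
      then have "{a \<in> I. ?G a = z} = {}" "{a \<in> I. ?F a = z} = {}" unfolding z by auto
      then show ?thesis by (simp only:)
    qed
    moreover have "{x. x \<in> I \<and> z = h x} = {a \<in> I. h a = z}" for h by auto
    ultimately show "count (image_mset ?G (mset_set I)) z = count (image_mset ?F (mset_set I)) z"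
      using I(1) by (simp add: count_image_mset' del: prod.inject)
  qed
  then obtain \<sigma> where s: "\<sigma> permutes I" "\<forall>x\<in>I. ?G x = ?F (\<sigma> x)"
    using image_mset_eq_implies_permutes[OF I(1)] by blast
  show ?thesis unfolding shuffle_def
  proof (intro exI conjI ballI)
    show "\<sigma> permutes I" by fact
    fix i assume i: "i \<in> I"
    then have "\<sigma> i \<in> I" by (simp add: permutes_in_image[OF s(1)])
    then show "(i, \<sigma> i) \<in> r" using s(2) i equiv_class_eq_iff[OF I(2)] by auto
    show "g i = f (\<sigma> i)" using s(2) i by auto
  qed
qed

lemma shuffle_cong:
  assumes "\<And>i. i \<in> I \<Longrightarrow> g i = g' i" "\<And>i. i \<in> I \<Longrightarrow> f i = f' i"
  shows "shuffle I r g f \<longleftrightarrow> shuffle I r g' f'"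
  unfolding shuffle_def using assms permutes_in_image by (smt (verit, best))

lemma shuffle_transpose:
  assumes r: "equiv I r" and ij: "(i, j) \<in> r"
  shows "shuffle I r (g \<circ> Transposition.transpose i j) g"
  unfolding shuffle_def
proof (intro exI conjI ballI)
  have mem: "i \<in> I" "j \<in> I" using equiv_mem[OF r ij] by auto
  then show "Transposition.transpose i j permutes I" by (rule permutes_swap_id)
  fix k assume "k \<in> I"
  then show "(k, Transposition.transpose i j k) \<in> r"
    using ij equiv_sym[OF r ij] equiv_refl[OF r] by (auto simp: Transposition.transpose_def)
qed auto

lemma sorted_by_cong:
  assumes "r \<subseteq> I \<times> I" "\<And>i. i \<in> I \<Longrightarrow> g i = g' i" "\<And>i. i \<in> I \<Longrightarrow> y i = y' i"
  shows "sorted_by r g y \<longleftrightarrow> sorted_by r g' y'"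
proof -
  have "(g j < g i \<longrightarrow> y j \<le> y i) \<longleftrightarrow> (g' j < g' i \<longrightarrow> y' j \<le> y' i)" if "(i, j) \<in> r" for i j
    using assms that by (metis (no_types, lifting) mem_Sigma_iff subsetD)
  then show ?thesis unfolding sorted_by_def by (intro ball_cong) auto
qed

text \<open>Either \<open>Q\<close> holds on all of \<open>U\<close>, or no element outside
  \<open>U\<close> satisfies \<open>Q\<close>; the minimum records both cases.\<close>

lemma card_upper_set_threshold:
  assumes "finite B" "U \<subseteq> B" "\<And>a b. a \<in> U \<Longrightarrow> b \<in> B - U \<Longrightarrow> Q b \<Longrightarrow> Q a"
  shows "card {b \<in> U. Q b} = min (card U) (card {b \<in> B. Q b})"
proof (cases "\<forall>a\<in>U. Q a")
  case True
  then have "{b \<in> U. Q b} = U" by auto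
  moreover have "card {b \<in> U. Q b} \<le> card {b \<in> B. Q b}"
    using assms(1,2) by (intro card_mono) auto
  ultimately show ?thesis by simp
next
  case False
  then have "{b \<in> U. Q b} = {b \<in> B. Q b}" using assms(2,3) by blast
  moreover have "card {b \<in> U. Q b} \<le> card U"
    using assms(1,2) by (intro card_mono) (auto intro: finite_subset)
  ultimately show ?thesis by simp
qed

text \<open>Two arrangements that are both sorted with respect to \<open>y\<close> agree, as multisets, on each
  level set of \<open>y\<close>: the counts on superlevel sets are forced by the total counts.\<close>

lemma shuffle_level:
  fixes u v :: "'a \<Rightarrow> real"
  assumes I: "finite I" "equiv I r"
    and uv: "shuffle I r u v" and cu: "sorted_by r u y" and cv: "sorted_by r v y"
  shows "shuffle I (r \<inter> {(i, j). y i = y j}) u v"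
proof (rule shuffleI_card[OF I(1)])
  show "equiv I (r \<inter> {(i, j). y i = y j})" by (rule equiv_level[OF I(2)])
  fix a x assume a: "a \<in> I"
  define B where "B = r `` {a}"
  have fB: "finite B" unfolding B_def
    by (rule finite_subset[OF equiv_class_subset[OF I(2)] I(1)])
  have BB: "(c, b) \<in> r" if "b \<in> B" "c \<in> B" for b c
    using that equiv_sym[OF I(2)] equiv_trans[OF I(2)] unfolding B_def by blast
  \<comment> \<open>\<open>R\<close> cuts out a superlevel set of \<open>y\<close> and
    \<open>Q\<close> one of the arrangement. Both range over upward closed predicates so that weak
    and strict thresholds, whose difference is a level set, are instances of one statement.\<close>
  have up: "card {b \<in> {b \<in> B. R (y b)}. Q (w b)} = min (card {b \<in> B. R (y b)}) (card {b \<in> B. Q (w b)})"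
    if cw: "sorted_by r w y" and mR: "\<And>s t. R s \<Longrightarrow> s \<le> t \<Longrightarrow> R t"
      and mQ: "\<And>s t. Q s \<Longrightarrow> s \<le> t \<Longrightarrow> Q t" for w R Q
  proof (rule card_upper_set_threshold[OF fB])
    fix c b assume c: "c \<in> {b \<in> B. R (y b)}" and b: "b \<in> B - {b \<in> B. R (y b)}" and Q: "Q (w b)"
    have "w b \<le> w c"
    proof (rule ccontr)
      assume "\<not> w b \<le> w c"
      then have "y c \<le> y b" using cw BB[of c b] c b unfolding sorted_by_def by auto
      then show False using mR c b by blast
    qed
    then show "Q (w c)" using Q mQ by blast
  qed auto
  have eqB: "card {b \<in> B. Q (u b)} = card {b \<in> B. Q (v b)}" for Q
    unfolding B_def by (rule shuffle_card[OF I uv])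
  have up2: "card {b \<in> B. R (y b) \<and> Q (u b)} = card {b \<in> B. R (y b) \<and> Q (v b)}"
    if mR: "\<And>s t. R s \<Longrightarrow> s \<le> t \<Longrightarrow> R t" and mQ: "\<And>s t. Q s \<Longrightarrow> s \<le> t \<Longrightarrow> Q t" for R Q
  proof -
    have "{b \<in> {b \<in> B. R (y b)}. Q (w b)} = {b \<in> B. R (y b) \<and> Q (w b)}" for w by auto
    then show ?thesis using up[OF cu, where R = R and Q = Q] up[OF cv, where R = R and Q = Q] mR mQ eqB[of Q] by simp
  qed
  define s where "s = y a"
  have split: "card {b \<in> B. P b} = card {b \<in> B. P' b} + card {b \<in> B. P b \<and> \<not> P' b}"
    if "\<And>b. P' b \<Longrightarrow> P b" for P P' :: "'a \<Rightarrow> bool"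
    using fB that by (subst card_Un_disjoint[symmetric]) (auto intro: arg_cong[where f=card])
  \<comment> \<open>The level set of \<open>y\<close> at \<open>s\<close> is the difference of its
    weak and strict superlevel sets. The same subtraction in the values of the arrangement below
    isolates the value \<open>x\<close>.\<close>
  have lev: "card {b \<in> B. y b = s \<and> Q (u b)} = card {b \<in> B. y b = s \<and> Q (v b)}"
    if mQ: "\<And>s t. Q s \<Longrightarrow> s \<le> t \<Longrightarrow> Q t" for Q
  proof -
    have "card {b \<in> B. s \<le> y b \<and> Q (w b)} =
      card {b \<in> B. s < y b \<and> Q (w b)} + card {b \<in> B. y b = s \<and> Q (w b)}" for w
      using split[of "\<lambda>b. s < y b \<and> Q (w b)" "\<lambda>b. s \<le> y b \<and> Q (w b)"]
      by (auto simp: order.order_iff_strict intro!: arg_cong[where f=card])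
    from this[of u] this[of v] show ?thesis
      using up2[of "\<lambda>t. s \<le> t" Q] up2[of "\<lambda>t. s < t" Q] mQ by simp
  qed
  have "card {b \<in> B. y b = s \<and> x \<le> w b} =
      card {b \<in> B. y b = s \<and> x < w b} + card {b \<in> B. y b = s \<and> w b = x}" for w :: "'a \<Rightarrow> real"
  proof -
    have "{b \<in> B. (y b = s \<and> x \<le> w b) \<and> \<not> (y b = s \<and> x < w b)} = {b \<in> B. y b = s \<and> w b = x}"
      by auto
    then show ?thesis
      using split[of "\<lambda>b. y b = s \<and> x < w b" "\<lambda>b. y b = s \<and> x \<le> w b"] by (simp only:) auto
  qed
  from this[of u] this[of v] have "card {b \<in> B. y b = s \<and> u b = x} = card {b \<in> B. y b = s \<and> v b = x}"
    using lev[of "\<lambda>t. x \<le> t"] lev[of "\<lambda>t. x < t"] by simp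
  moreover have "{b \<in> (r \<inter> {(i, j). y i = y j}) `` {a}. w b = x} = {b \<in> B. y b = s \<and> w b = x}" for w
    unfolding B_def s_def by auto
  ultimately show "card {b \<in> (r \<inter> {(i, j). y i = y j}) `` {a}. u b = x}
      = card {b \<in> (r \<inter> {(i, j). y i = y j}) `` {a}. v b = x}" by simp
qed

lemma sorted_by_shuffle_level:
  assumes "equiv I r" "sorted_by r v y" "shuffle I (r \<inter> {(i, j). y i = y j}) u v"
  shows "sorted_by r u y"
proof -
  obtain \<sigma> where s: "\<forall>i\<in>I. (i, \<sigma> i) \<in> r \<inter> {(i, j). y i = y j}" "\<forall>i\<in>I. u i = v (\<sigma> i)"
    using assms(3) unfolding shuffle_def by blast
  show ?thesis unfolding sorted_by_def
  proof (clarify)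
    fix i j assume ij: "(i, j) \<in> r" and l: "u j < u i"
    have m: "i \<in> I" "j \<in> I" using equiv_mem[OF assms(1) ij] by auto
    then have "(\<sigma> i, \<sigma> j) \<in> r"
      using s(1) ij equiv_sym[OF assms(1)] equiv_trans[OF assms(1)] by (metis IntE)
    moreover have "v (\<sigma> j) < v (\<sigma> i)" using s(2) m l by simp
    ultimately have "y (\<sigma> j) \<le> y (\<sigma> i)" using assms(2) unfolding sorted_by_def by blast
    then show "y j \<le> y i" using s(1) m by auto
  qed
qed

lemma shuffle_mono: "shuffle I r u v \<Longrightarrow> r \<subseteq> r' \<Longrightarrow> shuffle I r' u v"
  unfolding shuffle_def by blast

text \<open>The sorted arrangements form one orbit of the smaller group that also preserves the
  levels of \<open>y\<close>. Hence a maximal face is again a \<open>young_polytope\<close>, for a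
  finer relation.\<close>

lemma shuffle_level_iff:
  assumes I: "finite I" "equiv I r" and v: "shuffle I r v f" "sorted_by r v y"
  shows "shuffle I (r \<inter> {(i, j). y i = y j}) u v \<longleftrightarrow> shuffle I r u f \<and> sorted_by r u y"
  using shuffle_level[OF I _ _ v(2)] sorted_by_shuffle_level[OF I(2) v(2)] shuffle_mono[of I _ u v r]
    shuffle_trans[OF I(2)] shuffle_sym[OF I(2)] v(1) by blast

section \<open>The rearrangement inequality within blocks\<close>

lemma sum_transpose_diff:
  fixes y g :: "'a \<Rightarrow> real"
  assumes "finite I" "i \<in> I" "j \<in> I"
  shows "(\<Sum>k\<in>I. y k * (g \<circ> Transposition.transpose i j) k) = (\<Sum>k\<in>I. y k * g k) + (y i - y j) * (g j - g i)"
proof (cases "i = j")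
  case False
  have "I = insert i (insert j (I - {i, j}))" using assms by auto
  then obtain J where J: "I = insert i (insert j J)" "i \<notin> J" "j \<notin> J" "finite J"
    using assms(1) by (metis DiffD2 finite_Diff insertI1 insertI2)
  have "(\<Sum>k\<in>J. y k * (g \<circ> Transposition.transpose i j) k) = (\<Sum>k\<in>J. y k * g k)"
    using J by (intro sum.cong) (auto simp: Transposition.transpose_def)
  then show ?thesis using J False by (simp add: algebra_simps)
qed simp

text \<open>Swapping an out-of-order pair would strictly increase the pairing, by the product of the
  two differences.\<close>

lemma maximal_imp_sorted_by:
  fixes y g :: "'a \<Rightarrow> real"
  assumes I: "finite I" "equiv I r"
    and m: "\<And>h. shuffle I r h g \<Longrightarrow> (\<Sum>i\<in>I. y i * h i) \<le> (\<Sum>i\<in>I. y i * g i)"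
  shows "sorted_by r g y"
  unfolding sorted_by_def
proof (clarify, rule ccontr)
  fix i j assume ij: "(i, j) \<in> r" "g j < g i" "\<not> y j \<le> y i"
  have "(\<Sum>k\<in>I. y k * g k) + (y i - y j) * (g j - g i) \<le> (\<Sum>k\<in>I. y k * g k)"
    using m[OF shuffle_transpose[OF I(2) ij(1)]] sum_transpose_diff[of I i j y g] I(1)
      equiv_mem[OF I(2) ij(1)] by simp
  moreover have "(y i - y j) * (g j - g i) > 0" using ij by (intro mult_neg_neg) auto
  ultimately show False by linarith
qed

lemma finite_max_exists:
  fixes F :: "'b \<Rightarrow> 'c::linorder"
  assumes "finite A" "A \<noteq> {}" obtains a where "a \<in> A" "\<And>b. b \<in> A \<Longrightarrow> F b \<le> F a"
proof -
  have "Max (F ` A) \<in> F ` A" using assms by (intro Max_in) auto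
  then obtain a where "a \<in> A" "F a = Max (F ` A)" by (metis imageE)
  then show ?thesis using that[of a] assms(1) by simp
qed

lemma maximal_shuffle_exists:
  fixes y f :: "'a \<Rightarrow> real"
  assumes I: "finite I" "equiv I r"
  obtains g where "shuffle I r g f" "\<And>h. shuffle I r h f \<Longrightarrow> (\<Sum>i\<in>I. y i * h i) \<le> (\<Sum>i\<in>I. y i * g i)"
proof -
  let ?A = "{\<sigma>. \<sigma> permutes I \<and> (\<forall>i\<in>I. (i, \<sigma> i) \<in> r)}"
  let ?F = "\<lambda>\<sigma>. \<Sum>i\<in>I. y i * f (\<sigma> i)"
  have "finite ?A" using finite_permutations[OF I(1)] by simp
  moreover have "id \<in> ?A" by (auto simp: permutes_id equiv_refl[OF I(2)])
  ultimately obtain \<sigma> where s: "\<sigma> \<in> ?A" "\<And>\<tau>. \<tau> \<in> ?A \<Longrightarrow> ?F \<tau> \<le> ?F \<sigma>"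
    using finite_max_exists[of ?A ?F] by blast
  show ?thesis
  proof (rule that[of "f \<circ> \<sigma>"])
    show "shuffle I r (f \<circ> \<sigma>) f" using s(1) unfolding shuffle_def by auto
    fix h assume "shuffle I r h f"
    then obtain \<tau> where t: "\<tau> \<in> ?A" "\<forall>i\<in>I. h i = f (\<tau> i)" unfolding shuffle_def by blast
    have "(\<Sum>i\<in>I. y i * h i) = ?F \<tau>" using t(2) by (intro sum.cong) auto
    then show "(\<Sum>i\<in>I. y i * h i) \<le> (\<Sum>i\<in>I. y i * (f \<circ> \<sigma>) i)" using s(2)[OF t(1)] by simp
  qed
qed

lemma sorted_by_exists:
  fixes y f :: "'a \<Rightarrow> real"
  assumes I: "finite I" "equiv I r"
  obtains g where "shuffle I r g f" "sorted_by r g y"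
proof -
  obtain g where g: "shuffle I r g f" "\<And>h. shuffle I r h f \<Longrightarrow> (\<Sum>i\<in>I. y i * h i) \<le> (\<Sum>i\<in>I. y i * g i)"
    using maximal_shuffle_exists[OF I] by blast
  then have "sorted_by r g y" using maximal_imp_sorted_by[OF I] shuffle_trans[OF I(2)] by blast
  with g(1) show ?thesis by (rule that)
qed

lemma shuffle_level_sum:
  fixes y v :: "'a \<Rightarrow> real"
  assumes "shuffle I (r \<inter> {(i, j). y i = y j}) u v"
  shows "(\<Sum>i\<in>I. y i * u i) = (\<Sum>i\<in>I. y i * v i)"
proof -
  obtain \<sigma> where s: "\<sigma> permutes I" "\<forall>i\<in>I. (i, \<sigma> i) \<in> r \<inter> {(i, j). y i = y j}" "\<forall>i\<in>I. u i = v (\<sigma> i)"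
    using assms unfolding shuffle_def by blast
  have "(\<Sum>i\<in>I. y i * u i) = (\<Sum>i\<in>I. y (\<sigma> i) * v (\<sigma> i))" using s by (intro sum.cong) auto
  also have "\<dots> = (\<Sum>i\<in>I. y i * v i)" using sum.permute[OF s(1), of "\<lambda>i. y i * v i"] by (simp add: o_def)
  finally show ?thesis .
qed

text \<open>For the converse, a local optimum is global: a true maximiser is also sorted, so it
  agrees with \<open>g\<close> up to permutations inside the levels of \<open>y\<close>, and these
  do not change the pairing.\<close>

lemma maximal_iff_sorted_by:
  fixes y g :: "'a \<Rightarrow> real"
  assumes I: "finite I" "equiv I r" and g: "shuffle I r g f"
  shows "(\<forall>h. shuffle I r h f \<longrightarrow> (\<Sum>i\<in>I. y i * h i) \<le> (\<Sum>i\<in>I. y i * g i)) \<longleftrightarrow> sorted_by r g y"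
proof
  assume "\<forall>h. shuffle I r h f \<longrightarrow> (\<Sum>i\<in>I. y i * h i) \<le> (\<Sum>i\<in>I. y i * g i)"
  then show "sorted_by r g y"
    using maximal_imp_sorted_by[OF I] shuffle_trans[OF I(2)] g by blast
next
  assume c: "sorted_by r g y"
  obtain k where k: "shuffle I r k f" "\<And>h. shuffle I r h f \<Longrightarrow> (\<Sum>i\<in>I. y i * h i) \<le> (\<Sum>i\<in>I. y i * k i)"
    using maximal_shuffle_exists[OF I] by blast
  then have "sorted_by r k y" using maximal_imp_sorted_by[OF I] shuffle_trans[OF I(2)] by blast
  then have "shuffle I (r \<inter> {(i, j). y i = y j}) k g"
    using shuffle_level_iff[OF I g c] k(1) by blast
  then have "(\<Sum>i\<in>I. y i * k i) = (\<Sum>i\<in>I. y i * g i)" by (rule shuffle_level_sum)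
  then show "\<forall>h. shuffle I r h f \<longrightarrow> (\<Sum>i\<in>I. y i * h i) \<le> (\<Sum>i\<in>I. y i * g i)"
    using k(2) by simp
qed

section \<open>Maximal faces of convex hulls\<close>

abbreviation "lookup \<equiv> Poly_Mapping.lookup"

definition point :: "'a set \<Rightarrow> ('a \<Rightarrow> real) \<Rightarrow> 'a fvec" where
  "point I g = (\<Sum>i\<in>I. Poly_Mapping.single i (g i))"

definition young :: "'a set \<Rightarrow> 'a rel \<Rightarrow> ('a \<Rightarrow> real) \<Rightarrow> 'a fvec set" where
  "young I r f = {point I g |g. shuffle I r g f}"

definition young_polytope :: "'a set \<Rightarrow> 'a rel \<Rightarrow> ('a \<Rightarrow> real) \<Rightarrow> 'a fvec set" where
  "young_polytope I r f = convex hull (young I r f)"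

definition maxs :: "'b set \<Rightarrow> ('b \<Rightarrow> real) \<Rightarrow> 'b set" where
  "maxs P \<phi> = {x \<in> P. \<forall>z\<in>P. \<phi> z \<le> \<phi> x}"

lemma lookup_point: "finite I \<Longrightarrow> lookup (point I g) i = (if i \<in> I then g i else 0)"
  by (simp add: point_def lookup_sum lookup_single when_def)

lemma point_cong: "(\<And>i. i \<in> I \<Longrightarrow> g i = h i) \<Longrightarrow> point I g = point I h"
  by (simp add: point_def)

lemma point_in_real_space: "finite I \<Longrightarrow> point I g \<in> real_space I"
  by (auto simp: real_space_def in_keys_iff lookup_point split: if_splits)

lemma real_space_lookup: "p \<in> real_space I \<Longrightarrow> i \<notin> I \<Longrightarrow> lookup p i = 0"
  by (auto simp: real_space_def in_keys_iff)

lemma point_lookup: "finite I \<Longrightarrow> p \<in> real_space I \<Longrightarrow> point I (lookup p) = p"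
  by (rule poly_mapping_eqI) (auto simp: lookup_point real_space_lookup)

lemma lookup_scaleR: "lookup (c *\<^sub>R x) i = c * lookup x i"
proof -
  have "finite {i. c *\<^sub>R lookup x i \<noteq> 0}"
    by (rule finite_subset[OF _ finite_lookup[of x]]) auto
  then show ?thesis
    unfolding scaleR_poly_mapping_def by (subst Abs_poly_mapping_inverse) auto
qed

lemma pairing_add: "pairing I y (a + b) = pairing I y a + pairing I y b"
  by (simp add: pairing_def lookup_add algebra_simps sum.distrib)

lemma pairing_scaleR: "pairing I y (c *\<^sub>R a) = c * pairing I y a"
  by (simp add: pairing_def lookup_scaleR algebra_simps sum_distrib_left)

lemma linear_pairing: "linear (pairing I y)"
  by (rule linearI) (simp_all add: pairing_add pairing_scaleR)

lemma pairing_point: "finite I \<Longrightarrow> pairing I y (point I g) = (\<Sum>i\<in>I. y i * g i)"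
  by (simp add: pairing_def lookup_point)

lemma pairing_cong: "(\<And>i. i \<in> I \<Longrightarrow> y i = y' i) \<Longrightarrow> pairing I y x = pairing I y' x"
  by (simp add: pairing_def)

lemma young_lookup:
  assumes "finite I" "v \<in> young I r f"
  shows "shuffle I r (lookup v) f" "point I (lookup v) = v"
proof -
  obtain g where g: "v = point I g" "shuffle I r g f" using assms(2) by (auto simp: young_def)
  show "point I (lookup v) = v" unfolding g(1) by (rule point_lookup[OF assms(1) point_in_real_space[OF assms(1)]])
  show "shuffle I r (lookup v) f"
    using g(2) by (subst shuffle_cong[of I _ g _ f]) (auto simp: g(1) lookup_point[OF assms(1)])
qed

lemma finite_young: assumes "finite I" shows "finite (young I r f)"
proof (rule finite_subset)
  show "young I r f \<subseteq> (\<lambda>\<sigma>. point I (f \<circ> \<sigma>)) ` {\<sigma>. \<sigma> permutes I}"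
    unfolding young_def shuffle_def by (auto intro!: image_eqI point_cong)
qed (simp add: finite_permutations[OF assms])

lemma young_nonempty: "equiv I r \<Longrightarrow> young I r f \<noteq> {}"
  unfolding young_def using shuffle_refl by blast

lemma maxs_young_iff:
  assumes I: "finite I" "equiv I r" and v: "v \<in> young I r f"
  shows "v \<in> maxs (young I r f) (pairing I y) \<longleftrightarrow> sorted_by r (lookup v) y"
proof -
  have "v \<in> maxs (young I r f) (pairing I y) \<longleftrightarrow>
      (\<forall>h. shuffle I r h f \<longrightarrow> (\<Sum>i\<in>I. y i * h i) \<le> (\<Sum>i\<in>I. y i * lookup v i))"
    using v unfolding maxs_def young_def
    by (auto simp: pairing_point[OF I(1)] lookup_point[OF I(1)])
  then show ?thesis using maximal_iff_sorted_by[OF I young_lookup(1)[OF I(1) v]] by blast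
qed

section \<open>Faces of the hull of a finite set\<close>

lemma maxs_face_of:
  assumes "convex P" and lin: "linear \<phi>" shows "maxs P \<phi> face_of P"
  unfolding face_of_def
proof (intro conjI ballI impI)
  show "maxs P \<phi> \<subseteq> P" by (auto simp: maxs_def)
  show "convex (maxs P \<phi>)"
  proof (rule convexI)
    fix x y u v assume x: "x \<in> maxs P \<phi>" and y: "y \<in> maxs P \<phi>" and u: "0 \<le> u" "0 \<le> v" "u + v = (1::real)"
    have "\<phi> x = \<phi> y" using x y by (auto simp: maxs_def intro: order_antisym)
    then have "\<phi> (u *\<^sub>R x + v *\<^sub>R y) = \<phi> x"
      using u(3) by (simp add: linear_add[OF lin] linear_scale[OF lin] flip: distrib_right)
    moreover have "u *\<^sub>R x + v *\<^sub>R y \<in> P"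
      using x y u assms(1) by (auto simp: maxs_def intro: convexD)
    ultimately show "u *\<^sub>R x + v *\<^sub>R y \<in> maxs P \<phi>" using x by (auto simp: maxs_def)
  qed
  fix a b x assume a: "a \<in> P" and b: "b \<in> P" and x: "x \<in> maxs P \<phi>" and s: "x \<in> open_segment a b"
  obtain u where u: "0 < u" "u < 1" "x = (1 - u) *\<^sub>R a + u *\<^sub>R b" using s by (auto simp: in_segment)
  have e: "\<phi> x = (1 - u) * \<phi> a + u * \<phi> b" using u(3) by (simp add: linear_add[OF lin] linear_scale[OF lin])
  have le: "\<phi> a \<le> \<phi> x" "\<phi> b \<le> \<phi> x" using x a b by (auto simp: maxs_def)
  have 1: "u * \<phi> b \<le> u * \<phi> x" "(1 - u) * \<phi> a \<le> (1 - u) * \<phi> x"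
    using le u by (auto intro: mult_left_mono)
  have "(1 - u) * \<phi> x + u * \<phi> x = \<phi> x" by (simp add: algebra_simps)
  then have "u * \<phi> b = u * \<phi> x" "(1 - u) * \<phi> a = (1 - u) * \<phi> x" using 1 e by linarith+
  then have "\<phi> a = \<phi> x" "\<phi> b = \<phi> x" using u by auto
  then show "a \<in> maxs P \<phi>" "b \<in> maxs P \<phi>" using x a b by (auto simp: maxs_def)
qed

text \<open>In a convex combination that lies in \<open>F\<close>, every vertex of nonzero weight
  lies in \<open>F\<close>: apart from degenerate cases, the combination is interior to the segment
  from that vertex to the renormalised sum of the others.\<close>

lemma face_of_hull_vertices:
  fixes V :: "'b::real_vector set"
  assumes V: "finite V" and F: "F face_of (convex hull V)"
  shows "F = convex hull (F \<inter> V)"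
proof
  show "convex hull (F \<inter> V) \<subseteq> F" using face_of_imp_convex[OF F] by (intro hull_minimal) auto
  show "F \<subseteq> convex hull (F \<inter> V)"
  proof
    fix x assume x: "x \<in> F"
    then have "x \<in> convex hull V" using face_of_imp_subset[OF F] by auto
    then obtain u where u: "\<forall>v\<in>V. 0 \<le> u v" "sum u V = 1" "(\<Sum>v\<in>V. u v *\<^sub>R v) = x"
      unfolding convex_hull_finite[OF V] by blast
    have pos: "w \<in> F" if w: "w \<in> V" "u w \<noteq> 0" for w
    proof (cases "u w = 1")
      case True
      then have "sum u (V - {w}) = 0" using u(2) V w(1) by (simp add: sum_diff1)
      then have "\<forall>v\<in>V - {w}. u v = 0"
        using u(1) V by (subst (asm) sum_nonneg_eq_0_iff) auto
      then have "(\<Sum>v\<in>V. u v *\<^sub>R v) = w"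
        using True V w(1) by (simp add: sum.remove[of V w])
      then show ?thesis using u(3) x by simp
    next
      case False
      define c where "c = u w"
      have s: "sum u (V - {w}) = 1 - c" using u(2) V w(1) by (simp add: sum_diff1 c_def)
      have "0 \<le> sum u (V - {w})" using u(1) by (intro sum_nonneg) auto
      then have c: "0 < c" "c < 1" using s False w u(1) by (auto simp: c_def order.order_iff_strict)
      define z where "z = (\<Sum>v\<in>V - {w}. (u v / (1 - c)) *\<^sub>R v)"
      have zV: "z \<in> convex hull V"
        unfolding z_def using V u(1) s c
        by (intro convex_sum) (auto simp: hull_inc simp flip: sum_divide_distrib)
      have wV: "w \<in> convex hull V" using w(1) by (rule hull_inc)
      have "(1 - c) *\<^sub>R z = (\<Sum>v\<in>V - {w}. u v *\<^sub>R v)"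
        unfolding z_def scaleR_sum_right using c by simp
      then have xe: "x = (1 - c) *\<^sub>R z + c *\<^sub>R w"
        using u(3) V w(1) by (simp add: sum.remove[of V w] c_def add.commute)
      show ?thesis
      proof (cases "z = w")
        case True
        then have "x = w" using xe by (simp flip: scaleR_left_distrib)
        then show ?thesis using x by simp
      next
        case False
        then have "x \<in> open_segment z w" using xe c by (auto simp: in_segment)
        then show ?thesis using F x zV wV unfolding face_of_def by blast
      qed
    qed
    have sub: "F \<inter> V \<subseteq> V" by simp
    have u0: "\<forall>v\<in>V - F \<inter> V. u v = 0" using pos by blast
    have "sum u (F \<inter> V) = sum u V" by (rule sum.mono_neutral_left[OF V sub u0])
    then have "sum u (F \<inter> V) = 1" using u(2) by simp
    moreover have "(\<Sum>v\<in>F \<inter> V. u v *\<^sub>R v) = (\<Sum>v\<in>V. u v *\<^sub>R v)"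
      using u0 by (intro sum.mono_neutral_left[OF V sub]) auto
    then have "(\<Sum>v\<in>F \<inter> V. u v *\<^sub>R v) = x" using u(3) by simp
    ultimately show "x \<in> convex hull (F \<inter> V)"
      unfolding convex_hull_finite[OF finite_subset[OF sub V]] using u(1) by blast
  qed
qed

text \<open>The maximal set is a face, hence the hull of the vertices it contains. A half-space
  containing the vertices contains the hull, so these are the vertices that are maximal within
  \<open>V\<close>.\<close>

lemma maxs_convex_hull:
  fixes V :: "'b::real_vector set"
  assumes V: "finite V" and lin: "linear \<phi>"
  shows "maxs (convex hull V) \<phi> = convex hull (maxs V \<phi>)"
proof -
  have "maxs (convex hull V) \<phi> \<inter> V = maxs V \<phi>"
  proof (intro equalityI subsetI)
    fix v assume v: "v \<in> maxs V \<phi>"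
    have "convex {z. \<phi> z \<le> \<phi> v}"
      unfolding convex_def
      using linear_add[OF lin] linear_scale[OF lin]
      by (auto intro!: convex_bound_le simp: real_scaleR_def)
    then have "convex hull V \<subseteq> {z. \<phi> z \<le> \<phi> v}" using v by (intro hull_minimal) (auto simp: maxs_def)
    then show "v \<in> maxs (convex hull V) \<phi> \<inter> V" using v hull_inc[of v V convex] by (auto simp: maxs_def)
  qed (auto simp: maxs_def hull_inc)
  then show ?thesis
    using face_of_hull_vertices[OF V maxs_face_of[OF convex_convex_hull lin]] by simp
qed

lemma maxs_nonempty:
  assumes "finite V" "V \<noteq> {}" shows "maxs V \<phi> \<noteq> {}"
proof (rule finite_max_exists[OF assms, of \<phi>])
  fix a assume "a \<in> V" "\<And>b. b \<in> V \<Longrightarrow> \<phi> b \<le> \<phi> a"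
  then have "a \<in> maxs V \<phi>" by (simp add: maxs_def)
  then show ?thesis by blast
qed

lemma maxs_hull_subset_iff:
  fixes V :: "'b::real_vector set"
  assumes "finite V" "linear \<phi>" "linear \<psi>"
  shows "maxs (convex hull V) \<phi> \<subseteq> maxs (convex hull V) \<psi> \<longleftrightarrow> maxs V \<phi> \<subseteq> maxs V \<psi>"
proof
  assume *: "maxs (convex hull V) \<phi> \<subseteq> maxs (convex hull V) \<psi>"
  show "maxs V \<phi> \<subseteq> maxs V \<psi>"
  proof
    fix v assume v: "v \<in> maxs V \<phi>"
    then have "v \<in> maxs (convex hull V) \<psi>"
      using * hull_inc[of v "maxs V \<phi>" convex] unfolding maxs_convex_hull[OF assms(1,2)] by blast
    then show "v \<in> maxs V \<psi>" using v hull_inc[of _ V convex] by (auto simp: maxs_def)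
  qed
next
  assume "maxs V \<phi> \<subseteq> maxs V \<psi>"
  then show "maxs (convex hull V) \<phi> \<subseteq> maxs (convex hull V) \<psi>"
    unfolding maxs_convex_hull[OF assms(1,2)] maxs_convex_hull[OF assms(1,3)] by (rule hull_mono)
qed

section \<open>Faces and normal fans\<close>

text \<open>A transposition moves every vertex parallel to the same vector e_i - e_j. This common
  direction makes the two segments of the exchange property meet.\<close>

lemma lookup_point_transpose:
  assumes "finite I" "(i, j) \<in> r" "equiv I r" "v \<in> young I r f"
  shows "point I (lookup v \<circ> Transposition.transpose i j) \<in> young I r f"
    and "point I (lookup v \<circ> Transposition.transpose i j) =
      v - (lookup v i - lookup v j) *\<^sub>R (Poly_Mapping.single i 1 - Poly_Mapping.single j 1)"
proof -
  have "shuffle I r (lookup v \<circ> Transposition.transpose i j) f"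
    using shuffle_trans[OF assms(3) shuffle_transpose[OF assms(3,2)] young_lookup(1)[OF assms(1,4)]] .
  then show "point I (lookup v \<circ> Transposition.transpose i j) \<in> young I r f"
    unfolding young_def by blast
  have m: "i \<in> I" "j \<in> I" using equiv_mem[OF assms(3,2)] by auto
  have z: "lookup v k = 0" if "k \<notin> I" for k
    using that young_lookup(2)[OF assms(1,4)] lookup_point[OF assms(1), of "lookup v" k] by simp
  show "point I (lookup v \<circ> Transposition.transpose i j) =
      v - (lookup v i - lookup v j) *\<^sub>R (Poly_Mapping.single i 1 - Poly_Mapping.single j 1)"
    using m z
    by (intro poly_mapping_eqI)
      (auto simp: lookup_point[OF assms(1)] lookup_minus lookup_scaleR lookup_single when_def
        Transposition.transpose_def)
qed

text \<open>The exchange property of faces: the segment between \<open>v\<close> and \<open>w\<close> crosses the segment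
  between their images under the transposition.\<close>

lemma face_transpose:
  assumes I: "finite I" "equiv I r" and F: "F face_of young_polytope I r f"
    and v: "v \<in> F" "v \<in> young I r f" and w: "w \<in> F" "w \<in> young I r f"
    and ij: "(i, j) \<in> r" "lookup v j < lookup v i" "lookup w i < lookup w j"
  shows "point I (lookup v \<circ> Transposition.transpose i j) \<in> F"
proof -
  define d :: "'a fvec" where "d = Poly_Mapping.single i 1 - Poly_Mapping.single j 1"
  define a where "a = lookup v i - lookup v j"
  define b where "b = lookup w j - lookup w i"
  have ab: "0 < a" "0 < b" using ij by (auto simp: a_def b_def)
  define v' where "v' = point I (lookup v \<circ> Transposition.transpose i j)"
  define w' where "w' = point I (lookup w \<circ> Transposition.transpose i j)"
  have v': "v' = v - a *\<^sub>R d" "v' \<in> young I r f"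
    using lookup_point_transpose[OF I(1) ij(1) I(2) v(2)] by (auto simp: v'_def a_def d_def)
  have "w' = w - (- b) *\<^sub>R d" "w' \<in> young I r f"
    using lookup_point_transpose[OF I(1) ij(1) I(2) w(2)] by (auto simp: w'_def b_def d_def)
  then have w': "w' = w + b *\<^sub>R d" "w' \<in> young I r f" by auto
  \<comment> \<open>The weight for which the displacements of \<open>v'\<close> and
    \<open>w'\<close> along \<open>d\<close> cancel, so that \<open>z\<close> lies on both
    segments.\<close>
  define t where "t = a / (a + b)"
  have t: "0 < t" "t < 1" "(1 - t) * a = t * b" using ab by (auto simp: t_def field_simps)
  define z where "z = (1 - t) *\<^sub>R v + t *\<^sub>R w"
  have zF: "z \<in> F" unfolding z_def
    using face_of_imp_convex[OF F] v(1) w(1) t by (intro convexD) auto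
  have "(1 - t) *\<^sub>R v' + t *\<^sub>R w' = z + (t * b - (1 - t) * a) *\<^sub>R d"
    unfolding v' w' z_def by (simp add: algebra_simps)
  then have ze: "z = (1 - t) *\<^sub>R v' + t *\<^sub>R w'" using t(3) by simp
  show ?thesis
  proof (cases "v' = w'")
    case True
    then have "z = v'" using ze by (simp flip: scaleR_left_distrib)
    then show ?thesis using zF by (simp add: v'_def)
  next
    case False
    then have "z \<in> open_segment v' w'" using ze t by (auto simp: in_segment)
    moreover have "v' \<in> young_polytope I r f" "w' \<in> young_polytope I r f"
      using v'(2) w'(2) unfolding young_polytope_def by (auto intro: hull_inc)
    ultimately show ?thesis using F zF unfolding face_of_def v'_def by blast
  qed
qed

text \<open>A face is exposed by the sum of its vertices, read as a linear functional.\<close>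

lemma face_exposed:
  assumes I: "finite I" "equiv I r" and F: "F face_of young_polytope I r f" "F \<noteq> {}"
  obtains y where "F = maxs (young_polytope I r f) (pairing I y)"
proof -
  define V where "V = young I r f"
  define W where "W = F \<inter> V"
  have fV: "finite V" unfolding V_def by (rule finite_young[OF I(1)])
  then have fW: "finite W" by (simp add: W_def)
  have FW: "F = convex hull W"
    unfolding W_def V_def using F(1) finite_young[OF I(1)]
    by (intro face_of_hull_vertices) (simp_all add: young_polytope_def)
  then have W: "W \<noteq> {}" using F(2) by auto
  define y where "y i = (\<Sum>w\<in>W. lookup w i)" for i
  define tr where "tr i j v = point I (lookup v \<circ> Transposition.transpose i j)" for i j v
  have exch: "tr i j v \<in> W" if "v \<in> W" "w \<in> W" "(i, j) \<in> r" "lookup v j < lookup v i" "lookup w i < lookup w j" for i j v w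
    using that face_transpose[OF I F(1), of v w i j] lookup_point_transpose(1)[OF I(1) that(3) I(2), of v f]
    by (auto simp: W_def V_def tr_def)
  have lk: "lookup (tr i j v) k = lookup v (Transposition.transpose i j k)" if "(i, j) \<in> r" "v \<in> V" for i j k v
  proof -
    have "lookup v k = 0" if "k \<notin> I" for k
      using that young_lookup(2)[OF I(1)] \<open>v \<in> V\<close> lookup_point[OF I(1), of "lookup v" k] by (simp add: V_def)
    then show ?thesis using equiv_mem[OF I(2) that(1)]
      by (auto simp: tr_def lookup_point[OF I(1)] Transposition.transpose_def)
  qed
  have comm: "tr j i v = tr i j v" for i j v by (simp add: tr_def transpose_commute)
  \<comment> \<open>Sums over \<open>W\<close> are compared: if no vertex of \<open>W\<close> had
    its \<open>i\<close> coordinate below its \<open>j\<close> coordinate, then \<open>v\<close>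
    would force \<open>y j < y i\<close>.\<close>
  have less: "\<exists>w\<in>W. lookup w i < lookup w j" if "y i \<le> y j" "v \<in> W" "lookup v j < lookup v i" for i j v
  proof (rule ccontr)
    assume "\<not> ?thesis"
    then have "y j < y i" unfolding y_def
      using fW that(2,3) by (intro sum_strict_mono_ex1) auto
    then show False using that(1) by simp
  qed
  have comp: "sorted_by r (lookup w) y" if w: "w \<in> W" for w
    unfolding sorted_by_def
  proof (clarify, rule ccontr)
    fix i j assume ij: "(i, j) \<in> r" "lookup w j < lookup w i" "\<not> y j \<le> y i"
    \<comment> \<open>Now \<open>W\<close> contains a vertex for either order of the two
      coordinates, so by exchange the transposition preserves \<open>W\<close>. The two coordinate
      sums then coincide, against \<open>y i < y j\<close>.\<close>
    obtain u where u: "u \<in> W" "lookup u i < lookup u j" using less[of i j w] ij w by auto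
    have ji: "(j, i) \<in> r" using equiv_sym[OF I(2) ij(1)] .
    have cl: "tr i j v \<in> W" if v: "v \<in> W" for v
    proof -
      consider "lookup v j < lookup v i" | "lookup v i < lookup v j" | "lookup v i = lookup v j" by linarith
      then show ?thesis
      proof cases
        case 1 then show ?thesis using exch[OF v u(1) ij(1) _ u(2)] by simp
      next
        case 2 then show ?thesis using exch[OF v w ji _ ij(2)] comm by simp
      next
        case 3
        then have "tr i j v = v"
          using lk[OF ij(1), of v] v by (intro poly_mapping_eqI) (auto simp: W_def Transposition.transpose_def)
        then show ?thesis using v by simp
      qed
    qed
    have inv: "tr i j (tr i j v) = v" if "v \<in> W" for v
    proof (rule poly_mapping_eqI)
      fix k
      have "lookup (tr i j (tr i j v)) k = lookup (tr i j v) (Transposition.transpose i j k)"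
        using cl[OF that] by (intro lk[OF ij(1)]) (simp add: W_def)
      also have "\<dots> = lookup v k" using that by (subst lk[OF ij(1)]) (simp_all add: W_def)
      finally show "lookup (tr i j (tr i j v)) k = lookup v k" .
    qed
    have "y i = (\<Sum>w\<in>W. lookup (tr i j w) j)"
      unfolding y_def using lk[OF ij(1)] by (intro sum.cong) (auto simp: W_def)
    also have "\<dots> = y j" unfolding y_def
      by (rule sum.reindex_bij_witness[of W "tr i j" "tr i j"]) (auto simp: inv cl)
    finally show False using ij(3) by simp
  qed
  have onlyW: "u \<in> W" if u: "u \<in> V" and cu: "sorted_by r (lookup u) y" for u
  proof -
    let ?A = "\<lambda>v. {i \<in> I. lookup v i = lookup u i}"
    \<comment> \<open>The vertex of \<open>W\<close> that agrees with \<open>u\<close> in as many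
      coordinates as possible. A disagreement would be repaired by a transposition that stays in
      \<open>W\<close>, which contradicts this choice.\<close>
    obtain v where v: "v \<in> W" and vm: "\<And>w. w \<in> W \<Longrightarrow> card (?A w) \<le> card (?A v)"
      using finite_max_exists[OF fW W, of "\<lambda>v. card (?A v)"] by blast
    have vV: "v \<in> V" using v by (simp add: W_def)
    have shu: "shuffle I r (lookup u) (lookup v)"
      using young_lookup(1)[OF I(1)] u vV shuffle_trans[OF I(2)] shuffle_sym[OF I(2)] unfolding V_def by blast
    let ?s = "r \<inter> {(i, j). y i = y j}"
    have sh: "shuffle I ?s (lookup u) (lookup v)"
      by (rule shuffle_level[OF I shu cu comp[OF v]])
    have "lookup v i = lookup u i" if i: "i \<in> I" for i
    proof (rule ccontr)
      assume ne: "lookup v i \<noteq> lookup u i"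
      let ?C = "\<lambda>w. {b \<in> ?s `` {i}. lookup w b = lookup u i}"
      have fin: "finite (?s `` {i})"
        using equiv_class_subset[OF equiv_level[OF I(2)]] I(1) by (rule finite_subset)
      have "card (?C u) = card (?C v)"
        by (rule shuffle_card[OF I(1) equiv_level[OF I(2)] sh])
      moreover have "i \<in> ?C u" using equiv_refl[OF I(2) i] by simp
      moreover have "i \<notin> ?C v" using ne by simp
      ultimately have "\<not> ?C v \<subseteq> ?C u"
        using psubset_card_mono[of "?C u" "?C v"] finite_subset[OF _ fin, of "?C u"] by auto
      \<comment> \<open>Inside the class and level of \<open>i\<close> both vertices take the value
        \<open>lookup u i\<close> equally often, so \<open>v\<close> has it at some \<open>j\<close>
        where \<open>u\<close> does not. Swapping \<open>i\<close> and \<open>j\<close> in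
        \<open>v\<close> gains \<open>i\<close> and loses no agreement; \<open>y i = y j\<close>
        provides the opposing vertex that exchange needs.\<close>
      then obtain j where j: "(i, j) \<in> r" "y i = y j" "lookup v j = lookup u i" "lookup u j \<noteq> lookup u i"
        by auto
      have ji: "(j, i) \<in> r" using equiv_sym[OF I(2) j(1)] .
      have "lookup v i \<noteq> lookup v j" using j(3) ne by simp
      then have trW: "tr i j v \<in> W"
      proof (cases "lookup v j < lookup v i")
        case True
        then obtain w where "w \<in> W" "lookup w i < lookup w j" using less[of i j v] j(2) v by auto
        then show ?thesis using exch[OF v _ j(1) True] by blast
      next
        case False
        then have l: "lookup v i < lookup v j" using \<open>lookup v i \<noteq> lookup v j\<close> by simp
        then obtain w where "w \<in> W" "lookup w j < lookup w i" using less[of j i v] j(2) v by auto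
        then show ?thesis using exch[OF v _ ji l] comm by metis
      qed
      have "insert i (?A v) \<subseteq> ?A (tr i j v)"
        using i j(3,4) lk[OF j(1) vV] by (auto simp: Transposition.transpose_def)
      then have "card (insert i (?A v)) \<le> card (?A (tr i j v))" using I(1) by (intro card_mono) auto
      moreover have "card (insert i (?A v)) = Suc (card (?A v))" using ne I(1) by simp
      ultimately show False using vm[OF trW] by simp
    qed
    then have "point I (lookup v) = point I (lookup u)" by (rule point_cong)
    then have "v = u" using young_lookup(2)[OF I(1)] u vV unfolding V_def by metis
    then show ?thesis using v by simp
  qed
  have "maxs V (pairing I y) = W"
  proof (intro equalityI subsetI)
    fix u assume m: "u \<in> maxs V (pairing I y)"
    then have "u \<in> V" by (simp add: maxs_def)
    then show "u \<in> W" using onlyW maxs_young_iff[OF I, of u f y] m by (simp add: V_def)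
  next
    fix u assume "u \<in> W"
    then show "u \<in> maxs V (pairing I y)"
      using comp maxs_young_iff[OF I, of u f y] by (simp add: V_def W_def)
  qed
  then have "F = maxs (young_polytope I r f) (pairing I y)"
    unfolding young_polytope_def maxs_convex_hull[OF finite_young[OF I(1)] linear_pairing] FW V_def by simp
  then show ?thesis by (rule that)
qed

lemma maxs_young_subset_iff:
  assumes I: "finite I" "equiv I r"
  shows "maxs (young_polytope I r f) (pairing I y) \<subseteq> maxs (young_polytope I r f) (pairing I y')
    \<longleftrightarrow> dominates I r f y y'"
proof -
  have "maxs (young I r f) (pairing I y) \<subseteq> maxs (young I r f) (pairing I y') \<longleftrightarrow>
      (\<forall>v\<in>young I r f. sorted_by r (lookup v) y \<longrightarrow> sorted_by r (lookup v) y')"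
    using maxs_young_iff[OF I, of _ f] unfolding subset_iff by (metis (no_types, lifting) maxs_def mem_Collect_eq)
  also have "\<dots> \<longleftrightarrow> dominates I r f y y'"
    unfolding dominates_def
  proof (intro iffI allI impI ballI)
    fix g assume *: "\<forall>v\<in>young I r f. sorted_by r (lookup v) y \<longrightarrow> sorted_by r (lookup v) y'"
      and g: "shuffle I r g f" "sorted_by r g y"
    have sub: "r \<subseteq> I \<times> I" using equiv_mem[OF I(2)] by auto
    have c: "sorted_by r (lookup (point I g)) z \<longleftrightarrow> sorted_by r g z" for z
      by (rule sorted_by_cong[OF sub]) (simp_all add: lookup_point[OF I(1)])
    have "point I g \<in> young I r f" using g(1) unfolding young_def by blast
    then show "sorted_by r g y'" using * c g(2) by blast
  next
    fix v assume "\<forall>g. shuffle I r g f \<longrightarrow> sorted_by r g y \<longrightarrow> sorted_by r g y'"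
      and "v \<in> young I r f" "sorted_by r (lookup v) y"
    then show "sorted_by r (lookup v) y'" using young_lookup(1)[OF I(1)] by blast
  qed
  finally show ?thesis
    unfolding young_polytope_def maxs_hull_subset_iff[OF finite_young[OF I(1)] linear_pairing linear_pairing] .
qed

lemma dominates_cong:
  assumes "equiv I r" "\<And>i. i \<in> I \<Longrightarrow> y i = z i" "\<And>i. i \<in> I \<Longrightarrow> y' i = z' i"
  shows "dominates I r f y y' \<longleftrightarrow> dominates I r f z z'"
proof -
  have sub: "r \<subseteq> I \<times> I" using equiv_mem[OF assms(1)] by auto
  have "sorted_by r g y \<longleftrightarrow> sorted_by r g z" "sorted_by r g y' \<longleftrightarrow> sorted_by r g z'" for g
    by (rule sorted_by_cong[OF sub]; simp add: assms(2,3))+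
  then show ?thesis unfolding dominates_def by simp
qed

lemma dominates_refl: "dominates I r f y y"
  by (simp add: dominates_def)

lemma dominates_trans: "dominates I r f x y \<Longrightarrow> dominates I r f y z \<Longrightarrow> dominates I r f x z"
  by (simp add: dominates_def)

text \<open>Every nonempty face is exposed by some \<open>y\<close>, and its cone consists of the
  functionals above \<open>y\<close> in the preorder \<open>dominates\<close>. The fan is thus the
  set of principal up-sets of this preorder.\<close>

lemma young_normal_fan:
  assumes I: "finite I" "equiv I r"
  shows "normal_fan I (young_polytope I r f) =
    (\<lambda>y. {y' \<in> I \<rightarrow>\<^sub>E UNIV. dominates I r f y y'}) ` (I \<rightarrow>\<^sub>E UNIV)"
proof -
  let ?P = "young_polytope I r f"
  have cone: "normal_cone I ?P (maxs ?P (pairing I y)) = {y' \<in> I \<rightarrow>\<^sub>E UNIV. dominates I r f y y'}" for y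
    unfolding maxs_young_subset_iff[OF I, symmetric] normal_cone_def maxs_def by blast
  have face: "maxs ?P (pairing I y) face_of ?P" "maxs ?P (pairing I y) \<noteq> {}" for y
  proof -
    show "maxs ?P (pairing I y) face_of ?P"
      by (rule maxs_face_of[OF _ linear_pairing]) (simp add: young_polytope_def convex_convex_hull)
    show "maxs ?P (pairing I y) \<noteq> {}"
      using maxs_nonempty[OF finite_young[OF I(1)] young_nonempty[OF I(2)]]
      unfolding young_polytope_def maxs_convex_hull[OF finite_young[OF I(1)] linear_pairing]
      by simp
  qed
  show ?thesis
  proof (intro equalityI subsetI)
    fix C assume "C \<in> normal_fan I ?P"
    then obtain F where F: "F face_of ?P" "F \<noteq> {}" "C = normal_cone I ?P F" unfolding normal_fan_def by blast
    obtain y where y: "F = maxs ?P (pairing I y)" by (rule face_exposed[OF I F(1,2)])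
    have "maxs ?P (pairing I y) = maxs ?P (pairing I (restrict y I))"
      unfolding maxs_def by (simp cong: pairing_cong)
    then have "C = {y' \<in> I \<rightarrow>\<^sub>E UNIV. dominates I r f (restrict y I) y'}"
      using F(3) y cone by metis
    then show "C \<in> (\<lambda>y. {y' \<in> I \<rightarrow>\<^sub>E UNIV. dominates I r f y y'}) ` (I \<rightarrow>\<^sub>E UNIV)" by auto
  next
    fix C assume "C \<in> (\<lambda>y. {y' \<in> I \<rightarrow>\<^sub>E UNIV. dominates I r f y y'}) ` (I \<rightarrow>\<^sub>E UNIV)"
    then obtain y where "C = normal_cone I ?P (maxs ?P (pairing I y))" using cone by auto
    then show "C \<in> normal_fan I ?P" unfolding normal_fan_def using face[of y] by blast
  qed
qed

text \<open>A preorder is recovered from the set of its principal up-sets, even without knowing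
  which generator each of them belongs to.\<close>

theorem young_normal_fan_eq_iff:
  assumes I: "finite I" and r: "equiv I r" and s: "equiv I s"
  shows "normal_fan I (young_polytope I r f) = normal_fan I (young_polytope I s g) \<longleftrightarrow>
    (\<forall>y y'. dominates I r f y y' \<longleftrightarrow> dominates I s g y y')"
proof
  assume eq: "normal_fan I (young_polytope I r f) = normal_fan I (young_polytope I s g)"
  have imp: "dominates I s' g' y y'"
    if eq: "normal_fan I (young_polytope I r' f') = normal_fan I (young_polytope I s' g')"
      and r: "equiv I r'" and s: "equiv I s'" and d: "dominates I r' f' y y'" for r' s' f' g' y y'
  proof -
    let ?C = "\<lambda>y. {y' \<in> I \<rightarrow>\<^sub>E UNIV. dominates I s' g' y y'}"
    let ?y = "restrict y I" and ?y' = "restrict y' I"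
    have E: "?y \<in> I \<rightarrow>\<^sub>E UNIV" "?y' \<in> I \<rightarrow>\<^sub>E UNIV" by auto
    have "?C ?y \<in> normal_fan I (young_polytope I r' f')"
      unfolding eq young_normal_fan[OF I s] using E by blast
    \<comment> \<open>The up-set of \<open>?y\<close> in one preorder is the up-set of some
      \<open>x\<close> in the other. It contains \<open>?y\<close>, so \<open>x\<close> lies below
      \<open>?y\<close> there, and transitivity carries \<open>?y'\<close> into it.\<close>
    then obtain x where x: "?C ?y = {y' \<in> I \<rightarrow>\<^sub>E UNIV. dominates I r' f' x y'}"
      unfolding young_normal_fan[OF I r] by blast
    have "dominates I r' f' ?y ?y'" using d dominates_cong[OF r, of y ?y y' ?y' f'] by simp
    moreover have "dominates I r' f' x ?y" using x E(1) dominates_refl[of I s' g' ?y] by blast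
    ultimately have "?y' \<in> ?C ?y" unfolding x using E(2) dominates_trans by blast
    then show ?thesis using dominates_cong[OF s, of y ?y y' ?y' g'] by simp
  qed
  show "\<forall>y y'. dominates I r f y y' \<longleftrightarrow> dominates I s g y y'"
    using imp[OF eq r s] imp[OF eq[symmetric] s r] by blast
qed (simp add: young_normal_fan[OF I r] young_normal_fan[OF I s])

section \<open>Products of orbit polytopes and their maximal faces\<close>

lemma shuffle_iff_card:
  assumes "finite I" "equiv I r"
  shows "shuffle I r g f \<longleftrightarrow>
    (\<forall>a\<in>I. \<forall>x. card {b \<in> r `` {a}. g b = x} = card {b \<in> r `` {a}. f b = x})"
proof
  assume "shuffle I r g f"
  then show "\<forall>a\<in>I. \<forall>x. card {b \<in> r `` {a}. g b = x} = card {b \<in> r `` {a}. f b = x}"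
    using shuffle_card[OF assms, of g f, where Q = "\<lambda>z. z = x" for x] by blast
next
  assume "\<forall>a\<in>I. \<forall>x. card {b \<in> r `` {a}. g b = x} = card {b \<in> r `` {a}. f b = x}"
  then show "shuffle I r g f" by (intro shuffleI_card[OF assms]) blast
qed

section \<open>Block relations on disjoint unions, and products of polytopes\<close>

lemma equiv_Un:
  assumes "equiv S r" "equiv T s" "S \<inter> T = {}"
  shows "equiv (S \<union> T) (r \<union> s)"
proof (rule equivI)
  note m = equiv_mem[OF assms(1)] equiv_mem[OF assms(2)]
  show "r \<union> s \<subseteq> (S \<union> T) \<times> (S \<union> T)" using m by auto
  show "refl_on (S \<union> T) (r \<union> s)"
    using equiv_refl[OF assms(1)] equiv_refl[OF assms(2)] by (auto simp: refl_on_def)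
  show "sym (r \<union> s)" using equiv_sym[OF assms(1)] equiv_sym[OF assms(2)] by (auto simp: sym_def)
  show "trans (r \<union> s)"
  proof (rule transI)
    fix x y z assume "(x, y) \<in> r \<union> s" "(y, z) \<in> r \<union> s"
    then consider "(x, y) \<in> r" "(y, z) \<in> r" | "(x, y) \<in> s" "(y, z) \<in> s"
      using m assms(3) by blast
    then show "(x, z) \<in> r \<union> s"
      using equiv_trans[OF assms(1)] equiv_trans[OF assms(2)] by cases blast+
  qed
qed

lemma equiv_restrict:
  assumes "equiv I r" "S \<subseteq> I" shows "equiv S (Restr r S)"
proof (rule equivI)
  show "Restr r S \<subseteq> S \<times> S" by auto
  show "refl_on S (Restr r S)" using equiv_refl[OF assms(1)] assms(2) by (auto simp: refl_on_def)
  show "sym (Restr r S)" using equiv_sym[OF assms(1)] by (auto simp: sym_def)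
  show "trans (Restr r S)" using equiv_trans[OF assms(1)] by (auto simp: trans_def)
qed

lemma class_Un:
  assumes "equiv S r" "equiv T s" "S \<inter> T = {}"
  shows "a \<in> S \<Longrightarrow> (r \<union> s) `` {a} = r `` {a}" "a \<in> T \<Longrightarrow> (r \<union> s) `` {a} = s `` {a}"
  using equiv_mem[OF assms(1)] equiv_mem[OF assms(2)] assms(3) by blast+

text \<open>The counting criterion suffices, since each class of the union lies on one of the two
  sides; no permutation has to be split or glued.\<close>

lemma shuffle_Un:
  assumes "finite S" "finite T" "equiv S r" "equiv T s" "S \<inter> T = {}"
  shows "shuffle (S \<union> T) (r \<union> s) g f \<longleftrightarrow> shuffle S r g f \<and> shuffle T s g f"
proof -
  have un: "finite (S \<union> T)" using assms(1,2) by simp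
  show ?thesis
    unfolding shuffle_iff_card[OF un equiv_Un[OF assms(3-5)]] shuffle_iff_card[OF assms(1,3)]
      shuffle_iff_card[OF assms(2,4)] ball_Un
    by (intro arg_cong2[where f = conj] ball_cong refl)
      (simp_all only: class_Un[OF assms(3-5)])
qed

lemma sorted_by_Un: "sorted_by (r \<union> s) g y \<longleftrightarrow> sorted_by r g y \<and> sorted_by s g y"
  by (simp add: sorted_by_def ball_Un)

lemma young_polytope_cong:
  assumes "\<And>i. i \<in> I \<Longrightarrow> f i = f' i"
  shows "young_polytope I r f = young_polytope I r f'"
  using shuffle_cong[of I _ _ f f'] assms unfolding young_polytope_def young_def by metis

lemma point_Un: "finite S \<Longrightarrow> finite T \<Longrightarrow> S \<inter> T = {} \<Longrightarrow> point (S \<union> T) g = point S g + point T g"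
  unfolding point_def by (rule sum.union_disjoint)

lemma polytope_prod_plus: "polytope_prod P Q = P + Q"
  by (auto simp: polytope_prod_def set_plus_def)

text \<open>One arrangement serves both factors, because arrangements are functions on all labels
  and only their values on \<open>S\<close> and on \<open>T\<close> matter. Vertices add up
  coordinatewise, and hulls commute with Minkowski sums.\<close>

lemma young_polytope_Un:
  assumes "finite S" "finite T" "equiv S r" "equiv T s" "S \<inter> T = {}"
  shows "young_polytope (S \<union> T) (r \<union> s) f = polytope_prod (young_polytope S r f) (young_polytope T s f)"
proof -
  have "young (S \<union> T) (r \<union> s) f = young S r f + young T s f"
  proof (intro equalityI subsetI)
    fix x assume "x \<in> young (S \<union> T) (r \<union> s) f"
    then obtain g where "x = point (S \<union> T) g" "shuffle S r g f" "shuffle T s g f"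
      unfolding young_def shuffle_Un[OF assms] by blast
    then show "x \<in> young S r f + young T s f"
      unfolding point_Un[OF assms(1,2,5)] young_def by (auto intro!: set_plus_intro)
  next
    fix x assume "x \<in> young S r f + young T s f"
    then obtain g h where x: "x = point S g + point T h" and gh: "shuffle S r g f" "shuffle T s h f"
      unfolding young_def by (auto elim!: set_plus_elim)
    define k where "k i = (if i \<in> S then g i else h i)" for i
    have T: "i \<in> T \<Longrightarrow> k i = h i" for i using assms(5) by (auto simp: k_def)
    have "shuffle S r k f" "shuffle T s k f"
      using gh shuffle_cong[of S k g f f] shuffle_cong[of T k h f f] T by (auto simp: k_def)
    moreover have "x = point (S \<union> T) k"
      unfolding x point_Un[OF assms(1,2,5)] using T by (auto simp: k_def intro!: arg_cong2[where f = plus] point_cong)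
    ultimately show "x \<in> young (S \<union> T) (r \<union> s) f" unfolding young_def shuffle_Un[OF assms] by blast
  qed
  then show ?thesis by (simp add: young_polytope_def polytope_prod_plus convex_hull_set_plus)
qed

section \<open>Orbit polytopes and relabelling of coordinates\<close>

lemma relabel_sum:
  assumes "finite I" "Poly_Mapping.keys p \<subseteq> I"
  shows "relabel \<sigma> p = (\<Sum>i\<in>I. Poly_Mapping.single (\<sigma> i) (lookup p i))"
  unfolding relabel_def using assms by (intro sum.mono_neutral_left) (auto simp: in_keys_iff)

lemma linear_relabel: "linear (relabel \<sigma>)"
proof (rule linearI)
  fix p q :: "'a fvec"
  let ?I = "Poly_Mapping.keys p \<union> Poly_Mapping.keys q"
  have k: "Poly_Mapping.keys (p + q) \<subseteq> ?I" by (rule Poly_Mapping.keys_add)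
  show "relabel \<sigma> (p + q) = relabel \<sigma> p + relabel \<sigma> q"
    by (subst (1 2 3) relabel_sum[of ?I]) (use k in \<open>auto simp: lookup_add single_add sum.distrib\<close>)
next
  fix c and p :: "'a fvec"
  have k: "Poly_Mapping.keys (c *\<^sub>R p) \<subseteq> Poly_Mapping.keys p"
    by (auto simp: in_keys_iff lookup_scaleR)
  have s: "Poly_Mapping.single i (c * a) = c *\<^sub>R Poly_Mapping.single i a" for i a
    by (rule poly_mapping_eqI) (simp add: lookup_scaleR lookup_single when_def)
  show "relabel \<sigma> (c *\<^sub>R p) = c *\<^sub>R relabel \<sigma> p"
    by (subst (1 2) relabel_sum[of "Poly_Mapping.keys p"]) (use k in \<open>auto simp: lookup_scaleR s scaleR_sum_right\<close>)
qed

lemma relabel_point: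
  assumes "finite I" "bij_betw \<sigma> I J" "\<forall>i\<in>I. \<tau> (\<sigma> i) = i"
  shows "relabel \<sigma> (point I g) = point J (g \<circ> \<tau>)"
proof -
  have "relabel \<sigma> (point I g) = (\<Sum>i\<in>I. Poly_Mapping.single (\<sigma> i) (lookup (point I g) i))"
    using assms(1) point_in_real_space[OF assms(1), of g] by (intro relabel_sum) (auto simp: real_space_def)
  also have "\<dots> = (\<Sum>i\<in>I. Poly_Mapping.single (\<sigma> i) ((g \<circ> \<tau>) (\<sigma> i)))"
    using assms by (intro sum.cong) (auto simp: lookup_point)
  also have "\<dots> = point J (g \<circ> \<tau>)"
    unfolding point_def by (rule sum.reindex_bij_betw[OF assms(2)])
  finally show ?thesis .
qed

lemma orbit_polytope_eq_young:
  assumes "finite I" "p \<in> real_space I"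
  shows "orbit_polytope I p = young_polytope I (I \<times> I) (lookup p)"
proof -
  \<comment> \<open>Relabelling transports the coordinate at \<open>i\<close> to
    \<open>\<sigma> i\<close>, so the coordinate function is composed with the inverse
    permutation.\<close>
  have r: "relabel \<sigma> p = point I (lookup p \<circ> Hilbert_Choice.inv \<sigma>)" if "\<sigma> permutes I" for \<sigma>
    using relabel_point[OF assms(1) permutes_imp_bij[OF that], of "Hilbert_Choice.inv \<sigma>" "lookup p"]
      point_lookup[OF assms] permutes_inverses[OF that] by simp
  have "{relabel \<sigma> p |\<sigma>. \<sigma> permutes I} = young I (I \<times> I) (lookup p)"
  proof (intro equalityI subsetI)
    fix x assume "x \<in> {relabel \<sigma> p |\<sigma>. \<sigma> permutes I}"
    then obtain \<sigma> where s: "\<sigma> permutes I" "x = relabel \<sigma> p" by blast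
    have "shuffle I (I \<times> I) (lookup p \<circ> Hilbert_Choice.inv \<sigma>) (lookup p)"
      unfolding shuffle_def using permutes_inv[OF s(1)] permutes_in_image[OF permutes_inv[OF s(1)]]
      by (intro exI[of _ "Hilbert_Choice.inv \<sigma>"]) auto
    then show "x \<in> young I (I \<times> I) (lookup p)" unfolding young_def s(2) r[OF s(1)] by blast
  next
    fix x assume "x \<in> young I (I \<times> I) (lookup p)"
    then obtain g \<sigma> where s: "x = point I g" "\<sigma> permutes I" "\<forall>i\<in>I. g i = lookup p (\<sigma> i)"
      unfolding young_def shuffle_def by blast
    have "x = relabel (Hilbert_Choice.inv \<sigma>) p"
      unfolding s(1) r[OF permutes_inv[OF s(2)]] permutes_inv_inv[OF s(2)]
      by (rule point_cong) (simp add: s(3))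
    then show "x \<in> {relabel \<sigma> p |\<sigma>. \<sigma> permutes I}" using permutes_inv[OF s(2)] by blast
  qed
  then show ?thesis by (simp add: orbit_polytope_def young_polytope_def)
qed

lemma equiv_full: "equiv I (I \<times> I)"
  by (rule equivI) (auto simp: refl_on_def sym_def trans_def)

lemma orbit_product_imp_young:
  "orbit_product I P \<Longrightarrow> finite I \<and> (\<exists>r f. equiv I r \<and> P = young_polytope I r f)"
proof (induction rule: orbit_product.induct)
  case (orbit I p)
  then show ?case using orbit_polytope_eq_young[of I p] equiv_full[of I] by blast
next
  case (prod S P T Q)
  then obtain r f s g where h: "finite S" "finite T" "equiv S r" "equiv T s"
    "P = young_polytope S r f" "Q = young_polytope T s g" by blast
  define k where "k i = (if i \<in> S then f i else g i)" for i
  have "young_polytope S r f = young_polytope S r k" "young_polytope T s g = young_polytope T s k"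
    using prod(3) by (auto simp: k_def intro!: young_polytope_cong)
  then have "polytope_prod P Q = young_polytope (S \<union> T) (r \<union> s) k"
    using young_polytope_Un[OF h(1-4) prod(3)] h(5,6) by simp
  then show ?case using equiv_Un[OF h(3,4) prod(3)] h(1,2) by blast
qed

text \<open>Splitting off the class of one element writes the polytope as an orbit polytope times a
  polytope of the same kind on fewer labels.\<close>

lemma orbit_product_young:
  "finite I \<Longrightarrow> equiv I r \<Longrightarrow> orbit_product I (young_polytope I r f)"
proof (induction "card I" arbitrary: I r rule: less_induct)
  case less
  have orb: "orbit_product B (young_polytope B (B \<times> B) f)" if "finite B" for B
  proof -
    have "young_polytope B (B \<times> B) f = orbit_polytope B (point B f)"
      unfolding orbit_polytope_eq_young[OF that point_in_real_space[OF that]]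
      by (rule young_polytope_cong) (simp add: lookup_point[OF that])
    then show ?thesis using orbit_product.orbit[OF that point_in_real_space[OF that]] by simp
  qed
  show ?case
  proof (cases "I = {}")
    case True
    then have "r = I \<times> I" using equiv_mem[OF less.prems(2)] by auto
    then show ?thesis using orb[OF less.prems(1)] by simp
  next
    case False
    then obtain a where a: "a \<in> I" by blast
    define B where "B = r `` {a}"
    define T where "T = I - B"
    have BI: "B \<subseteq> I" unfolding B_def by (rule equiv_class_subset[OF less.prems(2)])
    have fin: "finite B" "finite T" using BI less.prems(1) by (auto simp: T_def intro: finite_subset)
    have aB: "a \<in> B" using equiv_refl[OF less.prems(2) a] by (simp add: B_def)
    have dis: "B \<inter> T = {}" and un: "I = B \<union> T" using BI by (auto simp: T_def)
    have eT: "equiv T (Restr r T)" by (rule equiv_restrict[OF less.prems(2)]) (simp add: T_def)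
    have "card T < card I" using less.prems(1) a aB by (intro psubset_card_mono) (auto simp: T_def)
    then have oT: "orbit_product T (young_polytope T (Restr r T) f)" using less.hyps fin(2) eT by blast
    have "r = B \<times> B \<union> Restr r T"
    proof (intro equalityI subrelI)
      fix i j assume ij: "(i, j) \<in> r"
      show "(i, j) \<in> B \<times> B \<union> Restr r T"
      proof (cases "i \<in> B")
        case True
        then show ?thesis using equiv_trans[OF less.prems(2) _ ij, of a] by (simp add: B_def)
      next
        case False
        then have "j \<notin> B"
          using equiv_trans[OF less.prems(2) _ equiv_sym[OF less.prems(2) ij], of a] by (auto simp: B_def)
        then show ?thesis using False ij equiv_mem[OF less.prems(2) ij] by (simp add: T_def)
      qed
    next
      fix i j assume "(i, j) \<in> B \<times> B \<union> Restr r T"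
      moreover have "(i, j) \<in> r" if "(a, i) \<in> r" "(a, j) \<in> r"
        using equiv_trans[OF less.prems(2) equiv_sym[OF less.prems(2) that(1)] that(2)] .
      ultimately show "(i, j) \<in> r" by (auto simp: B_def)
    qed
    then have "young_polytope I r f =
        polytope_prod (young_polytope B (B \<times> B) f) (young_polytope T (Restr r T) f)"
      using young_polytope_Un[OF fin equiv_full eT dis, of f] un by metis
    then show ?thesis using orbit_product.prod[OF orb[OF fin(1)] oT dis] un by simp
  qed
qed

lemma orbit_product_iff_young:
  "orbit_product I P \<longleftrightarrow> finite I \<and> (\<exists>r f. equiv I r \<and> P = young_polytope I r f)"
  using orbit_product_imp_young orbit_product_young by metis

lemma maxs_young_polytope:
  assumes I: "finite I" "equiv I r" and g: "shuffle I r g f" "sorted_by r g y"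
  shows "maxs (young_polytope I r f) (pairing I y) = young_polytope I (r \<inter> {(i, j). y i = y j}) g"
proof -
  have sub: "r \<subseteq> I \<times> I" using equiv_mem[OF I(2)] by auto
  have "maxs (young I r f) (pairing I y) = young I (r \<inter> {(i, j). y i = y j}) g"
  proof (intro equalityI subsetI)
    fix v assume v: "v \<in> maxs (young I r f) (pairing I y)"
    then have vy: "v \<in> young I r f" by (simp add: maxs_def)
    then have "shuffle I (r \<inter> {(i, j). y i = y j}) (lookup v) g"
      using v maxs_young_iff[OF I vy] shuffle_level_iff[OF I g] young_lookup[OF I(1) vy] by blast
    then show "v \<in> young I (r \<inter> {(i, j). y i = y j}) g"
      unfolding young_def using young_lookup(2)[OF I(1) vy, symmetric] by blast
  next
    fix v assume "v \<in> young I (r \<inter> {(i, j). y i = y j}) g"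
    then obtain u where u: "v = point I u" "shuffle I r u f" "sorted_by r u y"
      unfolding young_def shuffle_level_iff[OF I g] by blast
    then have vy: "v \<in> young I r f" unfolding young_def by blast
    have "sorted_by r (lookup v) y" using u(3)
      by (subst sorted_by_cong[OF sub, of _ u y y]) (simp_all add: u(1) lookup_point[OF I(1)])
    then show "v \<in> maxs (young I r f) (pairing I y)" using maxs_young_iff[OF I vy] by blast
  qed
  then show ?thesis
    unfolding young_polytope_def maxs_convex_hull[OF finite_young[OF I(1)] linear_pairing] by simp
qed

text \<open>The levels of the indicator are \<open>S\<close> and \<open>T\<close>, so refining
  \<open>r\<close> by them leaves \<open>Restr r S\<close> and \<open>Restr r T\<close>, and a
  polytope over such a union is a product.\<close>

lemma max_face_young:
  assumes I: "finite (S \<union> T)" "equiv (S \<union> T) r" and dis: "S \<inter> T = {}"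
    and g: "shuffle (S \<union> T) r g f" "sorted_by r g (indicat_real S)"
  shows "max_face S (young_polytope (S \<union> T) r f) =
    polytope_prod (young_polytope S (Restr r S) g) (young_polytope T (Restr r T) g)"
proof -
  have "(\<Sum>s\<in>S. lookup z s) = pairing (S \<union> T) (indicat_real S) z" for z
    unfolding pairing_def using I(1) by (intro sum.mono_neutral_cong_left) (auto simp: indicator_def)
  then have "max_face S (young_polytope (S \<union> T) r f) =
      maxs (young_polytope (S \<union> T) r f) (pairing (S \<union> T) (indicat_real S))"
    unfolding max_face_def maxs_def by simp
  also have "\<dots> = young_polytope (S \<union> T) (r \<inter> {(i, j). indicat_real S i = indicat_real S j}) g"
    by (rule maxs_young_polytope[OF I g])
  also have "r \<inter> {(i, j). indicat_real S i = indicat_real S j} = Restr r S \<union> Restr r T"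
    using equiv_mem[OF I(2)] dis by (auto simp: indicator_def split: if_splits)
  also have "young_polytope (S \<union> T) \<dots> g =
      polytope_prod (young_polytope S (Restr r S) g) (young_polytope T (Restr r T) g)"
    using I(1) dis by (intro young_polytope_Un equiv_restrict[OF I(2)]) auto
  finally show ?thesis .
qed

lemma young_polytope_real_space:
  assumes "finite I" shows "young_polytope I r f \<subseteq> real_space I"
  unfolding young_polytope_def
proof (rule hull_minimal)
  show "young I r f \<subseteq> real_space I" using point_in_real_space[OF assms] by (auto simp: young_def)
  show "convex (real_space I)"
    unfolding convex_def
  proof (intro ballI allI impI)
    fix x y and u v :: real assume "x \<in> real_space I" "y \<in> real_space I"
    then have "lookup (u *\<^sub>R x + v *\<^sub>R y) i = 0" if "i \<notin> I" for i
      using that by (simp add: lookup_add lookup_scaleR real_space_lookup)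
    then show "u *\<^sub>R x + v *\<^sub>R y \<in> real_space I" unfolding real_space_def by (auto simp: in_keys_iff)
  qed
qed

lemma orbit_product_real_space: "orbit_product I P \<Longrightarrow> P \<subseteq> real_space I"
  using orbit_product_imp_young young_polytope_real_space by blast

lemma orbit_product_nonempty: "orbit_product I P \<Longrightarrow> P \<noteq> {}"
  using orbit_product_imp_young young_nonempty unfolding young_polytope_def by (metis convex_hull_eq_empty)

text \<open>A sum of vectors supported on \<open>S\<close> and on \<open>T\<close> determines its
  summands, and nonemptiness of \<open>B\<close> allows every element of \<open>A\<close> to occur
  in such a sum.\<close>

lemma polytope_prod_left_subset:
  assumes "S \<inter> T = {}" "A \<subseteq> real_space S" "A' \<subseteq> real_space S" "B \<subseteq> real_space T" "B' \<subseteq> real_space T"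
    and ne: "B \<noteq> {}" and eq: "polytope_prod A B = polytope_prod A' B'"
  shows "A \<subseteq> A'"
proof
  fix a assume a: "a \<in> A"
  obtain b where b: "b \<in> B" using ne by blast
  have "a + b \<in> polytope_prod A B" using a b unfolding polytope_prod_def by blast
  then have "a + b \<in> polytope_prod A' B'" by (simp only: eq)
  then obtain a' b' where ab: "a' \<in> A'" "b' \<in> B'" "a + b = a' + b'" unfolding polytope_prod_def by blast
  have "a = a'"
  proof (rule poly_mapping_eqI)
    fix i
    show "lookup a i = lookup a' i"
    proof (cases "i \<in> S")
      case True
      then have "lookup b i = 0" "lookup b' i = 0"
        using assms(1,4,5) b ab(2) by (metis disjoint_iff real_space_lookup subsetD)+
      then show ?thesis using arg_cong[OF ab(3), of "\<lambda>p. lookup p i"] by (simp add: lookup_add)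
    next
      case False
      then show ?thesis using assms(2,3) a ab(1) by (metis real_space_lookup subsetD)
    qed
  qed
  then show "a \<in> A'" using ab(1) by simp
qed

lemma polytope_prod_commute: "polytope_prod A B = polytope_prod B A"
  by (simp add: polytope_prod_plus add.commute)

text \<open>The definite description is legitimate because factors supported on disjoint label sets
  are determined by their product. All four inclusions are instances of the one-sided lemma.\<close>

lemma face_factors_young:
  assumes I: "finite (S \<union> T)" "equiv (S \<union> T) r" and dis: "S \<inter> T = {}"
    and g: "shuffle (S \<union> T) r g f" "sorted_by r g (indicat_real S)"
  shows "face_factors S T (young_polytope (S \<union> T) r f) =
    (young_polytope S (Restr r S) g, young_polytope T (Restr r T) g)"
  unfolding face_factors_def
proof (rule the_equality)
  let ?A = "young_polytope S (Restr r S) g" and ?B = "young_polytope T (Restr r T) g"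
  have o: "orbit_product S ?A" "orbit_product T ?B"
    using I(1) by (auto intro!: orbit_product_young equiv_restrict[OF I(2)])
  then show "orbit_product S (fst (?A, ?B)) \<and> orbit_product T (snd (?A, ?B)) \<and>
      max_face S (young_polytope (S \<union> T) r f) = polytope_prod (fst (?A, ?B)) (snd (?A, ?B))"
    using max_face_young[OF I dis g] by simp
  fix AB assume AB: "orbit_product S (fst AB) \<and> orbit_product T (snd AB) \<and>
      max_face S (young_polytope (S \<union> T) r f) = polytope_prod (fst AB) (snd AB)"
  then have eq: "polytope_prod (fst AB) (snd AB) = polytope_prod ?A ?B"
    using max_face_young[OF I dis g] by simp
  have rs: "fst AB \<subseteq> real_space S" "snd AB \<subseteq> real_space T" "?A \<subseteq> real_space S" "?B \<subseteq> real_space T"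
    using AB o orbit_product_real_space by blast+
  have ne: "fst AB \<noteq> {}" "snd AB \<noteq> {}" "?A \<noteq> {}" "?B \<noteq> {}"
    using AB o orbit_product_nonempty by blast+
  have dis': "T \<inter> S = {}" using dis by blast
  have eq': "polytope_prod (snd AB) (fst AB) = polytope_prod ?B ?A"
    using eq by (simp add: polytope_prod_commute)
  have "fst AB = ?A"
    using polytope_prod_left_subset[OF dis rs(1,3,2,4) ne(2) eq]
      polytope_prod_left_subset[OF dis rs(3,1,4,2) ne(4) eq[symmetric]] by blast
  moreover have "snd AB = ?B"
    using polytope_prod_left_subset[OF dis' rs(2,4,1,3) ne(1) eq']
      polytope_prod_left_subset[OF dis' rs(4,2,3,1) ne(3) eq'[symmetric]] by blast
  ultimately show "AB = (?A, ?B)" by (simp add: prod_eq_iff)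
qed

section \<open>The Hopf monoid operations on classes\<close>

abbreviation "young_class I r f \<equiv> OP_class I (young_polytope I r f)"

lemma mem_OP_class:
  "Q \<in> OP_class I P \<longleftrightarrow> orbit_product I P \<and> orbit_product I Q \<and> normal_fan I P = normal_fan I Q"
  by (auto simp: normal_equiv_def)

lemma OP_class_eq_iff:
  assumes "orbit_product I P" "orbit_product I Q"
  shows "OP_class I P = OP_class I Q \<longleftrightarrow> normal_fan I P = normal_fan I Q"
proof
  assume eq: "OP_class I P = OP_class I Q"
  have "Q \<in> OP_class I Q" unfolding mem_OP_class using assms by blast
  then have "Q \<in> OP_class I P" by (simp only: eq)
  then show "normal_fan I P = normal_fan I Q" unfolding mem_OP_class by blast
next
  assume "normal_fan I P = normal_fan I Q"
  then have "R \<in> OP_class I P \<longleftrightarrow> R \<in> OP_class I Q" for R unfolding mem_OP_class using assms by auto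
  then show "OP_class I P = OP_class I Q" by blast
qed

lemma young_class_eq_iff:
  assumes "finite I" "equiv I r" "equiv I s"
  shows "young_class I r f = young_class I s g \<longleftrightarrow> (\<forall>y y'. dominates I r f y y' \<longleftrightarrow> dominates I s g y y')"
  using OP_class_eq_iff[OF orbit_product_young orbit_product_young] young_normal_fan_eq_iff assms by metis

lemma mem_young_class:
  assumes I: "finite I" "equiv I r" and Q: "Q \<in> young_class I r f"
  obtains s g where "equiv I s" "Q = young_polytope I s g"
    "\<And>y y'. dominates I s g y y' \<longleftrightarrow> dominates I r f y y'"
proof -
  have Q': "orbit_product I Q" "normal_fan I (young_polytope I r f) = normal_fan I Q"
    using Q unfolding mem_OP_class by auto
  obtain s g where sg: "equiv I s" "Q = young_polytope I s g" using orbit_product_imp_young[OF Q'(1)] by blast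
  have "\<forall>y y'. dominates I r f y y' \<longleftrightarrow> dominates I s g y y'"
    using young_normal_fan_eq_iff[OF I(1,2) sg(1), of f g] Q'(2) unfolding sg(2) by (rule iffD1)
  then show ?thesis using that[OF sg] by simp
qed

lemma young_in_class: "finite I \<Longrightarrow> equiv I r \<Longrightarrow> young_polytope I r f \<in> young_class I r f"
  unfolding mem_OP_class using orbit_product_young by blast

lemma OP_iff:
  assumes "finite I" shows "X \<in> OP I \<longleftrightarrow> (\<exists>r f. equiv I r \<and> X = young_class I r f)"
proof -
  have "X \<in> OP I \<longleftrightarrow> (\<exists>P. orbit_product I P \<and> X = OP_class I P)"
    by (auto simp: OP_def quotient_def)
  then show ?thesis unfolding orbit_product_iff_young using assms by blast
qed

text \<open>Passing to one factor needs a sorted arrangement of the other to complete the given one;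
  \<open>g0\<close> and \<open>h0\<close> supply it.\<close>

lemma dominates_Un:
  assumes fin: "finite S" "finite T" and eq: "equiv S r" "equiv T s" and dis: "S \<inter> T = {}"
  shows "dominates (S \<union> T) (r \<union> s) f y y' \<longleftrightarrow> dominates S r f y y' \<and> dominates T s f y y'"
proof -
  have sub: "r \<subseteq> S \<times> S" "s \<subseteq> T \<times> T" using equiv_mem[OF eq(1)] equiv_mem[OF eq(2)] by auto
  have glue: "\<exists>k. (shuffle S r k f \<longleftrightarrow> shuffle S r g f) \<and> (shuffle T s k f \<longleftrightarrow> shuffle T s h f) \<and>
      (\<forall>z. sorted_by r k z \<longleftrightarrow> sorted_by r g z) \<and> (\<forall>z. sorted_by s k z \<longleftrightarrow> sorted_by s h z)" for g h
  proof (intro exI conjI allI)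
    let ?k = "\<lambda>i. if i \<in> S then g i else h i"
    have T: "i \<in> T \<Longrightarrow> ?k i = h i" for i using dis by auto
    show "shuffle S r ?k f \<longleftrightarrow> shuffle S r g f" by (rule shuffle_cong) auto
    show "shuffle T s ?k f \<longleftrightarrow> shuffle T s h f" by (rule shuffle_cong) (use T in auto)
    show "sorted_by r ?k z \<longleftrightarrow> sorted_by r g z" for z by (rule sorted_by_cong[OF sub(1)]) auto
    show "sorted_by s ?k z \<longleftrightarrow> sorted_by s h z" for z by (rule sorted_by_cong[OF sub(2)]) (use T in auto)
  qed
  obtain g0 where g0: "shuffle S r g0 f" "sorted_by r g0 y" by (rule sorted_by_exists[OF fin(1) eq(1)])
  obtain h0 where h0: "shuffle T s h0 f" "sorted_by s h0 y" by (rule sorted_by_exists[OF fin(2) eq(2)])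
  show ?thesis
  proof
    assume d: "dominates (S \<union> T) (r \<union> s) f y y'"
    then have d: "shuffle S r k f \<Longrightarrow> shuffle T s k f \<Longrightarrow> sorted_by r k y \<Longrightarrow> sorted_by s k y \<Longrightarrow>
        sorted_by r k y' \<and> sorted_by s k y'" for k
      unfolding dominates_def shuffle_Un[OF fin eq dis] sorted_by_Un by blast
    show "dominates S r f y y' \<and> dominates T s f y y'"
      unfolding dominates_def
    proof (intro conjI allI impI)
      fix g assume g: "shuffle S r g f" "sorted_by r g y"
      obtain k where k: "shuffle S r k f" "shuffle T s k f" "sorted_by r k y" "sorted_by s k y"
        "\<forall>z. sorted_by r k z \<longleftrightarrow> sorted_by r g z" using glue[of g h0] g h0 by metis
      then show "sorted_by r g y'" using d[OF k(1-4)] by blast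
    next
      fix h assume h: "shuffle T s h f" "sorted_by s h y"
      obtain k where k: "shuffle S r k f" "shuffle T s k f" "sorted_by r k y" "sorted_by s k y"
        "\<forall>z. sorted_by s k z \<longleftrightarrow> sorted_by s h z" using glue[of g0 h] g0 h by metis
      then show "sorted_by s h y'" using d[OF k(1-4)] by blast
    qed
  next
    assume "dominates S r f y y' \<and> dominates T s f y y'"
    then show "dominates (S \<union> T) (r \<union> s) f y y'"
      unfolding dominates_def shuffle_Un[OF fin eq dis] sorted_by_Un by blast
  qed
qed

lemma dominates_arrangement_cong:
  assumes "\<And>i. i \<in> I \<Longrightarrow> f i = f' i" shows "dominates I r f y y' \<longleftrightarrow> dominates I r f' y y'"
  unfolding dominates_def using shuffle_cong[of I _ _ f f'] assms by metis

text \<open>The rearrangements of two order-equivalent arrangements by the same permutation order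
  the labels in the same way, so values matter only through their comparisons.\<close>

lemma dominates_order_cong:
  assumes eq: "equiv I r" and o: "\<And>i j. i \<in> I \<Longrightarrow> j \<in> I \<Longrightarrow> f i < f j \<longleftrightarrow> f' i < f' j"
  shows "dominates I r f y y' \<longleftrightarrow> dominates I r f' y y'"
proof -
  have imp: "dominates I r f2 y y'" if d: "dominates I r f1 y y'"
    and o: "\<And>i j. i \<in> I \<Longrightarrow> j \<in> I \<Longrightarrow> f1 i < f1 j \<longleftrightarrow> f2 i < f2 j" for f1 f2 :: "'a \<Rightarrow> real"
    unfolding dominates_def
  proof (intro allI impI)
    fix g assume g: "shuffle I r g f2" "sorted_by r g y"
    then obtain \<sigma> where s: "\<sigma> permutes I" "\<forall>i\<in>I. (i, \<sigma> i) \<in> r" "\<forall>i\<in>I. g i = f2 (\<sigma> i)"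
      unfolding shuffle_def by blast
    have "shuffle I r (f1 \<circ> \<sigma>) f1" unfolding shuffle_def using s by auto
    moreover have c: "sorted_by r (f1 \<circ> \<sigma>) z \<longleftrightarrow> sorted_by r g z" for z
    proof -
      have "f1 (\<sigma> j) < f1 (\<sigma> i) \<longleftrightarrow> g j < g i" if "(i, j) \<in> r" for i j
        using equiv_mem[OF eq that] s(3) o permutes_in_image[OF s(1)] by auto
      then show ?thesis unfolding sorted_by_def by (intro ball_cong) auto
    qed
    ultimately show "sorted_by r g y'" using d g(2) unfolding dominates_def by blast
  qed
  show ?thesis using imp[of f f'] imp[of f' f] o by blast
qed

text \<open>Raising \<open>y\<close> on \<open>S\<close> by a large constant turns maximisation over the maximal face of \<open>1\<^sub>S\<close>
  into maximisation over the whole polytope.\<close>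

lemma sorted_by_shift:
  assumes eq: "equiv (S \<union> T) r" and M: "\<And>i j. i \<in> S \<Longrightarrow> j \<in> T \<Longrightarrow> y j < y i + M" and dis: "S \<inter> T = {}"
  shows "sorted_by r h (\<lambda>i. if i \<in> S then y i + M else y i) \<longleftrightarrow>
    sorted_by r h (indicat_real S) \<and> sorted_by (Restr r S \<union> Restr r T) h y"
proof -
  let ?y = "\<lambda>i. if i \<in> S then y i + M else y i" and ?r = "Restr r S \<union> Restr r T"
  have iff: "?y j \<le> ?y i \<longleftrightarrow>
      indicat_real S j \<le> indicat_real S i \<and> ((i, j) \<in> ?r \<longrightarrow> y j \<le> y i)" if "(i, j) \<in> r" for i j
    using equiv_mem[OF eq that] M[of i j] M[of j i] dis that by (auto simp: indicator_def)
  show ?thesis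
  proof
    assume *: "sorted_by r h ?y"
    show "sorted_by r h (indicat_real S) \<and> sorted_by ?r h y"
      unfolding sorted_by_def
    proof (intro conjI ballI, safe)
      fix i j assume "(i, j) \<in> r" "h j < h i"
      then show "indicat_real S j \<le> indicat_real S i" using * iff[of i j] unfolding sorted_by_def by blast
    next
      fix i j assume ij: "(i, j) \<in> r" "i \<in> S" "j \<in> S" "h j < h i"
      then have "(i, j) \<in> ?r" by blast
      then show "y j \<le> y i" using * iff[of i j] ij unfolding sorted_by_def by blast
    next
      fix i j assume ij: "(i, j) \<in> r" "i \<in> T" "j \<in> T" "h j < h i"
      then have "(i, j) \<in> ?r" by blast
      then show "y j \<le> y i" using * iff[of i j] ij unfolding sorted_by_def by blast
    qed
  next
    assume *: "sorted_by r h (indicat_real S) \<and> sorted_by ?r h y"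
    show "sorted_by r h ?y" unfolding sorted_by_def
    proof (clarify)
      fix i j assume ij: "(i, j) \<in> r" "h j < h i"
      then have "indicat_real S j \<le> indicat_real S i" "(i, j) \<in> ?r \<longrightarrow> y j \<le> y i"
        using * unfolding sorted_by_def by blast+
      then show "?y j \<le> ?y i" using iff[OF ij(1)] by blast
    qed
  qed
qed

lemma split_level_indicator:
  assumes "equiv (S \<union> T) r" "S \<inter> T = {}"
  shows "r \<inter> {(i, j). indicat_real S i = indicat_real S j} = Restr r S \<union> Restr r T"
  using equiv_mem[OF assms(1)] assms(2) by (auto simp: indicator_def split: if_splits)

lemma shuffle_split:
  assumes I: "finite (S \<union> T)" "equiv (S \<union> T) r" and dis: "S \<inter> T = {}"
    and g: "shuffle (S \<union> T) r g f" "sorted_by r g (indicat_real S)"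
  shows "shuffle (S \<union> T) (Restr r S \<union> Restr r T) h g \<longleftrightarrow>
    shuffle (S \<union> T) r h f \<and> sorted_by r h (indicat_real S)"
  using shuffle_level_iff[OF I g] unfolding split_level_indicator[OF I(2) dis] .

text \<open>For functionals raised by \<open>M\<close> on \<open>S\<close> the maximal faces lie in
  the maximal face of the indicator, which is the product of the two restrictions. Dominance on the
  whole polytope therefore decides dominance on this product.\<close>

lemma dominates_shift:
  assumes I: "finite (S \<union> T)" "equiv (S \<union> T) r" and dis: "S \<inter> T = {}"
    and g: "shuffle (S \<union> T) r g f" "sorted_by r g (indicat_real S)"
    and M: "\<And>i j. i \<in> S \<Longrightarrow> j \<in> T \<Longrightarrow> y j < y i + M" "\<And>i j. i \<in> S \<Longrightarrow> j \<in> T \<Longrightarrow> y' j < y' i + M"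
  shows "dominates (S \<union> T) r f (\<lambda>i. if i \<in> S then y i + M else y i) (\<lambda>i. if i \<in> S then y' i + M else y' i)
    \<longleftrightarrow> dominates S (Restr r S) g y y' \<and> dominates T (Restr r T) g y y'"
proof -
  have "equiv S (Restr r S)" "equiv T (Restr r T)" by (auto intro: equiv_restrict[OF I(2)])
  then have *: "dominates S (Restr r S) g y y' \<and> dominates T (Restr r T) g y y' \<longleftrightarrow>
      dominates (S \<union> T) (Restr r S \<union> Restr r T) g y y'"
    using dominates_Un[of S T "Restr r S" "Restr r T" g y y'] I(1) dis by simp
  have c: "sorted_by r h (\<lambda>i. if i \<in> S then z i + M else z i) \<longleftrightarrow>
      sorted_by r h (indicat_real S) \<and> sorted_by (Restr r S \<union> Restr r T) h z"
    if "\<And>i j. i \<in> S \<Longrightarrow> j \<in> T \<Longrightarrow> z j < z i + M" for z h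
    by (rule sorted_by_shift[OF I(2) _ dis]) (rule that)
  show ?thesis
    unfolding *
    unfolding dominates_def shuffle_split[OF I dis g] c[of y, OF M(1), simplified] c[of y', OF M(2), simplified]
    by (intro arg_cong[where f = All] ext) blast
qed

lemma shift_exists:
  assumes "finite I"
  obtains M :: real where "\<And>i j. i \<in> I \<Longrightarrow> j \<in> I \<Longrightarrow> y j < y i + M" "\<And>i j. i \<in> I \<Longrightarrow> j \<in> I \<Longrightarrow> y' j < y' i + M"
proof -
  let ?m = "\<Sum>i\<in>I. \<bar>y i\<bar> + \<bar>y' i\<bar>"
  have "\<bar>y i\<bar> + \<bar>y' i\<bar> \<le> ?m" if "i \<in> I" for i
    using member_le_sum[of i I "\<lambda>i. \<bar>y i\<bar> + \<bar>y' i\<bar>"] that assms by auto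
  then have "\<bar>y i\<bar> \<le> ?m" "\<bar>y' i\<bar> \<le> ?m" if "i \<in> I" for i
    using that by (smt (verit))+
  \<comment> \<open>Two values of \<open>y\<close> differ by at most twice the bound
    \<open>?m\<close>, and so do two values of \<open>y'\<close>; one more than that exceeds every
    difference for both functionals.\<close>
  then show ?thesis by (intro that[of "2 * ?m + 1"]) (smt (verit))+
qed

text \<open>This is the well-definedness of the coproduct on classes. The shift yields the
  equivalence for both sides together; they are separated by functionals that vanish on one side,
  where dominance holds trivially.\<close>

lemma dominates_restrict_eq:
  assumes I: "finite (S \<union> T)" and r: "equiv (S \<union> T) r" and s: "equiv (S \<union> T) s" and dis: "S \<inter> T = {}"
    and g: "shuffle (S \<union> T) r g f" "sorted_by r g (indicat_real S)"
    and h: "shuffle (S \<union> T) s h k" "sorted_by s h (indicat_real S)"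
    and eq: "\<And>y y'. dominates (S \<union> T) r f y y' \<longleftrightarrow> dominates (S \<union> T) s k y y'"
  shows "dominates S (Restr r S) g y y' \<longleftrightarrow> dominates S (Restr s S) h y y'"
    and "dominates T (Restr r T) g y y' \<longleftrightarrow> dominates T (Restr s T) h y y'"
proof -
  have both: "dominates S (Restr r S) g y y' \<and> dominates T (Restr r T) g y y' \<longleftrightarrow>
      dominates S (Restr s S) h y y' \<and> dominates T (Restr s T) h y y'" for y y'
  proof -
    obtain M where M: "\<And>i j. i \<in> S \<union> T \<Longrightarrow> j \<in> S \<union> T \<Longrightarrow> y j < y i + M"
        "\<And>i j. i \<in> S \<union> T \<Longrightarrow> j \<in> S \<union> T \<Longrightarrow> y' j < y' i + M"
      using shift_exists[OF I, of y y'] by blast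
    show ?thesis
      using dominates_shift[OF I r dis g, of y M y'] dominates_shift[OF I s dis h, of y M y'] M eq by simp
  qed
  have TS: "i \<in> T \<Longrightarrow> i \<notin> S" "i \<in> S \<Longrightarrow> i \<notin> T" for i using dis by auto
  have eS: "equiv S (Restr r S)" "equiv S (Restr s S)" and eT: "equiv T (Restr r T)" "equiv T (Restr s T)"
    by (auto intro: equiv_restrict[OF r] equiv_restrict[OF s])
  let ?S = "\<lambda>y i. if i \<in> S then y i else 0" and ?T = "\<lambda>y i. if i \<in> T then y i else 0"
  have sS: "dominates S (Restr r S) g (?S y) (?S y') \<longleftrightarrow> dominates S (Restr r S) g y y'"
    "dominates S (Restr s S) h (?S y) (?S y') \<longleftrightarrow> dominates S (Restr s S) h y y'"
    by (rule dominates_cong[OF eS(1)]; simp) (rule dominates_cong[OF eS(2)]; simp)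
  have zT: "dominates T (Restr r T) g (?S y) (?S y')" "dominates T (Restr s T) h (?S y) (?S y')"
    using dominates_cong[OF eT(1), of "?S y" "\<lambda>_. 0" "?S y'" "\<lambda>_. 0"]
      dominates_cong[OF eT(2), of "?S y" "\<lambda>_. 0" "?S y'" "\<lambda>_. 0"] TS by (simp_all add: dominates_refl)
  show "dominates S (Restr r S) g y y' \<longleftrightarrow> dominates S (Restr s S) h y y'"
    using both[of "?S y" "?S y'"] sS zT by simp
  have sT: "dominates T (Restr r T) g (?T y) (?T y') \<longleftrightarrow> dominates T (Restr r T) g y y'"
    "dominates T (Restr s T) h (?T y) (?T y') \<longleftrightarrow> dominates T (Restr s T) h y y'"
    by (rule dominates_cong[OF eT(1)]; simp) (rule dominates_cong[OF eT(2)]; simp)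
  have zS: "dominates S (Restr r S) g (?T y) (?T y')" "dominates S (Restr s S) h (?T y) (?T y')"
    using dominates_cong[OF eS(1), of "?T y" "\<lambda>_. 0" "?T y'" "\<lambda>_. 0"]
      dominates_cong[OF eS(2), of "?T y" "\<lambda>_. 0" "?T y'" "\<lambda>_. 0"] TS by (simp_all add: dominates_refl)
  show "dominates T (Restr r T) g y y' \<longleftrightarrow> dominates T (Restr s T) h y y'"
    using both[of "?T y" "?T y'"] sT zS by simp
qed

section \<open>Transport along bijections of label sets\<close>

lemma equiv_map_prod:
  assumes "equiv I r" "bij_betw \<sigma> I J" shows "equiv J (map_prod \<sigma> \<sigma> ` r)"
proof (rule equivI)
  have im: "\<sigma> ` I = J" and inj: "inj_on \<sigma> I" using assms(2) by (auto simp: bij_betw_def)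
  note m = equiv_mem[OF assms(1)]
  show "map_prod \<sigma> \<sigma> ` r \<subseteq> J \<times> J" using m im by auto
  show "refl_on J (map_prod \<sigma> \<sigma> ` r)" using equiv_refl[OF assms(1)] im by (auto simp: refl_on_def)
  show "sym (map_prod \<sigma> \<sigma> ` r)" using equiv_sym[OF assms(1)] by (auto simp: sym_def)
  show "trans (map_prod \<sigma> \<sigma> ` r)"
  proof (rule transI)
    fix x y z assume "(x, y) \<in> map_prod \<sigma> \<sigma> ` r" "(y, z) \<in> map_prod \<sigma> \<sigma> ` r"
    then obtain a b c d where *: "(a, b) \<in> r" "(c, d) \<in> r" "x = \<sigma> a" "y = \<sigma> b" "y = \<sigma> c" "z = \<sigma> d" by auto
    then have "b = c" using m inj by (metis inj_onD)
    then have "(a, d) \<in> r" using * equiv_trans[OF assms(1)] by blast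
    then show "(x, z) \<in> map_prod \<sigma> \<sigma> ` r" using * by force
  qed
qed

lemma class_map_prod:
  assumes "equiv I r" "bij_betw \<sigma> I J" "a \<in> I"
  shows "(map_prod \<sigma> \<sigma> ` r) `` {\<sigma> a} = \<sigma> ` (r `` {a})"
proof -
  have inj: "inj_on \<sigma> I" using assms(2) by (auto simp: bij_betw_def)
  have "b = a" if "(b, c) \<in> r" "\<sigma> b = \<sigma> a" for b c
    using that equiv_mem[OF assms(1)] inj assms(3) by (metis inj_onD)
  then show ?thesis using assms(3) by (auto simp: image_iff)
qed

lemma shuffle_relabel:
  assumes I: "finite I" "equiv I r" and b: "bij_betw \<sigma> I J" and t: "\<forall>i\<in>I. \<tau> (\<sigma> i) = i"
  shows "shuffle J (map_prod \<sigma> \<sigma> ` r) h (f \<circ> \<tau>) \<longleftrightarrow> shuffle I r (h \<circ> \<sigma>) f"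
proof -
  have J: "finite J" "J = \<sigma> ` I" using b I(1) by (auto simp: bij_betw_def)
  have c: "card {b \<in> \<sigma> ` (r `` {a}). k b = x} = card {b \<in> r `` {a}. k (\<sigma> b) = x}" for a x and k :: "'b \<Rightarrow> 'c"
  proof -
    have "{b \<in> \<sigma> ` (r `` {a}). k b = x} = \<sigma> ` {b \<in> r `` {a}. k (\<sigma> b) = x}" by auto
    moreover have "inj_on \<sigma> {b \<in> r `` {a}. k (\<sigma> b) = x}"
      using b equiv_class_subset[OF I(2), of a] by (auto simp: bij_betw_def intro: inj_on_subset)
    ultimately show ?thesis by (simp add: card_image)
  qed
  have "{b \<in> r `` {a}. (f \<circ> \<tau>) (\<sigma> b) = x} = {b \<in> r `` {a}. f b = x}" for a x
    using t equiv_class_subset[OF I(2), of a] by (auto simp: subset_iff)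
  then have ft: "card {b \<in> r `` {a}. (f \<circ> \<tau>) (\<sigma> b) = x} = card {b \<in> r `` {a}. f b = x}" for a x by simp
  have "shuffle J (map_prod \<sigma> \<sigma> ` r) h (f \<circ> \<tau>) \<longleftrightarrow>
    (\<forall>a\<in>I. \<forall>x. card {b \<in> \<sigma> ` (r `` {a}). h b = x} = card {b \<in> \<sigma> ` (r `` {a}). (f \<circ> \<tau>) b = x})"
    unfolding shuffle_iff_card[OF J(1) equiv_map_prod[OF I(2) b]]
    by (simp only: J(2) ball_simps class_map_prod[OF I(2) b] cong: ball_cong)
  also have "\<dots> \<longleftrightarrow> shuffle I r (h \<circ> \<sigma>) f"
    unfolding shuffle_iff_card[OF I] c ft comp_apply[of h] ..
  finally show ?thesis .
qed

lemma sorted_by_relabel: "sorted_by (map_prod \<sigma> \<sigma> ` r) h y \<longleftrightarrow> sorted_by r (h \<circ> \<sigma>) (y \<circ> \<sigma>)"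
  by (auto simp: sorted_by_def)

lemma dominates_relabel:
  assumes I: "finite I" "equiv I r" and b: "bij_betw \<sigma> I J" and t: "\<forall>i\<in>I. \<tau> (\<sigma> i) = i"
  shows "dominates J (map_prod \<sigma> \<sigma> ` r) (f \<circ> \<tau>) y y' \<longleftrightarrow> dominates I r f (y \<circ> \<sigma>) (y' \<circ> \<sigma>)"
  unfolding dominates_def shuffle_relabel[where \<tau> = \<tau>, OF I b t] sorted_by_relabel
proof (intro iffI allI impI)
  have sub: "r \<subseteq> I \<times> I" using equiv_mem[OF I(2)] by auto
  fix g assume *: "\<forall>h. shuffle I r (h \<circ> \<sigma>) f \<longrightarrow> sorted_by r (h \<circ> \<sigma>) (y \<circ> \<sigma>) \<longrightarrow> sorted_by r (h \<circ> \<sigma>) (y' \<circ> \<sigma>)"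
    and g: "shuffle I r g f" "sorted_by r g (y \<circ> \<sigma>)"
  have "shuffle I r ((g \<circ> \<tau>) \<circ> \<sigma>) f \<longleftrightarrow> shuffle I r g f" by (rule shuffle_cong) (use t in auto)
  moreover have "sorted_by r ((g \<circ> \<tau>) \<circ> \<sigma>) z \<longleftrightarrow> sorted_by r g z" for z by (rule sorted_by_cong[OF sub]) (use t in auto)
  ultimately show "sorted_by r g (y' \<circ> \<sigma>)" using * g by blast
qed blast

lemma young_polytope_relabel:
  assumes I: "finite I" "equiv I r" and b: "bij_betw \<sigma> I J" and t: "\<forall>i\<in>I. \<tau> (\<sigma> i) = i"
  shows "relabel \<sigma> ` young_polytope I r f = young_polytope J (map_prod \<sigma> \<sigma> ` r) (f \<circ> \<tau>)"
proof -
  have "relabel \<sigma> ` young I r f = young J (map_prod \<sigma> \<sigma> ` r) (f \<circ> \<tau>)"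
    unfolding young_def shuffle_relabel[where \<tau> = \<tau>, OF I b t]
  proof (intro equalityI subsetI)
    fix x assume "x \<in> relabel \<sigma> ` {point I g |g. shuffle I r g f}"
    then obtain g where g: "x = point J (g \<circ> \<tau>)" "shuffle I r g f" using relabel_point[where \<tau> = \<tau>, OF I(1) b t] by auto
    have "shuffle I r ((g \<circ> \<tau>) \<circ> \<sigma>) f \<longleftrightarrow> shuffle I r g f" by (rule shuffle_cong) (use t in auto)
    then show "x \<in> {point J h |h. shuffle I r (h \<circ> \<sigma>) f}" using g by blast
  next
    fix x assume "x \<in> {point J h |h. shuffle I r (h \<circ> \<sigma>) f}"
    then obtain h where h: "x = point J h" "shuffle I r (h \<circ> \<sigma>) f" by blast
    have "relabel \<sigma> (point I (h \<circ> \<sigma>)) = point J ((h \<circ> \<sigma>) \<circ> \<tau>)" by (rule relabel_point[OF I(1) b t])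
    also have "\<dots> = point J h" using b t by (intro point_cong) (auto simp: bij_betw_def)
    finally have "x = relabel \<sigma> (point I (h \<circ> \<sigma>))" using h(1) by simp
    then show "x \<in> relabel \<sigma> ` {point I g |g. shuffle I r g f}" using h(2) by blast
  qed
  then show ?thesis
    unfolding young_polytope_def convex_hull_linear_image[OF linear_relabel] by simp
qed

section \<open>Relabelling, product and coproduct of classes\<close>

lemma OP_relabel_young:
  assumes I: "finite I" "equiv I r" and b: "bij_betw \<sigma> I J" and t: "\<forall>i\<in>I. \<tau> (\<sigma> i) = i"
  shows "OP_relabel \<sigma> J (young_class I r f) = young_class J (map_prod \<sigma> \<sigma> ` r) (f \<circ> \<tau>)"
  unfolding OP_relabel_def
proof (rule SUP_eq_const)
  show "young_class I r f \<noteq> {}" using young_in_class[OF I] by blast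
  have J: "finite J" using b I(1) by (auto simp: bij_betw_def)
  fix P assume "P \<in> young_class I r f"
  then obtain s g where s: "equiv I s" and P: "P = young_polytope I s g"
    and d: "\<And>y y'. dominates I s g y y' \<longleftrightarrow> dominates I r f y y'" by (rule mem_young_class[OF I]) blast
  show "OP_class J (relabel \<sigma> ` P) = young_class J (map_prod \<sigma> \<sigma> ` r) (f \<circ> \<tau>)"
    unfolding P young_polytope_relabel[where \<tau> = \<tau>, OF I(1) s b t]
      young_class_eq_iff[OF J equiv_map_prod[OF s b] equiv_map_prod[OF I(2) b]]
      dominates_relabel[where \<tau> = \<tau>, OF I(1) s b t] dominates_relabel[where \<tau> = \<tau>, OF I b t] d by simp
qed

lemma OP_mult_young:
  assumes fin: "finite S" "finite T" and eq: "equiv S r" "equiv T s" and dis: "S \<inter> T = {}"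
  shows "OP_mult S T (young_class S r f) (young_class T s f) = young_class (S \<union> T) (r \<union> s) f"
  unfolding OP_mult_def
proof (intro SUP_eq_const)
  show "young_class S r f \<noteq> {}" "young_class T s f \<noteq> {}" using young_in_class fin eq by blast+
  fix P Q assume "P \<in> young_class S r f" and "Q \<in> young_class T s f"
  obtain r' g where r': "equiv S r'" and P: "P = young_polytope S r' g"
    and dP: "\<And>y y'. dominates S r' g y y' \<longleftrightarrow> dominates S r f y y'"
    by (rule mem_young_class[OF fin(1) eq(1) \<open>P \<in> young_class S r f\<close>]) blast
  obtain s' h where s': "equiv T s'" and Q: "Q = young_polytope T s' h"
    and dQ: "\<And>y y'. dominates T s' h y y' \<longleftrightarrow> dominates T s f y y'"
    by (rule mem_young_class[OF fin(2) eq(2) \<open>Q \<in> young_class T s f\<close>]) blast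
  define k where "k i = (if i \<in> S then g i else h i)" for i
  have k: "i \<in> S \<Longrightarrow> g i = k i" "i \<in> T \<Longrightarrow> h i = k i" for i using dis by (auto simp: k_def)
  have P': "P = young_polytope S r' k" and Q': "Q = young_polytope T s' k"
    unfolding P Q by (intro young_polytope_cong k; assumption)+
  have "dominates S r' k y y' \<longleftrightarrow> dominates S r f y y'" "dominates T s' k y y' \<longleftrightarrow> dominates T s f y y'" for y y'
    unfolding dP[symmetric] dQ[symmetric] using k dominates_arrangement_cong[of S g k]
      dominates_arrangement_cong[of T h k] by auto
  then show "OP_class (S \<union> T) (polytope_prod P Q) = young_class (S \<union> T) (r \<union> s) f"
    unfolding P' Q' young_polytope_Un[OF fin r' s' dis, symmetric] using fin
    by (subst young_class_eq_iff[OF _ equiv_Un[OF r' s' dis] equiv_Un[OF eq dis]])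
      (simp_all add: dominates_Un[OF fin r' s' dis] dominates_Un[OF fin eq dis])
qed

text \<open>All representatives give the same two classes, because the restrictions are determined
  up to \<open>dominates\<close>. Any sorted \<open>g\<close> may be used to name them.\<close>

lemma OP_comult_young:
  assumes I: "finite (S \<union> T)" "equiv (S \<union> T) r" and dis: "S \<inter> T = {}"
    and g: "shuffle (S \<union> T) r g f" "sorted_by r g (indicat_real S)"
  shows "OP_comult S T (young_class (S \<union> T) r f) =
    (young_class S (Restr r S) g, young_class T (Restr r T) g)"
proof -
  let ?X = "young_class (S \<union> T) r f"
  have "OP_class S (fst (face_factors S T P)) = young_class S (Restr r S) g \<and>
      OP_class T (snd (face_factors S T P)) = young_class T (Restr r T) g" if PX: "P \<in> ?X" for P
  proof -
    obtain s k where s: "equiv (S \<union> T) s" and P: "P = young_polytope (S \<union> T) s k"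
      and d: "\<And>y y'. dominates (S \<union> T) s k y y' \<longleftrightarrow> dominates (S \<union> T) r f y y'"
      using mem_young_class[OF I PX] by blast
    obtain h where h: "shuffle (S \<union> T) s h k" "sorted_by s h (indicat_real S)" by (rule sorted_by_exists[OF I(1) s])
    have fin: "finite S" "finite T" using I(1) by auto
    show ?thesis
      unfolding P face_factors_young[OF I(1) s dis h] fst_conv snd_conv
      using young_class_eq_iff[OF fin(1), of "Restr s S" "Restr r S" h g]
        young_class_eq_iff[OF fin(2), of "Restr s T" "Restr r T" h g]
        equiv_restrict[OF s] equiv_restrict[OF I(2)] dominates_restrict_eq[OF I(1) s I(2) dis h g d]
      by simp
  qed
  moreover have "?X \<noteq> {}" using young_in_class[OF I] by blast
  ultimately show ?thesis unfolding OP_comult_def by (simp add: SUP_eq_const)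
qed

section \<open>Cuts: the composition of an orbit polytope\<close>

text \<open>The proper partial sums of the composition that lists the multiplicities of the values of \<open>f\<close>
  on \<open>B\<close> in decreasing order of the values.\<close>

definition cuts :: "'a set \<Rightarrow> ('a \<Rightarrow> real) \<Rightarrow> nat set" where
  "cuts B f = {card U |U. U \<subseteq> B \<and> U \<noteq> {} \<and> U \<noteq> B \<and> (\<forall>a\<in>U. \<forall>b\<in>B - U. f b < f a)}"

lemma cutsI:
  assumes "U \<subseteq> B" "U \<noteq> {}" "U \<noteq> B" "\<And>a b. a \<in> U \<Longrightarrow> b \<in> B \<Longrightarrow> b \<notin> U \<Longrightarrow> f b < f a" "card U = d"
  shows "d \<in> cuts B f"
  unfolding cuts_def using assms by blast

lemma cutsE:
  assumes "d \<in> cuts B f"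
  obtains U where "U \<subseteq> B" "U \<noteq> {}" "U \<noteq> B" "\<And>a b. a \<in> U \<Longrightarrow> b \<in> B \<Longrightarrow> b \<notin> U \<Longrightarrow> f b < f a" "card U = d"
  using assms unfolding cuts_def by blast

lemma cuts_bounds:
  assumes "finite B" "d \<in> cuts B f" shows "0 < d" "d < card B"
proof -
  obtain U where U: "U \<subseteq> B" "U \<noteq> {}" "U \<noteq> B" "card U = d" using assms(2) by (rule cutsE) blast
  show "0 < d" using U finite_subset[OF U(1) assms(1)] by (auto simp: card_gt_0_iff)
  show "d < card B" using U psubset_card_mono[OF assms(1), of U] by auto
qed

lemma cuts_image:
  assumes inj: "inj_on \<sigma> B" and o: "\<And>a b. a \<in> B \<Longrightarrow> b \<in> B \<Longrightarrow> g (\<sigma> a) < g (\<sigma> b) \<longleftrightarrow> f a < f b"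
  shows "cuts (\<sigma> ` B) g = cuts B f"
proof (intro equalityI subsetI)
  fix d assume "d \<in> cuts B f"
  then obtain U where U: "U \<subseteq> B" "U \<noteq> {}" "U \<noteq> B" "\<And>a b. a \<in> U \<Longrightarrow> b \<in> B \<Longrightarrow> b \<notin> U \<Longrightarrow> f b < f a" "card U = d"
    by (rule cutsE) blast
  have sub: "inj_on \<sigma> U" using inj U(1) by (rule inj_on_subset)
  show "d \<in> cuts (\<sigma> ` B) g"
  proof (rule cutsI)
    show "\<sigma> ` U \<subseteq> \<sigma> ` B" "\<sigma> ` U \<noteq> {}" using U by auto
    show "\<sigma> ` U \<noteq> \<sigma> ` B" using U(1,3) inj by (simp add: inj_on_image_eq_iff)
    show "card (\<sigma> ` U) = d" using U(5) sub by (simp add: card_image)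
    fix a b assume "a \<in> \<sigma> ` U" "b \<in> \<sigma> ` B" "b \<notin> \<sigma> ` U"
    then obtain a' b' where "a' \<in> U" "b' \<in> B" "b' \<notin> U" "a = \<sigma> a'" "b = \<sigma> b'" by auto
    moreover from this have "f b' < f a'" "a' \<in> B" using U(1,4) by auto
    ultimately show "g b < g a" using o by simp
  qed
next
  fix d assume "d \<in> cuts (\<sigma> ` B) g"
  then obtain V where V: "V \<subseteq> \<sigma> ` B" "V \<noteq> {}" "V \<noteq> \<sigma> ` B"
    "\<And>a b. a \<in> V \<Longrightarrow> b \<in> \<sigma> ` B \<Longrightarrow> b \<notin> V \<Longrightarrow> g b < g a" "card V = d"
    by (rule cutsE) blast
  then obtain U where U: "U \<subseteq> B" "V = \<sigma> ` U" by (auto simp: subset_image_iff)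
  have sub: "inj_on \<sigma> U" using inj U(1) by (rule inj_on_subset)
  show "d \<in> cuts B f"
  proof (rule cutsI)
    show "U \<subseteq> B" by fact
    show "U \<noteq> {}" "U \<noteq> B" using V U by auto
    show "card U = d" using V(5) U(2) sub by (simp add: card_image)
    fix a b assume ab: "a \<in> U" "b \<in> B" "b \<notin> U"
    then have "\<sigma> b \<notin> \<sigma> ` U" using inj U(1) by (auto dest: inj_onD)
    then show "f b < f a" using V(4)[of "\<sigma> a" "\<sigma> b"] ab U o by auto
  qed
qed

lemma shuffle_image_class:
  assumes "finite I" "equiv I r" "\<sigma> permutes I" "\<forall>i\<in>I. (i, \<sigma> i) \<in> r"
  shows "\<sigma> ` (r `` {a}) = r `` {a}"
proof (rule endo_inj_surj)
  show "finite (r `` {a})" by (rule finite_subset[OF equiv_class_subset[OF assms(2)] assms(1)])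
  show "\<sigma> ` (r `` {a}) \<subseteq> r `` {a}"
    using equiv_class_subset[OF assms(2), of a] assms(4) equiv_trans[OF assms(2)] by blast
  show "inj_on \<sigma> (r `` {a})" using permutes_inj[OF assms(3)] by (simp add: inj_on_def)
qed

lemma cuts_shuffle:
  assumes "finite I" "equiv I r" "shuffle I r g f"
  shows "cuts (r `` {a}) g = cuts (r `` {a}) f"
proof -
  obtain \<sigma> where s: "\<sigma> permutes I" "\<forall>i\<in>I. (i, \<sigma> i) \<in> r" "\<forall>i\<in>I. g i = f (\<sigma> i)"
    using assms(3) unfolding shuffle_def by blast
  have sub: "r `` {a} \<subseteq> I" by (rule equiv_class_subset[OF assms(2)])
  have "cuts (\<sigma> ` (r `` {a})) f = cuts (r `` {a}) g"
    using permutes_inj[OF s(1)] s(3) sub by (intro cuts_image) (auto simp: inj_on_def subset_iff)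
  then show ?thesis by (simp only: shuffle_image_class[OF assms(1,2) s(1,2)])
qed

text \<open>No vertex maximises both \<open>1\<^bsub>S \<union> {i}\<^esub>\<close> and \<open>1\<^bsub>S \<union> {j}\<^esub>\<close>, whose sum is the first functional
  below; equivalently, the submodular inequality of the polytope is strict at \<open>(S, i, j)\<close>.\<close>

definition separates :: "'a set \<Rightarrow> 'a rel \<Rightarrow> ('a \<Rightarrow> real) \<Rightarrow> 'a \<Rightarrow> 'a \<Rightarrow> 'a set \<Rightarrow> bool" where
  "separates I r f i j S \<longleftrightarrow> i \<in> I \<and> j \<in> I \<and> i \<noteq> j \<and> i \<notin> S \<and> j \<notin> S \<and>
     \<not> dominates I r f (\<lambda>k. if k \<in> S then 2 else if k = i \<or> k = j then 1 else 0) (indicat_real (insert i S))"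

lemma indicator_not_le: "\<not> indicat_real A b \<le> indicat_real A a \<longleftrightarrow> b \<in> A \<and> a \<notin> A"
  by (cases "b \<in> A"; cases "a \<in> A") auto

text \<open>Sorting by the functional puts the largest values of the class of \<open>i\<close> on
  \<open>S\<close> and the next two on \<open>i\<close> and \<open>j\<close>, in either order.
  Putting the smaller of the two on \<open>i\<close> violates the indicator exactly when they
  differ, that is, when there is a cut just after the first of them.\<close>

lemma separates_iff:
  assumes I: "finite I" "equiv I r"
  shows "separates I r f i j S \<longleftrightarrow> (i, j) \<in> r \<and> i \<noteq> j \<and> i \<notin> S \<and> j \<notin> S \<and>
    Suc (card (S \<inter> r `` {i})) \<in> cuts (r `` {i}) f"
proof -
  define z :: "'a \<Rightarrow> real" where "z = (\<lambda>k. if k \<in> S then 2 else if k = i \<or> k = j then 1 else 0)"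
  define B where "B = r `` {i}"
  have BI: "B \<subseteq> I" unfolding B_def by (rule equiv_class_subset[OF I(2)])
  have fB: "finite B" using BI I(1) by (rule finite_subset)
  have fSB: "finite (S \<inter> B)" using fB by simp
  have BB: "(c, b) \<in> r" if "b \<in> B" "c \<in> B" for b c
    using that equiv_sym[OF I(2)] equiv_trans[OF I(2)] unfolding B_def by blast
  have sepz: "separates I r f i j S \<longleftrightarrow> i \<in> I \<and> j \<in> I \<and> i \<noteq> j \<and> i \<notin> S \<and> j \<notin> S \<and>
      (\<exists>v. shuffle I r v f \<and> sorted_by r v z \<and> \<not> sorted_by r v (indicat_real (insert i S)))"
    unfolding separates_def dominates_def z_def by blast
  show ?thesis
  proof
    assume "separates I r f i j S"
    then obtain v where m: "i \<in> I" "j \<in> I" "i \<noteq> j" "i \<notin> S" "j \<notin> S"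
      and v: "shuffle I r v f" "sorted_by r v z" "\<not> sorted_by r v (indicat_real (insert i S))"
      unfolding sepz by blast
    have zle: "v b \<le> v a" if "(b, a) \<in> r" "z b < z a" for a b
      using v(2) that unfolding sorted_by_def by fastforce
    obtain a b where ab: "(a, b) \<in> r" "v b < v a" "b \<in> insert i S" "a \<notin> insert i S"
    proof -
      from v(3) obtain a b where "(a, b) \<in> r" "v b < v a" "\<not> indicat_real (insert i S) b \<le> indicat_real (insert i S) a"
        unfolding sorted_by_def by auto
      then show ?thesis using that indicator_not_le by metis
    qed
    \<comment> \<open>Whenever the indicator is larger at one label than at another, so is
      \<open>z\<close>, except at the tied pair \<open>i\<close> and \<open>j\<close>. The violated
      pair must be that one.\<close>
    have "z b \<le> z a" using zle[OF equiv_sym[OF I(2) ab(1)]] zle[OF ab(1)] ab(2)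
      by (metis linorder_not_less)
    then have "b = i" "a = j" using ab(3,4) m by (auto simp: z_def split: if_splits)
    then have ji: "(j, i) \<in> r" "v i < v j" using ab by auto
    have iB: "i \<in> B" and jB: "j \<in> B"
      using equiv_refl[OF I(2) m(1)] equiv_sym[OF I(2) ji(1)] by (auto simp: B_def)
    have "Suc (card (S \<inter> B)) \<in> cuts B v"
    \<comment> \<open>The top values of \<open>v\<close> on the class are those on \<open>S\<close>,
      followed by the one at \<open>j\<close>; the strict drop from \<open>j\<close> to
      \<open>i\<close> is the cut.\<close>
    proof (rule cutsI[where U = "insert j (S \<inter> B)"])
      show "insert j (S \<inter> B) \<subseteq> B" "insert j (S \<inter> B) \<noteq> {}" using jB by auto
      show "insert j (S \<inter> B) \<noteq> B" using iB m by auto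
      show "card (insert j (S \<inter> B)) = Suc (card (S \<inter> B))" using m fSB by simp
      fix c d assume c: "c \<in> insert j (S \<inter> B)" and d: "d \<in> B" "d \<notin> insert j (S \<inter> B)"
      have "v d \<le> v i"
      proof (cases "d = i")
        case False
        then have "z d < z i" using d m by (auto simp: z_def)
        then show ?thesis using zle[OF BB[OF iB d(1)]] by simp
      qed simp
      moreover have "v j \<le> v c"
      proof (cases "c = j")
        case False
        then have "c \<in> S" "c \<in> B" "z j < z c" using c m by (auto simp: z_def)
        then show ?thesis using zle[OF BB[of c j]] jB by simp
      qed simp
      ultimately show "v d < v c" using ji(2) by linarith
    qed
    then show "(i, j) \<in> r \<and> i \<noteq> j \<and> i \<notin> S \<and> j \<notin> S \<and> Suc (card (S \<inter> r `` {i})) \<in> cuts (r `` {i}) f"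
      using cuts_shuffle[OF I v(1)] equiv_sym[OF I(2) ji(1)] m unfolding B_def by simp
  next
    assume as: "(i, j) \<in> r \<and> i \<noteq> j \<and> i \<notin> S \<and> j \<notin> S \<and> Suc (card (S \<inter> r `` {i})) \<in> cuts (r `` {i}) f"
    then have ij: "(i, j) \<in> r" "i \<noteq> j" "i \<notin> S" "j \<notin> S" by auto
    have m: "i \<in> I" "j \<in> I" using equiv_mem[OF I(2) ij(1)] by auto
    have iB: "i \<in> B" and jB: "j \<in> B" using equiv_refl[OF I(2) m(1)] ij(1) by (auto simp: B_def)
    obtain v where v: "shuffle I r v f" "sorted_by r v z" by (rule sorted_by_exists[OF I])
    have vz: "z b \<le> z a" if "a \<in> B" "b \<in> B" "v b < v a" for a b
      using v(2) that BB unfolding sorted_by_def by fastforce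
    have "Suc (card (S \<inter> B)) \<in> cuts B v"
      using as cuts_shuffle[OF I v(1)] unfolding B_def by simp
    then obtain U where U: "U \<subseteq> B" "U \<noteq> {}" "U \<noteq> B"
      "\<And>a b. a \<in> U \<Longrightarrow> b \<in> B \<Longrightarrow> b \<notin> U \<Longrightarrow> v b < v a" "card U = Suc (card (S \<inter> B))"
      by (rule cutsE) blast
    have SU: "S \<inter> B \<subseteq> U"
    proof (rule ccontr)
      assume "\<not> S \<inter> B \<subseteq> U"
      then obtain a where a: "a \<in> S" "a \<in> B" "a \<notin> U" by blast
      have "b \<in> S \<inter> B" if b: "b \<in> U" for b
        using vz[of b a] U(1) U(4)[OF b a(2,3)] a b by (auto simp: z_def split: if_splits)
      then have "card U \<le> card (S \<inter> B)" using fSB by (intro card_mono) auto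
      then show False using U(5) by simp
    qed
    have "card (U - S \<inter> B) = 1" using U(5) SU fSB by (simp add: card_Diff_subset)
    \<comment> \<open>The one element of the upper set \<open>U\<close> outside \<open>S\<close>.
      Being next in the order of \<open>z\<close>, it is \<open>i\<close> or \<open>j\<close>; in
      the first case a transposition, under which \<open>z\<close> is invariant, brings the larger
      value to \<open>j\<close>.\<close>
    then obtain c where c: "U - S \<inter> B = {c}" by (rule card_1_singletonE)
    then have cU: "c \<in> U" "c \<in> B" "c \<notin> S" using U(1) by auto
    have "c = i \<or> c = j"
    proof (cases "i \<in> U")
      case True then show ?thesis using c ij iB by auto
    next
      case False
      then have "z i \<le> z c" using vz[OF cU(2) iB] U(4)[OF cU(1) iB] by simp
      then show ?thesis using cU(3) ij by (auto simp: z_def split: if_splits)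
    qed
    then obtain w where w: "shuffle I r w f" "sorted_by r w z" "w i < w j"
    proof
      assume "c = j"
      then have "i \<notin> U" using c ij iB by auto
      then show ?thesis using that[OF v] U(4)[of j i] cU \<open>c = j\<close> iB by simp
    next
      assume "c = i"
      then have "j \<notin> U" using c ij jB by auto
      then have lt: "v j < v i" using U(4)[of i j] cU \<open>c = i\<close> jB by simp
      define t where "t = Transposition.transpose i j"
      have zt: "z (t k) = z k" for k using ij by (auto simp: z_def t_def Transposition.transpose_def)
      have tr: "(k, t k) \<in> r" if "k \<in> I" for k
        using ij equiv_sym[OF I(2) ij(1)] equiv_refl[OF I(2) that] by (auto simp: t_def Transposition.transpose_def)
      have "sorted_by r (v \<circ> t) z"
        unfolding sorted_by_def
      proof clarify
        fix a b assume ab: "(a, b) \<in> r" "(v \<circ> t) b < (v \<circ> t) a"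
        have "(t a, t b) \<in> r"
          using ab(1) equiv_mem[OF I(2) ab(1)] tr equiv_sym[OF I(2)] equiv_trans[OF I(2)] by meson
        then have "z (t b) \<le> z (t a)" using v(2) ab(2) unfolding sorted_by_def by auto
        then show "z b \<le> z a" by (simp add: zt)
      qed
      moreover have "shuffle I r (v \<circ> t) f"
        using shuffle_trans[OF I(2) shuffle_transpose[OF I(2) ij(1)] v(1)] by (simp add: t_def)
      moreover have "(v \<circ> t) i < (v \<circ> t) j" using lt by (simp add: t_def)
      ultimately show ?thesis using that by blast
    qed
    have "\<not> sorted_by r w (indicat_real (insert i S))"
      unfolding sorted_by_def using w(3) equiv_sym[OF I(2) ij(1)] ij by (auto simp: indicator_def)
    then show "separates I r f i j S" unfolding sepz using m ij w by blast
  qed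
qed

text \<open>A cut \<open>d\<close> of the class leaves room for a set \<open>S\<close> of
  \<open>d - 1\<close> elements avoiding \<open>i\<close> and \<open>j\<close>, so every other
  \<open>j\<close> in the class is separated from \<open>i\<close> by some \<open>S\<close>. A class
  without cuts separates nothing and cannot be recognised this way.\<close>

lemma class_eq_separates:
  assumes I: "finite I" "equiv I r" and i: "i \<in> I" and ne: "cuts (r `` {i}) f \<noteq> {}"
  shows "r `` {i} = insert i {j. \<exists>S. separates I r f i j S}"
proof (intro equalityI subsetI)
  fix j assume j: "j \<in> r `` {i}"
  let ?B = "r `` {i}"
  have fB: "finite ?B" by (rule finite_subset[OF equiv_class_subset[OF I(2)] I(1)])
  obtain d where d: "d \<in> cuts ?B f" using ne by blast
  show "j \<in> insert i {j. \<exists>S. separates I r f i j S}"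
  proof (cases "j = i")
    case False
    have "i \<in> ?B" using equiv_refl[OF I(2) i] by simp
    then have "card (?B - {i, j}) = card ?B - 2" using j False fB by (simp add: card_Diff_subset)
    then have "d - 1 \<le> card (?B - {i, j})" using cuts_bounds[OF fB d] by simp
    then obtain S where S: "S \<subseteq> ?B - {i, j}" "card S = d - 1" by (meson obtain_subset_with_card_n)
    then have "S \<inter> ?B = S" by blast
    then have "Suc (card (S \<inter> ?B)) = d" using S(2) cuts_bounds[OF fB d] by simp
    then have "separates I r f i j S" unfolding separates_iff[OF I] using S(1) d j False by auto
    then show ?thesis by blast
  qed simp
qed (use equiv_refl[OF I(2) i] in \<open>auto simp: separates_iff[OF I]\<close>)

text \<open>The witness \<open>S\<close> is taken inside the class, so that its cardinality and that
  of its part in the class agree.\<close>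

lemma cuts_eq_separates:
  assumes I: "finite I" "equiv I r" and i: "i \<in> I"
  shows "cuts (r `` {i}) f = {Suc (card S) |S j. S \<subseteq> r `` {i} \<and> separates I r f i j S}"
proof (intro equalityI subsetI)
  let ?B = "r `` {i}"
  have fB: "finite ?B" by (rule finite_subset[OF equiv_class_subset[OF I(2)] I(1)])
  fix d assume d: "d \<in> cuts ?B f"
  have iB: "i \<in> ?B" using equiv_refl[OF I(2) i] by simp
  have "card ?B > 1" using cuts_bounds[OF fB d] by simp
  then have "?B \<noteq> {i}" by auto
  then obtain j where j: "j \<in> ?B" "j \<noteq> i" using iB by blast
  then have "card (?B - {i, j}) = card ?B - 2" using iB fB by (simp add: card_Diff_subset)
  then have "d - 1 \<le> card (?B - {i, j})" using cuts_bounds[OF fB d] by simp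
  then obtain S where S: "S \<subseteq> ?B - {i, j}" "card S = d - 1" by (meson obtain_subset_with_card_n)
  then have "S \<inter> ?B = S" by blast
  then have e: "Suc (card (S \<inter> ?B)) = d" "Suc (card S) = d" using S(2) cuts_bounds[OF fB d] by simp_all
  then have "separates I r f i j S" unfolding separates_iff[OF I] using S(1) d j by auto
  then show "d \<in> {Suc (card S) |S j. S \<subseteq> ?B \<and> separates I r f i j S}" using e(2) S(1) by blast
next
  fix d assume "d \<in> {Suc (card S) |S j. S \<subseteq> r `` {i} \<and> separates I r f i j S}"
  then obtain S j where S: "d = Suc (card S)" "S \<subseteq> r `` {i}" "separates I r f i j S" by blast
  then have "S \<inter> r `` {i} = S" by blast
  then show "d \<in> cuts (r `` {i}) f" using S(1,3) unfolding separates_iff[OF I] by metis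
qed

text \<open>\<open>separates\<close> depends on the relation and the arrangement only through
  \<open>dominates\<close>. The classes themselves are recovered only where there are cuts: an
  arrangement that is constant on every class gives a single point, whatever the relation.\<close>

lemma cuts_eq_of_dominates:
  assumes I: "finite I" and r: "equiv I r" and s: "equiv I s" and i: "i \<in> I"
    and eq: "\<And>y y'. dominates I r f y y' \<longleftrightarrow> dominates I s g y y'"
  shows "cuts (r `` {i}) f = cuts (s `` {i}) g"
    and "cuts (r `` {i}) f \<noteq> {} \<Longrightarrow> r `` {i} = s `` {i}"
proof -
  have sep: "separates I r f = separates I s g" unfolding separates_def eq by (rule refl)
  have ne: "cuts (r' `` {i}) f' \<noteq> {} \<longleftrightarrow> (\<exists>j S. separates I r' f' i j S)" if "equiv I r'" for r' f'
  proof
    assume "cuts (r' `` {i}) f' \<noteq> {}"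
    then show "\<exists>j S. separates I r' f' i j S" unfolding cuts_eq_separates[OF I that i] by blast
  qed (auto simp: separates_iff[OF I that])
  have cls: "r `` {i} = s `` {i}" if "cuts (r `` {i}) f \<noteq> {}"
  proof -
    have "cuts (s `` {i}) g \<noteq> {}" using that ne[OF r] ne[OF s] sep by simp
    then show ?thesis
      using class_eq_separates[OF I r i that] class_eq_separates[OF I s i] sep by simp
  qed
  show "cuts (r `` {i}) f \<noteq> {} \<Longrightarrow> r `` {i} = s `` {i}" by (rule cls)
  show "cuts (r `` {i}) f = cuts (s `` {i}) g"
  proof (cases "cuts (r `` {i}) f = {}")
    case True
    then have "cuts (s `` {i}) g = {}" using ne[OF r, of f] ne[OF s, of g] sep by simp
    then show ?thesis using True by simp
  next
    case False
    then show ?thesis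
      using cuts_eq_separates[OF I r i, of f] cuts_eq_separates[OF I s i, of g] sep cls[OF False] by simp
  qed
qed

text \<open>\<open>F n D\<close> stands for the value of a character at the orbit polytope on
  \<open>n\<close> labels whose composition has the proper partial sums \<open>D\<close>.
  Multiplicativity of characters dictates the product over blocks.\<close>

definition block_prod :: "(nat \<Rightarrow> nat set \<Rightarrow> 'k) \<Rightarrow> 'a set \<Rightarrow> 'a rel \<Rightarrow> ('a \<Rightarrow> real) \<Rightarrow> 'k::comm_monoid_mult" where
  "block_prod F I r f = (\<Prod>B\<in>I // r. F (card B) (cuts B f))"

text \<open>Blocks on which \<open>f\<close> is constant are not determined by the normal fan; their joint contribution
  depends only on the number of elements that they contain.\<close>

lemma block_prod_split:
  assumes I: "finite I" "equiv I r" and F: "\<And>n. F n {} = x ^ n"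
  shows "block_prod F I r f = x ^ card {i \<in> I. cuts (r `` {i}) f = {}} *
    (\<Prod>B\<in>{r `` {i} |i. i \<in> I \<and> cuts (r `` {i}) f \<noteq> {}}. F (card B) (cuts B f))"
proof -
  let ?T = "{B \<in> I // r. cuts B f = {}}" and ?N = "{B \<in> I // r. cuts B f \<noteq> {}}"
  have fin: "finite (I // r)" using equiv_mem[OF I(2)] by (intro finite_quotient[OF I(1)]) auto
  have "block_prod F I r f = prod (\<lambda>B. F (card B) (cuts B f)) (?T \<union> ?N)"
    unfolding block_prod_def by (rule prod.cong) auto
  also have "\<dots> = prod (\<lambda>B. F (card B) (cuts B f)) ?T * prod (\<lambda>B. F (card B) (cuts B f)) ?N"
    using fin by (intro prod.union_disjoint) auto
  also have "prod (\<lambda>B. F (card B) (cuts B f)) ?T = (\<Prod>B\<in>?T. x ^ card B)"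
    by (intro prod.cong) (auto simp: F)
  also have "\<dots> = x ^ (\<Sum>B\<in>?T. card B)" by (simp add: power_sum)
  also have "(\<Sum>B\<in>?T. card B) = card (\<Union>?T)"
  proof (rule card_Union_disjoint[symmetric])
    show "pairwise disjnt ?T"
      using quotient_disj[OF I(2)] by (auto simp: pairwise_def disjnt_def)
    show "finite B" if "B \<in> ?T" for B
      using that I by (auto intro: finite_equiv_class simp: equiv_def)
  qed
  also have "\<Union>?T = {i \<in> I. cuts (r `` {i}) f = {}}"
  proof (intro equalityI subsetI)
    fix i assume "i \<in> \<Union>?T"
    then obtain a where a: "a \<in> I" "i \<in> r `` {a}" "cuts (r `` {a}) f = {}" by (auto simp: quotient_def)
    then have "r `` {i} = r `` {a}" "i \<in> I"
      using equiv_class_eq[OF I(2), of a i] equiv_mem[OF I(2), of a i] by auto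
    then show "i \<in> {i \<in> I. cuts (r `` {i}) f = {}}" using a(3) by simp
  next
    fix i assume "i \<in> {i \<in> I. cuts (r `` {i}) f = {}}"
    then show "i \<in> \<Union>?T" using equiv_refl[OF I(2)] by (auto simp: quotient_def)
  qed
  also have "?N = {r `` {i} |i. i \<in> I \<and> cuts (r `` {i}) f \<noteq> {}}" by (auto simp: quotient_def)
  finally show ?thesis .
qed

text \<open>Nontrivial blocks and their cuts are read off \<open>dominates\<close>; trivial ones
  enter only through the number of labels that they cover in total. For \<open>weight\<close>, the
  hypothesis on \<open>F\<close> is the relation defining the group of series.\<close>

lemma block_prod_dominates_cong:
  assumes I: "finite I" and r: "equiv I r" and s: "equiv I s"
    and eq: "\<And>y y'. dominates I r f y y' \<longleftrightarrow> dominates I s g y y'" and F: "\<And>n. F n {} = x ^ n"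
  shows "block_prod F I r f = block_prod F I s g"
proof -
  note c = cuts_eq_of_dominates[OF I r s _ eq]
  have 1: "{i \<in> I. cuts (r `` {i}) f = {}} = {i \<in> I. cuts (s `` {i}) g = {}}" using c(1) by auto
  have "r `` {i} = s `` {i}" if "i \<in> I" "cuts (s `` {i}) g \<noteq> {}" for i using c that by metis
  then have 2: "{r `` {i} |i. i \<in> I \<and> cuts (r `` {i}) f \<noteq> {}} = {s `` {i} |i. i \<in> I \<and> cuts (s `` {i}) g \<noteq> {}}"
    using c(1) by (metis (no_types, lifting))
  have 3: "cuts B f = cuts B g" if B: "B \<in> {r `` {i} |i. i \<in> I \<and> cuts (r `` {i}) f \<noteq> {}}" for B
  proof -
    obtain i where i: "i \<in> I" "B = r `` {i}" "cuts (r `` {i}) f \<noteq> {}" using B by blast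
    then show ?thesis using c(1)[OF i(1)] c(2)[OF i(1,3)] by simp
  qed
  show ?thesis
    unfolding block_prod_split[where x = x and F = F, OF I r F] block_prod_split[where x = x and F = F, OF I s F] 1 2[symmetric]
    by (intro arg_cong2[where f = times] prod.cong refl) (simp only: 3)
qed

section \<open>Products over blocks and splitting of cuts\<close>

lemma block_prod_Un:
  assumes fin: "finite S" "finite T" and eq: "equiv S r" "equiv T s" and dis: "S \<inter> T = {}"
  shows "block_prod F (S \<union> T) (r \<union> s) f = block_prod F S r f * block_prod F T s f"
proof -
  have "(S \<union> T) // (r \<union> s) = S // r \<union> T // s"
    unfolding quotient_def using class_Un[OF eq dis] by auto
  moreover have "finite (S // r)" "finite (T // s)"
    using equiv_mem[OF eq(1)] equiv_mem[OF eq(2)]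
    by (intro finite_quotient[OF fin(1)] finite_quotient[OF fin(2)]; auto)+
  moreover have "S // r \<inter> T // s = {}"
  proof (rule ccontr)
    assume "S // r \<inter> T // s \<noteq> {}"
    then obtain B where B: "B \<in> S // r" "B \<in> T // s" by blast
    then have "B \<subseteq> S" "B \<subseteq> T" "B \<noteq> {}"
      using in_quotient_imp_subset[OF eq(1)] in_quotient_imp_subset[OF eq(2)] in_quotient_imp_non_empty[OF eq(1)] by auto
    then show False using dis by blast
  qed
  ultimately show ?thesis unfolding block_prod_def by (simp add: prod.union_disjoint)
qed

lemma block_prod_relabel:
  assumes I: "finite I" "equiv I r" and b: "bij_betw \<sigma> I J" and t: "\<forall>i\<in>I. \<tau> (\<sigma> i) = i"
  shows "block_prod F J (map_prod \<sigma> \<sigma> ` r) (f \<circ> \<tau>) = block_prod F I r f"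
proof -
  have J: "J = \<sigma> ` I" and inj: "inj_on \<sigma> I" using b by (auto simp: bij_betw_def)
  have sub: "B \<subseteq> I" if "B \<in> I // r" for B using that in_quotient_imp_subset[OF I(2)] by blast
  have q: "J // (map_prod \<sigma> \<sigma> ` r) = (image \<sigma>) ` (I // r)"
    unfolding quotient_def J by (auto simp: class_map_prod[OF I(2) b] image_iff)
  have "inj_on (image \<sigma>) (I // r)"
    using sub inj by (intro inj_onI) (metis inj_on_image_eq_iff)
  then have "block_prod F J (map_prod \<sigma> \<sigma> ` r) (f \<circ> \<tau>) =
      (\<Prod>B\<in>I // r. F (card (\<sigma> ` B)) (cuts (\<sigma> ` B) (f \<circ> \<tau>)))"
    unfolding block_prod_def q by (simp add: prod.reindex)
  also have "\<dots> = block_prod F I r f"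
    unfolding block_prod_def
  proof (rule prod.cong[OF refl])
    fix B assume "B \<in> I // r"
    then have B: "B \<subseteq> I" by (rule sub)
    then have iB: "inj_on \<sigma> B" using inj by (rule inj_on_subset[rotated])
    have "cuts (\<sigma> ` B) (f \<circ> \<tau>) = cuts B f"
      using t B by (intro cuts_image[OF iB]) (auto simp: subset_iff)
    then show "F (card (\<sigma> ` B)) (cuts (\<sigma> ` B) (f \<circ> \<tau>)) = F (card B) (cuts B f)"
      using iB by (simp add: card_image)
  qed
  finally show ?thesis .
qed

lemma block_prod_full:
  assumes "F 0 {} = 1" shows "block_prod F I (I \<times> I) f = F (card I) (cuts I f)"
proof (cases "I = {}")
  case True
  have "cuts {} f = {}" unfolding cuts_def by auto
  then show ?thesis using True assms by (simp add: block_prod_def)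
next
  case False
  then have "I // (I \<times> I) = {I}" by (auto simp: quotient_def)
  then show ?thesis by (simp add: block_prod_def)
qed

text \<open>For the partial sums \<open>D\<close> of a composition, \<open>low_cuts\<close> and
  \<open>high_cuts\<close> give those of the two pieces obtained by cutting it after
  \<open>k\<close> boxes. Both bounds are strict: a cut at \<open>k\<close> itself is forgotten, and
  so a concatenation and the near-concatenation have the same pieces.\<close>

definition low_cuts :: "nat \<Rightarrow> nat set \<Rightarrow> nat set" where "low_cuts k D = {d \<in> D. d < k}"

definition high_cuts :: "nat \<Rightarrow> nat set \<Rightarrow> nat set" where "high_cuts k D = {d. 0 < d \<and> d + k \<in> D}"

text \<open>Ties between \<open>S\<close> and its complement are allowed, so \<open>B\<close> may or
  may not have a cut at \<open>card (B \<inter> S)\<close>. All smaller upper sets of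
  \<open>B\<close> lie inside \<open>S\<close>.\<close>

lemma cuts_upper_part:
  assumes B: "finite B" and le: "\<And>a b. a \<in> B \<inter> S \<Longrightarrow> b \<in> B - S \<Longrightarrow> f b \<le> f a"
  shows "cuts (B \<inter> S) f = low_cuts (card (B \<inter> S)) (cuts B f)"
proof (intro equalityI subsetI)
  fix d assume d: "d \<in> cuts (B \<inter> S) f"
  then obtain U where U: "U \<subseteq> B \<inter> S" "U \<noteq> {}" "U \<noteq> B \<inter> S"
    "\<And>a b. a \<in> U \<Longrightarrow> b \<in> B \<inter> S \<Longrightarrow> b \<notin> U \<Longrightarrow> f b < f a" "card U = d" by (rule cutsE) blast
  obtain c where c: "c \<in> B \<inter> S" "c \<notin> U" using U(1,3) by blast
  have "d \<in> cuts B f"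
  proof (rule cutsI[OF _ U(2) _ _ U(5)])
    show "U \<subseteq> B" "U \<noteq> B" using U(1,3) by auto
    fix a b assume ab: "a \<in> U" "b \<in> B" "b \<notin> U"
    show "f b < f a"
    proof (cases "b \<in> S")
      case True then show ?thesis using U(4) ab by blast
    next
      case False
      then have "f b \<le> f c" using le c(1) ab by blast
      then show ?thesis using U(4)[OF ab(1) c] by simp
    qed
  qed
  then show "d \<in> low_cuts (card (B \<inter> S)) (cuts B f)"
    using cuts_bounds(2)[OF _ d] B by (simp add: low_cuts_def)
next
  fix d assume "d \<in> low_cuts (card (B \<inter> S)) (cuts B f)"
  then have d: "d \<in> cuts B f" "d < card (B \<inter> S)" by (auto simp: low_cuts_def)
  obtain U where U: "U \<subseteq> B" "U \<noteq> {}" "U \<noteq> B"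
    "\<And>a b. a \<in> U \<Longrightarrow> b \<in> B \<Longrightarrow> b \<notin> U \<Longrightarrow> f b < f a" "card U = d" using d(1) by (rule cutsE) blast
  have "U \<subseteq> S"
  proof
    fix a assume a: "a \<in> U"
    show "a \<in> S"
    proof (rule ccontr)
      assume "a \<notin> S"
      have "B \<inter> S \<subseteq> U"
        using U(1) U(4)[OF a] le[of _ a] a \<open>a \<notin> S\<close> by fastforce
      then have "card (B \<inter> S) \<le> card U" using U(1) B by (intro card_mono) (auto intro: finite_subset)
      then show False using d(2) U(5) by simp
    qed
  qed
  then show "d \<in> cuts (B \<inter> S) f" using U d(2) by (intro cutsI[of U]) auto
qed

lemma cuts_lower_part:
  assumes B: "finite B" and le: "\<And>a b. a \<in> B \<inter> S \<Longrightarrow> b \<in> B - S \<Longrightarrow> f b \<le> f a"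
  shows "cuts (B - S) f = high_cuts (card (B \<inter> S)) (cuts B f)"
proof (intro equalityI subsetI)
  fix d assume d: "d \<in> cuts (B - S) f"
  then obtain U where U: "U \<subseteq> B - S" "U \<noteq> {}" "U \<noteq> B - S"
    "\<And>a b. a \<in> U \<Longrightarrow> b \<in> B - S \<Longrightarrow> b \<notin> U \<Longrightarrow> f b < f a" "card U = d" by (rule cutsE) blast
  obtain c where c: "c \<in> U" using U(2) by blast
  have "d + card (B \<inter> S) \<in> cuts B f"
  proof (rule cutsI[where U = "U \<union> (B \<inter> S)"])
    show "U \<union> (B \<inter> S) \<subseteq> B" "U \<union> (B \<inter> S) \<noteq> {}" "U \<union> (B \<inter> S) \<noteq> B" using U(1-3) by auto
    have "card (U \<union> (B \<inter> S)) = card U + card (B \<inter> S)"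
      using U(1) B by (intro card_Un_disjoint) (auto intro: finite_subset)
    then show "card (U \<union> (B \<inter> S)) = d + card (B \<inter> S)" using U(5) by simp
    fix a b assume ab: "a \<in> U \<union> (B \<inter> S)" "b \<in> B" "b \<notin> U \<union> (B \<inter> S)"
    show "f b < f a"
    proof (cases "a \<in> U")
      case True then show ?thesis using U(4) ab by blast
    next
      case False
      then have "f c \<le> f a" using le ab c U(1) by blast
      then show ?thesis using U(4)[OF c, of b] ab by auto
    qed
  qed
  then show "d \<in> high_cuts (card (B \<inter> S)) (cuts B f)"
    using cuts_bounds(1)[OF _ d] B by (simp add: high_cuts_def)
next
  fix d assume "d \<in> high_cuts (card (B \<inter> S)) (cuts B f)"
  then have d: "d + card (B \<inter> S) \<in> cuts B f" "0 < d" by (auto simp: high_cuts_def)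
  obtain U where U: "U \<subseteq> B" "U \<noteq> {}" "U \<noteq> B"
    "\<And>a b. a \<in> U \<Longrightarrow> b \<in> B \<Longrightarrow> b \<notin> U \<Longrightarrow> f b < f a" "card U = d + card (B \<inter> S)"
    using d(1) by (rule cutsE) blast
  have SU: "B \<inter> S \<subseteq> U"
  proof
    fix c assume c: "c \<in> B \<inter> S"
    show "c \<in> U"
    proof (rule ccontr)
      assume "c \<notin> U"
      then have "U \<subseteq> B \<inter> S" using U(1,4) le[OF c] c by fastforce
      then have "card U \<le> card (B \<inter> S)" using B by (intro card_mono) auto
      then show False using d(2) U(5) by simp
    qed
  qed
  have c: "card (U - S) = d"
  proof -
    have "U - S = U - B \<inter> S" using U(1) by auto
    then show ?thesis using U(5) SU B by (simp add: card_Diff_subset)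
  qed
  show "d \<in> cuts (B - S) f"
  proof (rule cutsI[where U = "U - S"])
    show "U - S \<noteq> {}" using c d(2) by (metis card.empty less_irrefl)
    show "U - S \<noteq> B - S" using U(1,3) SU by auto
  qed (use U SU c in auto)
qed

lemma quotient_restrict:
  assumes "equiv I r" "S \<subseteq> I"
  shows "S // (Restr r S) = (\<lambda>B. B \<inter> S) ` {B \<in> I // r. B \<inter> S \<noteq> {}}"
proof -
  have cl: "(Restr r S) `` {a} = r `` {a} \<inter> S" if "a \<in> S" for a using that by auto
  show ?thesis
  proof (intro equalityI subsetI)
    fix C assume "C \<in> S // (Restr r S)"
    then obtain a where a: "a \<in> S" "C = r `` {a} \<inter> S" unfolding quotient_def using cl by auto
    then have "a \<in> r `` {a} \<inter> S" using equiv_refl[OF assms(1)] assms(2) by auto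
    then show "C \<in> (\<lambda>B. B \<inter> S) ` {B \<in> I // r. B \<inter> S \<noteq> {}}"
      using a assms(2) by (intro image_eqI[of _ _ "r `` {a}"]) (auto intro: quotientI)
  next
    fix C assume "C \<in> (\<lambda>B. B \<inter> S) ` {B \<in> I // r. B \<inter> S \<noteq> {}}"
    then obtain B a where B: "B \<in> I // r" "C = B \<inter> S" "a \<in> B" "a \<in> S" by blast
    then have "B = r `` {a}" using assms(1) by (metis Image_singleton_iff equiv_class_eq_iff quotientE)
    then show "C \<in> S // (Restr r S)" using B cl[OF B(4)] by (auto simp: quotient_def)
  qed
qed

text \<open>Blocks that miss \<open>S\<close> contribute \<open>F 0 {} = 1\<close>. Indexing by the
  blocks of \<open>I\<close> lets the two factors of a coproduct be multiplied block by
  block.\<close>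

lemma block_prod_restrict:
  assumes I: "finite I" "equiv I r" and S: "S \<subseteq> I" and F: "F 0 {} = 1"
  shows "block_prod F S (Restr r S) f = (\<Prod>B\<in>I // r. F (card (B \<inter> S)) (cuts (B \<inter> S) f))"
proof -
  have fin: "finite (I // r)" using equiv_mem[OF I(2)] by (intro finite_quotient[OF I(1)]) auto
  have inj: "inj_on (\<lambda>B. B \<inter> S) {B \<in> I // r. B \<inter> S \<noteq> {}}"
  proof (rule inj_onI)
    fix B C assume "B \<in> {B \<in> I // r. B \<inter> S \<noteq> {}}" "C \<in> {B \<in> I // r. B \<inter> S \<noteq> {}}" "B \<inter> S = C \<inter> S"
    then show "B = C" using quotient_disj[OF I(2), of B C] by blast
  qed
  have c0: "cuts {} f = {}" unfolding cuts_def by auto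
  have "block_prod F S (Restr r S) f = (\<Prod>B\<in>{B \<in> I // r. B \<inter> S \<noteq> {}}. F (card (B \<inter> S)) (cuts (B \<inter> S) f))"
    unfolding block_prod_def quotient_restrict[OF I(2) S] by (simp add: prod.reindex[OF inj])
  also have "\<dots> = (\<Prod>B\<in>I // r. F (card (B \<inter> S)) (cuts (B \<inter> S) f))"
    using fin by (intro prod.mono_neutral_left) (auto simp: F c0)
  finally show ?thesis .
qed

text \<open>A subset of a disjoint union is a free choice of a subset of each member; this is the
  distributive law.\<close>

lemma sum_Pow_Union:
  fixes f :: "'a set \<Rightarrow> 'a set \<Rightarrow> 'k::comm_semiring_1"
  assumes "finite P" "\<And>B. B \<in> P \<Longrightarrow> finite B" "\<And>B C. B \<in> P \<Longrightarrow> C \<in> P \<Longrightarrow> B \<noteq> C \<Longrightarrow> B \<inter> C = {}"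
  shows "(\<Sum>S\<in>Pow (\<Union>P). \<Prod>B\<in>P. f B (B \<inter> S)) = (\<Prod>B\<in>P. \<Sum>U\<in>Pow B. f B U)"
  using assms
proof (induction P rule: finite_induct)
  case (insert A P)
  let ?Q = "\<Union>P"
  have dis: "A \<inter> ?Q = {}" using insert.prems(2) insert.hyps(2) by blast
  have "(\<Sum>S\<in>Pow (\<Union>(insert A P)). \<Prod>B\<in>insert A P. f B (B \<inter> S)) =
      (\<Sum>(U, S)\<in>Pow A \<times> Pow ?Q. f A U * (\<Prod>B\<in>P. f B (B \<inter> S)))"
  proof (rule sum.reindex_bij_witness[of _ "\<lambda>(U, S). U \<union> S" "\<lambda>S. (S \<inter> A, S \<inter> ?Q)"])
    fix S assume S: "S \<in> Pow (\<Union>(insert A P))"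
    have "B \<inter> (S \<inter> ?Q) = B \<inter> S" if "B \<in> P" for B using that by blast
    then show "(case (S \<inter> A, S \<inter> ?Q) of (U, S) \<Rightarrow> f A U * (\<Prod>B\<in>P. f B (B \<inter> S))) =
        (\<Prod>B\<in>insert A P. f B (B \<inter> S))"
      using insert.hyps by (simp add: Int_commute)
  qed (use dis in auto)
  also have "\<dots> = (\<Sum>U\<in>Pow A. f A U) * (\<Sum>S\<in>Pow ?Q. \<Prod>B\<in>P. f B (B \<inter> S))"
    by (simp add: sum_product sum.cartesian_product)
  also have "\<dots> = (\<Prod>B\<in>insert A P. \<Sum>U\<in>Pow B. f B U)"
    using insert by simp
  finally show ?case .
qed simp

lemma sum_Pow_card:
  fixes h :: "nat \<Rightarrow> 'k::comm_semiring_1"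
  assumes "finite B"
  shows "(\<Sum>U\<in>Pow B. h (card U)) = (\<Sum>k\<le>card B. of_nat (card B choose k) * h k)"
proof -
  have "(\<Sum>U\<in>Pow B. h (card U)) = (\<Sum>k\<le>card B. \<Sum>U\<in>{U \<in> Pow B. card U = k}. h (card U))"
    using assms by (intro sum.group[symmetric]) (auto intro: card_mono)
  also have "\<dots> = (\<Sum>k\<le>card B. of_nat (card B choose k) * h k)"
    using n_subsets[OF assms] by (intro sum.cong) auto
  finally show ?thesis .
qed

section \<open>Sorted enumerations and order types\<close>

lemma sorted_enumeration_exists:
  fixes f :: "'a \<Rightarrow> real"
  assumes "finite I"
  obtains e where "bij_betw e {..<card I} I" "\<And>k l. k \<le> l \<Longrightarrow> l < card I \<Longrightarrow> f (e l) \<le> f (e k)"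
proof -
  obtain xs0 where xs0: "set xs0 = I" "distinct xs0" using finite_distinct_list[OF assms] by blast
  define xs where "xs = sort_key (\<lambda>i. - f i) xs0"
  have xs: "set xs = I" "distinct xs" "length xs = card I"
    using xs0 distinct_card[of xs0] by (auto simp: xs_def)
  have "sorted (map (\<lambda>i. - f i) xs)" by (simp add: xs_def)
  then have d: "f (xs ! l) \<le> f (xs ! k)" if "k \<le> l" "l < card I" for k l
    using sorted_nth_mono[of "map (\<lambda>i. - f i) xs" k l] that xs(3) by simp
  have "bij_betw ((!) xs) {..<card I} I" by (rule bij_betw_nth[OF xs(2)]) (simp_all add: xs)
  then show ?thesis using d by (rule that)
qed

lemma down_set_lessThan:
  assumes "V \<subseteq> {..<n}" "\<And>k l. k \<in> V \<Longrightarrow> l < n \<Longrightarrow> l \<notin> V \<Longrightarrow> k < l"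
  shows "V = {..<card V}"
proof -
  have fV: "finite V" using assms(1) by (rule finite_subset) simp
  have "{..<card V} \<subseteq> V"
  proof (rule ccontr)
    assume "\<not> {..<card V} \<subseteq> V"
    then obtain x where x: "x < card V" "x \<notin> V" by auto
    have "card V \<le> n" using card_mono[OF _ assms(1)] by simp
    then have "V \<subseteq> {..<x}" using assms(2) x by fastforce
    then have "card V \<le> x" using card_mono[of "{..<x}" V] by simp
    then show False using x(1) by simp
  qed
  then show ?thesis using fV by (intro card_subset_eq[symmetric]) auto
qed

text \<open>In a decreasing enumeration every upper set is an initial segment. The one of size
  \<open>d\<close> ends at index \<open>d - 1\<close> because indices start at zero.\<close>

lemma cuts_enumeration:
  assumes e: "bij_betw e {..<n} I" and d: "\<And>k l. k \<le> l \<Longrightarrow> l < n \<Longrightarrow> f (e l) \<le> f (e k)"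
  shows "cuts I f = {d. 0 < d \<and> d < n \<and> f (e d) < f (e (d - 1))}"
proof -
  have I: "I = e ` {..<n}" and inj: "inj_on e {..<n}" using e by (auto simp: bij_betw_def)
  have "cuts I f = cuts {..<n} (f \<circ> e)" unfolding I by (intro cuts_image[OF inj]) simp
  also have "\<dots> = {d. 0 < d \<and> d < n \<and> f (e d) < f (e (d - 1))}"
  proof (intro equalityI subsetI)
    fix c assume "c \<in> cuts {..<n} (f \<circ> e)"
    then obtain V where V: "V \<subseteq> {..<n}" "V \<noteq> {}" "V \<noteq> {..<n}"
      "\<And>a b. a \<in> V \<Longrightarrow> b \<in> {..<n} \<Longrightarrow> b \<notin> V \<Longrightarrow> (f \<circ> e) b < (f \<circ> e) a" "card V = c"
      by (rule cutsE) blast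
    have "k < l" if "k \<in> V" "l < n" "l \<notin> V" for k l
    proof (rule ccontr)
      assume "\<not> k < l"
      then have "f (e k) \<le> f (e l)" using d[of l k] V(1) that(1) by auto
      then show False using V(4)[of k l] that by auto
    qed
    then have Ve: "V = {..<c}" using down_set_lessThan[OF V(1)] V(5) by simp
    then have c: "0 < c" "c < n" using V(1-3) by (auto simp: lessThan_subset_iff le_less)
    then show "c \<in> {d. 0 < d \<and> d < n \<and> f (e d) < f (e (d - 1))}" using V(4)[of "c - 1" c] Ve by auto
  next
    fix c assume "c \<in> {d. 0 < d \<and> d < n \<and> f (e d) < f (e (d - 1))}"
    then have c: "0 < c" "c < n" "f (e c) < f (e (c - 1))" by auto
    show "c \<in> cuts {..<n} (f \<circ> e)"
    proof (rule cutsI[where U = "{..<c}"])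
      show "{..<c} \<subseteq> {..<n}" "{..<c} \<noteq> {}" "{..<c} \<noteq> {..<n}" "card {..<c} = c" using c by auto
      fix a b assume "a \<in> {..<c}" "b \<in> {..<n}" "b \<notin> {..<c}"
      moreover from this have "a \<le> c - 1" "c - 1 < n" by auto
      ultimately show "(f \<circ> e) b < (f \<circ> e) a" using d[of c b] d[of a "c - 1"] c by auto
    qed
  qed
  finally show ?thesis .
qed

lemma enumeration_less_iff:
  assumes e: "bij_betw e {..<n} I" and d: "\<And>k l. k \<le> l \<Longrightarrow> l < n \<Longrightarrow> f (e l) \<le> f (e k)"
    and kl: "k < n" "l < n"
  shows "f (e l) < f (e k) \<longleftrightarrow> (\<exists>c\<in>cuts I f. k < c \<and> c \<le> l)"
proof -
  have cu: "cuts I f = {d. 0 < d \<and> d < n \<and> f (e d) < f (e (d - 1))}"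
    by (rule cuts_enumeration[OF e]) (rule d)
  show ?thesis
  proof
    assume lt: "f (e l) < f (e k)"
    show "\<exists>c\<in>cuts I f. k < c \<and> c \<le> l"
    proof (rule ccontr)
      assume no: "\<not> ?thesis"
      have "f (e k) \<le> f (e m)" if "k \<le> m" "m \<le> l" for m
        using that
      proof (induction m rule: dec_induct)
        case (step m)
        have "\<not> f (e (Suc m)) < f (e m)"
        proof
          assume "f (e (Suc m)) < f (e m)"
          then have "Suc m \<in> cuts I f" unfolding cu using step kl by simp
          moreover have "k < Suc m" using step by simp
          ultimately show False using no step by blast
        qed
        then show ?case using step by simp
      qed simp
      moreover have "k \<le> l" using d[of l k] lt kl by (cases "k \<le> l") auto
      ultimately show False using lt by force
    qed
  next
    assume "\<exists>c\<in>cuts I f. k < c \<and> c \<le> l"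
    then obtain c where "0 < c" "c < n" "f (e c) < f (e (c - 1))" "k < c" "c \<le> l"
      unfolding cu by auto
    moreover from this have "k \<le> c - 1" "c - 1 < n" by auto
    ultimately show "f (e l) < f (e k)" using d[of c l] d[of k "c - 1"] kl by auto
  qed
qed

text \<open>Two decreasing enumerations are matched index by index. Strict comparisons are
  determined by the cuts lying between two indices, so the matching preserves and reflects the
  order.\<close>

lemma order_iso_of_cuts_eq:
  assumes fin: "finite I" "finite J" and c: "card I = card J" and cu: "cuts I f = cuts J g"
  obtains \<sigma> where "bij_betw \<sigma> I J" "\<And>i j. i \<in> I \<Longrightarrow> j \<in> I \<Longrightarrow> f i < f j \<longleftrightarrow> g (\<sigma> i) < g (\<sigma> j)"
proof -
  obtain e where e: "bij_betw e {..<card I} I" "\<And>k l. k \<le> l \<Longrightarrow> l < card I \<Longrightarrow> f (e l) \<le> f (e k)"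
    using sorted_enumeration_exists[OF fin(1), of f] by blast
  obtain u where u: "bij_betw u {..<card J} J" "\<And>k l. k \<le> l \<Longrightarrow> l < card J \<Longrightarrow> g (u l) \<le> g (u k)"
    using sorted_enumeration_exists[OF fin(2), of g] by blast
  define v where "v = inv_into {..<card I} e"
  have v: "bij_betw v I {..<card I}" "\<And>i. i \<in> I \<Longrightarrow> e (v i) = i"
    unfolding v_def using bij_betw_inv_into[OF e(1)] e(1) by (auto simp: bij_betw_def f_inv_into_f)
  show ?thesis
  proof (rule that[of "u \<circ> v"])
    show "bij_betw (u \<circ> v) I J" using bij_betw_trans[OF v(1)] u(1) c by simp
    fix i j assume ij: "i \<in> I" "j \<in> I"
    then have m: "v i < card I" "v j < card I" using v(1) by (auto simp: bij_betw_def)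
    have "f i < f j \<longleftrightarrow> f (e (v i)) < f (e (v j))" using ij v(2) by simp
    also have "\<dots> \<longleftrightarrow> g (u (v i)) < g (u (v j))"
      using enumeration_less_iff[of e _ I f, OF e(1) e(2) m(2,1)] enumeration_less_iff[of u _ J g, OF u(1) u(2), of "v j" "v i"] m c cu by simp
    finally show "f i < f j \<longleftrightarrow> g ((u \<circ> v) i) < g ((u \<circ> v) j)" by simp
  qed
qed

text \<open>For finite \<open>D\<close>, a decreasing staircase that drops by one at each element of
  \<open>D\<close>. It realises a prescribed set of cuts, hence every composition.\<close>

definition steps :: "nat set \<Rightarrow> nat \<Rightarrow> real" where
  "steps D k = - real (card {d \<in> D. d \<le> k})"

lemma cuts_steps:
  assumes e: "inj_on e {..<n}" and D: "D \<subseteq> {0<..<n}"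
  shows "cuts (e ` {..<n}) (steps D \<circ> inv_into {..<n} e) = D"
proof -
  have fD: "finite D" using D by (rule finite_subset) simp
  have s: "(steps D \<circ> inv_into {..<n} e) (e k) = steps D k" if "k < n" for k
    using that e by simp
  have b: "bij_betw e {..<n} (e ` {..<n})" using e by (simp add: bij_betw_def)
  have mono: "card {d \<in> D. d \<le> k} \<le> card {d \<in> D. d \<le> l}" if "k \<le> l" for k l
    using that fD by (intro card_mono) auto
  have st: "steps D d < steps D (d - 1) \<longleftrightarrow> d \<in> D" if "0 < d" for d
  proof -
    have "{c \<in> D. c \<le> d} = (if d \<in> D then insert d {c \<in> D. c \<le> d - 1} else {c \<in> D. c \<le> d - 1})"
      using that by (auto simp: le_less_Suc_eq le_diff_conv less_Suc_eq_le order_le_less)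
    moreover have "d \<notin> {c \<in> D. c \<le> d - 1}" using that by auto
    ultimately have "card {c \<in> D. c \<le> d} = (if d \<in> D then Suc (card {c \<in> D. c \<le> d - 1}) else card {c \<in> D. c \<le> d - 1})"
      using fD by simp
    then show ?thesis by (simp add: steps_def)
  qed
  have "cuts (e ` {..<n}) (steps D \<circ> inv_into {..<n} e) = {d. 0 < d \<and> d < n \<and> steps D d < steps D (d - 1)}"
  proof (subst cuts_enumeration[OF b])
    fix k l assume kl: "k \<le> l" "l < n"
    then show "(steps D \<circ> inv_into {..<n} e) (e l) \<le> (steps D \<circ> inv_into {..<n} e) (e k)"
      using mono[OF kl(1)] by (simp add: s steps_def del: comp_apply)
  next
    show "{d. 0 < d \<and> d < n \<and> (steps D \<circ> inv_into {..<n} e) (e d) < (steps D \<circ> inv_into {..<n} e) (e (d - 1))} =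
        {d. 0 < d \<and> d < n \<and> steps D d < steps D (d - 1)}"
      by (auto simp: s simp del: comp_apply)
  qed
  also have "\<dots> = D" using D st by auto
  finally show ?thesis .
qed

section \<open>Compositions and ribbon products\<close>

text \<open>On compositions of \<open>n\<close> this is the usual bijection with subsets of {1, ...,
  n - 1}. The bounds on \<open>k\<close> leave out the empty sum and the total.\<close>

definition psums :: "nat list \<Rightarrow> nat set" where
  "psums \<alpha> = {sum_list (take k \<alpha>) |k. 0 < k \<and> k < length \<alpha>}"

lemma psums_Nil [simp]: "psums [] = {}" and psums_single [simp]: "psums [a] = {}"
  by (auto simp: psums_def)

lemma psums_Cons:
  assumes "\<beta> \<noteq> []" shows "psums (a # \<beta>) = insert a ((+) a ` psums \<beta>)"
proof (intro equalityI subsetI)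
  fix d assume "d \<in> psums (a # \<beta>)"
  then obtain k where k: "0 < k" "k < Suc (length \<beta>)" "d = sum_list (take k (a # \<beta>))"
    by (auto simp: psums_def)
  then obtain j where j: "k = Suc j" by (cases k) auto
  show "d \<in> insert a ((+) a ` psums \<beta>)"
    using k j by (cases "j = 0") (auto simp: psums_def)
next
  fix d assume "d \<in> insert a ((+) a ` psums \<beta>)"
  then consider "d = a" | k where "0 < k" "k < length \<beta>" "d = a + sum_list (take k \<beta>)"
    by (auto simp: psums_def)
  then show "d \<in> psums (a # \<beta>)"
  proof cases
    case 1
    then show ?thesis unfolding psums_def using assms by (intro CollectI exI[of _ 1]) auto
  next
    case 2
    then show ?thesis unfolding psums_def by (intro CollectI exI[of _ "Suc k"]) auto
  qed
qed

lemma psums_append: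
  "\<beta> \<noteq> [] \<Longrightarrow> \<gamma> \<noteq> [] \<Longrightarrow>
    psums (\<beta> @ \<gamma>) = psums \<beta> \<union> {sum_list \<beta>} \<union> (+) (sum_list \<beta>) ` psums \<gamma>"
proof (induction \<beta>)
  case (Cons a \<beta>)
  show ?case
  proof (cases "\<beta> = []")
    case True
    then show ?thesis using Cons.prems by (simp add: psums_Cons)
  next
    case False
    then show ?thesis using Cons by (simp add: psums_Cons image_Un image_image add.assoc insert_commute)
  qed
qed simp

lemma near_concat_Cons: "\<beta> \<noteq> [] \<Longrightarrow> near_concat (a # \<beta>) \<gamma> = a # near_concat \<beta> \<gamma>"
  by (simp add: near_concat_def)

lemma near_concat_single: "near_concat [a] (b # \<gamma>) = (a + b) # \<gamma>"
  by (simp add: near_concat_def)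

lemma near_concat_nonempty: "near_concat \<beta> \<gamma> \<noteq> []"
  by (simp add: near_concat_def)

text \<open>Compared with concatenation, only the partial sum at the seam is missing.\<close>

lemma psums_near_concat:
  "\<beta> \<noteq> [] \<Longrightarrow> \<gamma> \<noteq> [] \<Longrightarrow>
    psums (near_concat \<beta> \<gamma>) = psums \<beta> \<union> (+) (sum_list \<beta>) ` psums \<gamma>"
proof (induction \<beta>)
  case (Cons a \<beta>)
  obtain b \<gamma>' where g: "\<gamma> = b # \<gamma>'" using Cons.prems(2) by (cases \<gamma>) auto
  show ?case
  proof (cases "\<beta> = []")
    case True
    then show ?thesis unfolding g
      by (cases "\<gamma>' = []") (auto simp: near_concat_single psums_Cons image_image add.assoc)
  next
    case False
    then show ?thesis using Cons
      by (simp add: near_concat_Cons psums_Cons near_concat_nonempty image_Un image_image add.assoc)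
  qed
qed simp

lemma sum_list_near_concat:
  "\<beta> \<noteq> [] \<Longrightarrow> \<gamma> \<noteq> [] \<Longrightarrow> sum_list (near_concat \<beta> \<gamma>) = sum_list \<beta> + sum_list \<gamma>"
proof (induction \<beta>)
  case (Cons a \<beta>)
  obtain b \<gamma>' where g: "\<gamma> = b # \<gamma>'" using Cons.prems(2) by (cases \<gamma>) auto
  show ?case using Cons by (cases "\<beta> = []") (auto simp: g near_concat_single near_concat_Cons)
qed simp

lemma composition_Cons [simp]: "composition (a # \<beta>) \<longleftrightarrow> 0 < a \<and> composition \<beta>"
  by (simp add: composition_def)

lemma composition_Nil [simp]: "composition []"
  by (simp add: composition_def)

lemma composition_append [simp]: "composition (\<beta> @ \<gamma>) \<longleftrightarrow> composition \<beta> \<and> composition \<gamma>"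
  by (auto simp: composition_def)

lemma composition_near_concat:
  "composition \<beta> \<Longrightarrow> composition \<gamma> \<Longrightarrow> \<beta> \<noteq> [] \<Longrightarrow> \<gamma> \<noteq> [] \<Longrightarrow> composition (near_concat \<beta> \<gamma>)"
proof (induction \<beta>)
  case (Cons a \<beta>)
  obtain b \<gamma>' where g: "\<gamma> = b # \<gamma>'" using Cons.prems(4) by (cases \<gamma>) auto
  show ?case using Cons by (cases "\<beta> = []") (auto simp: g near_concat_single near_concat_Cons)
qed simp

lemma composition_sum_pos: "composition \<beta> \<Longrightarrow> \<beta> \<noteq> [] \<Longrightarrow> 0 < sum_list \<beta>"
  by (cases \<beta>) auto

lemma psums_bounds: "composition \<alpha> \<Longrightarrow> psums \<alpha> \<subseteq> {0<..<sum_list \<alpha>}"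
proof (induction \<alpha>)
  case (Cons a \<alpha>)
  then show ?case
    by (cases "\<alpha> = []") (auto simp: psums_Cons composition_sum_pos dest!: subsetD)
qed simp

text \<open>The first part is the least proper partial sum, or the total if there is none; removing
  it shifts the remaining sums.\<close>

lemma composition_eqI:
  "composition \<alpha> \<Longrightarrow> composition \<beta> \<Longrightarrow> sum_list \<alpha> = sum_list \<beta> \<Longrightarrow> psums \<alpha> = psums \<beta> \<Longrightarrow> \<alpha> = \<beta>"
proof (induction \<alpha> arbitrary: \<beta>)
  case Nil
  then show ?case by (cases \<beta>) auto
next
  case (Cons a \<alpha>)
  obtain b \<beta>' where b: "\<beta> = b # \<beta>'" using Cons.prems by (cases \<beta>) auto
  have min: "psums (c # \<gamma>) = {} \<and> \<gamma> = [] \<or> \<gamma> \<noteq> [] \<and> c \<in> psums (c # \<gamma>) \<and> (\<forall>d\<in>psums (c # \<gamma>). c \<le> d)" for c \<gamma>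
    by (cases "\<gamma> = []") (auto simp: psums_Cons)
  show ?case
  proof (cases "\<alpha> = []")
    case True
    then have "\<beta>' = []" using Cons.prems(4) min[of b \<beta>'] b by auto
    then show ?thesis using True Cons.prems(3) b by simp
  next
    case False
    then have F: "\<beta>' \<noteq> []" using Cons.prems(4) min[of a \<alpha>] b by auto
    have ab: "a = b" using Cons.prems(4) min[of a \<alpha>] min[of b \<beta>'] b False F by (metis le_antisym)
    have pos: "0 \<notin> psums \<alpha>" "0 \<notin> psums \<beta>'"
      using psums_bounds[of \<alpha>] psums_bounds[of \<beta>'] Cons.prems b by auto
    have "insert a ((+) a ` psums \<alpha>) = insert a ((+) a ` psums \<beta>')"
      using Cons.prems(4) False F unfolding b ab by (simp add: psums_Cons)
    moreover have "a \<notin> (+) a ` psums \<alpha>" "a \<notin> (+) a ` psums \<beta>'" using pos by auto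
    ultimately have "(+) a ` psums \<alpha> = (+) a ` psums \<beta>'" by (metis insert_ident)
    then have "psums \<alpha> = psums \<beta>'" by (simp add: inj_image_eq_iff)
    then show ?thesis using Cons.IH[of \<beta>'] Cons.prems(1-3) b ab by simp
  qed
qed

text \<open>The largest element of \<open>D\<close> is the sum of all parts but the last, so a
  composition of it is extended by one part.\<close>

lemma composition_exists:
  "D \<subseteq> {0<..<n} \<Longrightarrow> \<exists>\<alpha>. composition \<alpha> \<and> sum_list \<alpha> = n \<and> psums \<alpha> = D"
proof (induction n arbitrary: D rule: less_induct)
  case (less n)
  have fD: "finite D" using less.prems by (rule finite_subset) simp
  show ?case
  proof (cases "D = {}")
    case True
    show ?thesis
    proof (cases "n = 0")
      case True then show ?thesis using \<open>D = {}\<close> by (intro exI[of _ "[]"]) simp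
    next
      case False then show ?thesis using \<open>D = {}\<close> by (intro exI[of _ "[n]"]) simp
    qed
  next
    case False
    define m where "m = Max D"
    have m: "m \<in> D" "\<And>d. d \<in> D \<Longrightarrow> d \<le> m" using fD False by (auto simp: m_def)
    have mn: "0 < m" "m < n" using m(1) less.prems by auto
    have "D - {m} \<subseteq> {0<..<m}" using m(2) less.prems by force
    then obtain \<alpha> where a: "composition \<alpha>" "sum_list \<alpha> = m" "psums \<alpha> = D - {m}" using less.IH[OF mn(2)] by blast
    have ne: "\<alpha> \<noteq> []" using a(2) mn by auto
    show ?thesis
    proof (intro exI conjI)
      show "composition (\<alpha> @ [n - m])" using a(1) mn by simp
      show "sum_list (\<alpha> @ [n - m]) = n" using a(2) mn by simp
      show "psums (\<alpha> @ [n - m]) = D" using ne a m(1) by (auto simp: psums_append)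
    qed
  qed
qed

definition comp_of :: "nat \<Rightarrow> nat set \<Rightarrow> nat list" where
  "comp_of n D = (THE \<alpha>. composition \<alpha> \<and> sum_list \<alpha> = n \<and> psums \<alpha> = D)"

lemma comp_of_eq: "composition \<alpha> \<Longrightarrow> comp_of (sum_list \<alpha>) (psums \<alpha>) = \<alpha>"
  unfolding comp_of_def by (rule the_equality) (auto intro: composition_eqI)

lemma comp_of:
  assumes "D \<subseteq> {0<..<n}"
  shows "composition (comp_of n D)" "sum_list (comp_of n D) = n" "psums (comp_of n D) = D"
proof -
  obtain \<alpha> where "composition \<alpha>" "sum_list \<alpha> = n" "psums \<alpha> = D" using composition_exists[OF assms] by blast
  then show "composition (comp_of n D)" "sum_list (comp_of n D) = n" "psums (comp_of n D) = D"
    using comp_of_eq[of \<alpha>] by auto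
qed

lemma comp_of_empty: "0 < n \<Longrightarrow> comp_of n {} = [n]" "comp_of 0 {} = []"
  using comp_of_eq[of "[n]"] comp_of_eq[of "[]"] by simp_all

lemma low_cuts_bounds: "D \<subseteq> {0<..<n} \<Longrightarrow> low_cuts k D \<subseteq> {0<..<k}"
  by (auto simp: low_cuts_def)

lemma high_cuts_bounds: "D \<subseteq> {0<..<n} \<Longrightarrow> high_cuts k D \<subseteq> {0<..<n - k}"
  by (auto simp: high_cuts_def)

text \<open>A partial sum of \<alpha> at the seam means concatenation, none means
  near-concatenation, and in both cases cutting \<alpha> there gives back \<beta> and \<gamma>. The
  two cases exclude each other, so the summands never both contribute.\<close>

lemma ribbon_prod_eq:
  assumes "composition \<alpha>" "composition \<beta>" "composition \<gamma>" "sum_list \<beta> + sum_list \<gamma> = sum_list \<alpha>"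
  shows "ribbon_prod \<beta> \<gamma> \<alpha> =
    (if psums \<beta> = low_cuts (sum_list \<beta>) (psums \<alpha>) \<and> psums \<gamma> = high_cuts (sum_list \<beta>) (psums \<alpha>) then 1 else 0)"
proof -
  note bd = psums_bounds[OF assms(1)] psums_bounds[OF assms(2)] psums_bounds[OF assms(3)]
  consider "\<beta> = []" | "\<beta> \<noteq> []" "\<gamma> = []" | "\<beta> \<noteq> []" "\<gamma> \<noteq> []" by blast
  then show ?thesis
  proof cases
    case 1
    have "low_cuts 0 (psums \<alpha>) = {}" "high_cuts 0 (psums \<alpha>) = psums \<alpha>"
      using bd(1) by (auto simp: low_cuts_def high_cuts_def)
    moreover have "\<alpha> = \<gamma> \<longleftrightarrow> psums \<gamma> = psums \<alpha>" using composition_eqI[OF assms(1,3)] assms(4) 1 by auto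
    ultimately show ?thesis using 1 by (simp add: ribbon_prod_def ribbon_def)
  next
    case 2
    have "low_cuts (sum_list \<alpha>) (psums \<alpha>) = psums \<alpha>" "high_cuts (sum_list \<alpha>) (psums \<alpha>) = {}"
      using bd(1) by (auto simp: low_cuts_def high_cuts_def)
    moreover have "\<alpha> = \<beta> \<longleftrightarrow> psums \<beta> = psums \<alpha>" using composition_eqI[OF assms(1,2)] assms(4) 2 by auto
    ultimately show ?thesis using 2 assms(4) by (simp add: ribbon_prod_def ribbon_def)
  next
    case 3
    let ?k = "sum_list \<beta>"
    let ?E = "psums \<beta> \<union> (+) ?k ` psums \<gamma>"
    have kE: "?k \<notin> ?E" using bd(2,3) by auto
    have "\<alpha> = \<beta> @ \<gamma> \<longleftrightarrow> psums \<alpha> = insert ?k ?E"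
      using composition_eqI[OF assms(1), of "\<beta> @ \<gamma>"] assms 3 by (auto simp: psums_append)
    moreover have "\<alpha> = near_concat \<beta> \<gamma> \<longleftrightarrow> psums \<alpha> = ?E"
      using composition_eqI[OF assms(1) composition_near_concat[OF assms(2,3) 3]] assms(4)
        psums_near_concat[OF 3] sum_list_near_concat[OF 3] by auto
    moreover have "psums \<beta> = low_cuts ?k (psums \<alpha>) \<and> psums \<gamma> = high_cuts ?k (psums \<alpha>) \<longleftrightarrow>
        psums \<alpha> = insert ?k ?E \<or> psums \<alpha> = ?E"
    proof
      assume *: "psums \<beta> = low_cuts ?k (psums \<alpha>) \<and> psums \<gamma> = high_cuts ?k (psums \<alpha>)"
      have "(+) ?k ` high_cuts ?k (psums \<alpha>) = {d \<in> psums \<alpha>. ?k < d}"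
      proof (intro equalityI subsetI)
        fix d assume d: "d \<in> {d \<in> psums \<alpha>. ?k < d}"
        then show "d \<in> (+) ?k ` high_cuts ?k (psums \<alpha>)"
          by (intro image_eqI[of _ _ "d - ?k"]) (auto simp: high_cuts_def)
      qed (auto simp: high_cuts_def add.commute)
      then have "?E = {d \<in> psums \<alpha>. d \<noteq> ?k}" using * by (auto simp: low_cuts_def)
      then show "psums \<alpha> = insert ?k ?E \<or> psums \<alpha> = ?E" by auto
    next
      assume "psums \<alpha> = insert ?k ?E \<or> psums \<alpha> = ?E"
      then have E: "d \<in> psums \<alpha> \<longleftrightarrow> d \<in> ?E" if "d \<noteq> ?k" for d using that by auto
      have "d \<in> low_cuts ?k (psums \<alpha>) \<longleftrightarrow> d \<in> psums \<beta>" for d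
        using E[of d] bd(2) by (auto simp: low_cuts_def)
      moreover have "d \<in> high_cuts ?k (psums \<alpha>) \<longleftrightarrow> d \<in> psums \<gamma>" for d
      proof -
        have "d + ?k \<notin> psums \<beta>" using bd(2) by auto
        then show ?thesis using E[of "d + ?k"] bd(2,3) by (auto simp: high_cuts_def add.commute)
      qed
      ultimately show "psums \<beta> = low_cuts ?k (psums \<alpha>) \<and> psums \<gamma> = high_cuts ?k (psums \<alpha>)" by blast
    qed
    moreover have "insert ?k ?E \<noteq> ?E" using kE by blast
    ultimately show ?thesis using 3 by (auto simp: ribbon_prod_def ribbon_def)
  qed
qed

lemma finite_compositions: "finite {\<alpha>. composition \<alpha> \<and> sum_list \<alpha> = n}"
proof (rule finite_subset)
  show "{\<alpha>. composition \<alpha> \<and> sum_list \<alpha> = n} \<subseteq> (\<lambda>D. comp_of n D) ` Pow {0<..<n}"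
  proof
    fix \<alpha> assume "\<alpha> \<in> {\<alpha>. composition \<alpha> \<and> sum_list \<alpha> = n}"
    then show "\<alpha> \<in> (\<lambda>D. comp_of n D) ` Pow {0<..<n}"
      using comp_of_eq[of \<alpha>] psums_bounds[of \<alpha>] by (intro image_eqI[of _ _ "psums \<alpha>"]) auto
  qed
qed simp

text \<open>For each degree \<open>k\<close> of the left factor exactly one pair of ribbons
  contributes, namely the two pieces of \<alpha> cut after \<open>k\<close> boxes. The coproduct of
  polytopes produces the same sum with binomial weights.\<close>

lemma NSym_mult_composition:
  assumes "composition \<alpha>"
  shows "NSym_mult c d \<alpha> = (\<Sum>k\<le>sum_list \<alpha>.
    c (comp_of k (low_cuts k (psums \<alpha>))) * d (comp_of (sum_list \<alpha> - k) (high_cuts k (psums \<alpha>))))"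
proof -
  let ?n = "sum_list \<alpha>" and ?D = "psums \<alpha>"
  let ?A = "{(\<beta>, \<gamma>). composition \<beta> \<and> composition \<gamma> \<and> sum_list \<beta> + sum_list \<gamma> = ?n}"
  let ?p = "\<lambda>k. (comp_of k (low_cuts k ?D), comp_of (?n - k) (high_cuts k ?D))"
  let ?h = "\<lambda>(\<beta>, \<gamma>). c \<beta> * d \<gamma> * ribbon_prod \<beta> \<gamma> \<alpha>"
  note lo = comp_of[OF low_cuts_bounds[OF psums_bounds[OF assms]]]
  note hi = comp_of[OF high_cuts_bounds[OF psums_bounds[OF assms]]]
  have fin: "finite ?A"
  proof (rule finite_subset)
    show "?A \<subseteq> (\<Union>k\<le>?n. {\<beta>. composition \<beta> \<and> sum_list \<beta> = k}) \<times> (\<Union>k\<le>?n. {\<beta>. composition \<beta> \<and> sum_list \<beta> = k})"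
      by auto
  qed (simp add: finite_compositions)
  have sub: "?p ` {..?n} \<subseteq> ?A" using lo hi by auto
  have zero: "\<forall>x\<in>?A - ?p ` {..?n}. ?h x = 0"
  proof
    fix x assume x: "x \<in> ?A - ?p ` {..?n}"
    obtain \<beta> \<gamma> where bg: "x = (\<beta>, \<gamma>)" by (cases x)
    have A: "composition \<beta>" "composition \<gamma>" "sum_list \<beta> + sum_list \<gamma> = ?n" using x bg by auto
    have "\<not> (psums \<beta> = low_cuts (sum_list \<beta>) ?D \<and> psums \<gamma> = high_cuts (sum_list \<beta>) ?D)"
    proof
      assume *: "psums \<beta> = low_cuts (sum_list \<beta>) ?D \<and> psums \<gamma> = high_cuts (sum_list \<beta>) ?D"
      have "?n - sum_list \<beta> = sum_list \<gamma>" using A(3) by simp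
      then have "x = ?p (sum_list \<beta>)" using * comp_of_eq[OF A(1)] comp_of_eq[OF A(2)] bg by simp
      moreover have "sum_list \<beta> \<in> {..?n}" using A(3) by simp
      ultimately show False using x by blast
    qed
    then show "?h x = 0" unfolding bg using ribbon_prod_eq[OF assms A, where 'a = 'a] by auto
  qed
  have inj: "inj_on ?p {..?n}"
    by (rule inj_on_inverseI[of _ "\<lambda>x. sum_list (fst x)"]) (simp add: lo)
  have "NSym_mult c d \<alpha> = sum ?h (?p ` {..?n})"
    unfolding NSym_mult_def by (rule sum.mono_neutral_right[OF fin sub zero])
  also have "\<dots> = (\<Sum>k\<le>?n. ?h (?p k))" by (simp only: sum.reindex[OF inj] comp_def)
  also have "\<dots> = (\<Sum>k\<le>?n. c (comp_of k (low_cuts k ?D)) * d (comp_of (?n - k) (high_cuts k ?D)))"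
  proof (rule sum.cong[OF refl])
    fix k assume k: "k \<in> {..?n}"
    have "ribbon_prod (fst (?p k)) (snd (?p k)) \<alpha> = (1::'a)"
      using ribbon_prod_eq[OF assms lo(1) hi(1), of k k, where 'a = 'a] k by (simp add: lo hi)
    then show "?h (?p k) = c (comp_of k (low_cuts k ?D)) * d (comp_of (?n - k) (high_cuts k ?D))" by simp
  qed
  finally show ?thesis .
qed

lemma NSym_mult_non_composition:
  assumes "\<not> composition \<alpha>" shows "NSym_mult c d \<alpha> = 0"
proof -
  have "ribbon_prod \<beta> \<gamma> \<alpha> = (0::'a)" if "composition \<beta>" "composition \<gamma>" for \<beta> \<gamma>
  proof -
    have "\<alpha> \<noteq> \<beta>" "\<alpha> \<noteq> \<gamma>" "\<alpha> \<noteq> \<beta> @ \<gamma>" using that assms by auto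
    moreover have "\<alpha> \<noteq> near_concat \<beta> \<gamma>" if "\<beta> \<noteq> []" "\<gamma> \<noteq> []"
      using composition_near_concat[OF \<open>composition \<beta>\<close> \<open>composition \<gamma>\<close> that] assms by auto
    ultimately show ?thesis by (auto simp: ribbon_prod_def ribbon_def)
  qed
  then show ?thesis unfolding NSym_mult_def by (intro sum.neutral) auto
qed

section \<open>The group of noncommutative symmetric functions\<close>

text \<open>Indexing by degree and set of partial sums turns the ribbon product into an operation on
  sets of cuts. Arguments with \<open>D \<subseteq> {0<..<n}\<close> are the meaningful
  ones.\<close>

definition coeff :: "(nat list \<Rightarrow> 'k) \<Rightarrow> nat \<Rightarrow> nat set \<Rightarrow> 'k" where
  "coeff c n D = c (comp_of n D)"

lemma coeff_mult:
  assumes "D \<subseteq> {0<..<n}"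
  shows "coeff (NSym_mult c d) n D = (\<Sum>k\<le>n. coeff c k (low_cuts k D) * coeff d (n - k) (high_cuts k D))"
  unfolding coeff_def using NSym_mult_composition[OF comp_of(1)[OF assms], of c d]
  by (simp add: comp_of[OF assms])

lemma NSym_eqI:
  assumes "\<And>\<alpha>. \<not> composition \<alpha> \<Longrightarrow> c \<alpha> = 0" "\<And>\<alpha>. \<not> composition \<alpha> \<Longrightarrow> d \<alpha> = 0"
    and "\<And>n D. D \<subseteq> {0<..<n} \<Longrightarrow> coeff c n D = coeff d n D"
  shows "c = d"
proof
  fix \<alpha> show "c \<alpha> = d \<alpha>"
  proof (cases "composition \<alpha>")
    case True
    then show ?thesis using assms(3)[OF psums_bounds[OF True]] comp_of_eq[OF True] by (simp add: coeff_def)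
  qed (simp add: assms)
qed

section \<open>The multiplication of formal sums: associativity, unit and inverses\<close>

lemma low_low: "j \<le> k \<Longrightarrow> low_cuts j (low_cuts k D) = low_cuts j D"
  by (auto simp: low_cuts_def)

lemma high_low: "high_cuts j (low_cuts (j + k) D) = low_cuts k (high_cuts j D)"
  by (auto simp: low_cuts_def high_cuts_def)

lemma high_high: "high_cuts k (high_cuts j D) = high_cuts (j + k) D"
  by (auto simp: high_cuts_def ac_simps)

text \<open>Both sides sum over the ways to cut a composition into three pieces;
  \<open>low_low\<close>, \<open>high_low\<close> and \<open>high_high\<close> say that the order of
  the two cuts is immaterial.\<close>

lemma NSym_mult_assoc:
  "NSym_mult (NSym_mult c d) e = NSym_mult c (NSym_mult d e)"
proof (rule NSym_eqI)
  fix n and D :: "nat set" assume D: "D \<subseteq> {0<..<n}"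
  let ?t = "\<lambda>j i l. coeff c j (low_cuts j D) * coeff d i (low_cuts i (high_cuts j D)) *
    coeff e l (high_cuts (j + i) D)"
  have "coeff (NSym_mult (NSym_mult c d) e) n D =
      (\<Sum>k\<le>n. \<Sum>j\<le>k. ?t j (k - j) (n - k))"
    unfolding coeff_mult[OF D]
  proof (rule sum.cong[OF refl])
    fix k assume "k \<in> {..n}"
    have "coeff (NSym_mult c d) k (low_cuts k D) * coeff e (n - k) (high_cuts k D) =
        (\<Sum>j\<le>k. coeff c j (low_cuts j (low_cuts k D)) * coeff d (k - j) (high_cuts j (low_cuts k D)) *
          coeff e (n - k) (high_cuts k D))"
      by (simp add: coeff_mult[OF low_cuts_bounds[OF D]] sum_distrib_right)
    also have "\<dots> = (\<Sum>j\<le>k. ?t j (k - j) (n - k))"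
    proof (rule sum.cong[OF refl])
      fix j assume j: "j \<in> {..k}"
      then have "high_cuts j (low_cuts k D) = low_cuts (k - j) (high_cuts j D)"
        using high_low[of j "k - j" D] by simp
      then show "coeff c j (low_cuts j (low_cuts k D)) * coeff d (k - j) (high_cuts j (low_cuts k D)) *
          coeff e (n - k) (high_cuts k D) = ?t j (k - j) (n - k)"
        using j by (simp add: low_low)
    qed
    finally show "coeff (NSym_mult c d) k (low_cuts k D) * coeff e (n - k) (high_cuts k D) =
      (\<Sum>j\<le>k. ?t j (k - j) (n - k))" .
  qed
  also have "\<dots> = (\<Sum>k\<le>n. \<Sum>j\<le>k. (\<lambda>j i. ?t j i (n - (j + i))) j (k - j))"
    by (intro sum.cong refl) simp
  also have "\<dots> = (\<Sum>(j, i)\<in>{(j, i). j + i \<le> n}. ?t j i (n - (j + i)))"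
    by (simp only: sum.triangle_reindex_eq)
  also have "{(j, i). j + i \<le> n} = Sigma {..n} (\<lambda>j. {..n - j})" by auto
  also have "(\<Sum>(j, i)\<in>Sigma {..n} (\<lambda>j. {..n - j}). ?t j i (n - (j + i))) =
      (\<Sum>j\<le>n. \<Sum>i\<le>n - j. ?t j i (n - (j + i)))"
    by (simp add: sum.Sigma)
  also have "\<dots> = coeff (NSym_mult c (NSym_mult d e)) n D"
    unfolding coeff_mult[OF D] coeff_mult[OF high_cuts_bounds[OF D]]
    by (simp add: sum_distrib_left high_high mult.assoc)
  finally show "coeff (NSym_mult (NSym_mult c d) e) n D = coeff (NSym_mult c (NSym_mult d e)) n D" .
qed (simp_all add: NSym_mult_non_composition)

lemma coeff_one:
  assumes "D \<subseteq> {0<..<n}" shows "coeff (ribbon []) n D = (if n = 0 then 1 else 0)"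
proof -
  have "comp_of n D = [] \<longleftrightarrow> n = 0"
    using comp_of[OF assms] comp_of_empty(2) assms by auto
  then show ?thesis by (simp add: coeff_def ribbon_def)
qed

lemma low_cuts_full: "D \<subseteq> {0<..<n} \<Longrightarrow> low_cuts n D = D"
  by (auto simp: low_cuts_def)

lemma high_cuts_0: "D \<subseteq> {0<..<n} \<Longrightarrow> high_cuts 0 D = D"
  by (auto simp: high_cuts_def)

lemma ribbon_non_composition: "\<not> composition \<alpha> \<Longrightarrow> ribbon [] \<alpha> = 0"
  by (auto simp: ribbon_def)

lemma NSym_one_mult:
  assumes "\<And>\<alpha>. \<not> composition \<alpha> \<Longrightarrow> c \<alpha> = 0" shows "NSym_mult (ribbon []) c = c"
proof (rule NSym_eqI)
  fix n and D :: "nat set" assume D: "D \<subseteq> {0<..<n}"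
  have "coeff (NSym_mult (ribbon []) c) n D = (\<Sum>k\<le>n. if k = 0 then coeff c n D else 0)"
    unfolding coeff_mult[OF D]
    by (intro sum.cong refl) (simp add: coeff_one[OF low_cuts_bounds[OF D]] high_cuts_0[OF D])
  then show "coeff (NSym_mult (ribbon []) c) n D = coeff c n D" by simp
qed (simp_all add: NSym_mult_non_composition assms)

lemma NSym_mult_one:
  assumes "\<And>\<alpha>. \<not> composition \<alpha> \<Longrightarrow> c \<alpha> = 0" shows "NSym_mult c (ribbon []) = c"
proof (rule NSym_eqI)
  fix n and D :: "nat set" assume D: "D \<subseteq> {0<..<n}"
  have "coeff (NSym_mult c (ribbon [])) n D = (\<Sum>k\<le>n. if k = n then coeff c n D else 0)"
    unfolding coeff_mult[OF D]
    by (intro sum.cong refl) (simp add: coeff_one[OF high_cuts_bounds[OF D]] low_cuts_full[OF D])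
  then show "coeff (NSym_mult c (ribbon [])) n D = coeff c n D" by simp
qed (simp_all add: NSym_mult_non_composition assms)

text \<open>The equation that the unknown series times \<open>c\<close> be 1, solved for the unknown
  coefficient of degree \<open>n\<close>. That coefficient is multiplied by the constant term of
  \<open>c\<close>, which is 1 where this is used.\<close>

function left_inverse :: "(nat list \<Rightarrow> 'k::field) \<Rightarrow> nat \<Rightarrow> nat set \<Rightarrow> 'k" where
  "left_inverse c n D = (if n = 0 then 1 else
     - (\<Sum>k\<in>{..<n}. left_inverse c k (low_cuts k D) * coeff c (n - k) (high_cuts k D)))"
  by auto
termination by (relation "Wellfounded.measure (\<lambda>(c, n, D). n)") auto

declare left_inverse.simps [simp del]

lemma coeff_Nil: "coeff c 0 {} = c []"
  by (simp add: coeff_def comp_of_empty)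

lemma NSym_left_inverse_exists:
  assumes "c [] = (1::'k::field)"
  shows "\<exists>b. (\<forall>\<alpha>. \<not> composition \<alpha> \<longrightarrow> b \<alpha> = 0) \<and> b [] = 1 \<and> NSym_mult b c = ribbon []"
proof -
  define b where "b \<alpha> = (if composition \<alpha> then left_inverse c (sum_list \<alpha>) (psums \<alpha>) else 0)" for \<alpha>
  have cb: "coeff b n D = left_inverse c n D" if "D \<subseteq> {0<..<n}" for n D
    using comp_of[OF that] by (simp add: coeff_def b_def)
  show ?thesis
  proof (intro exI conjI allI impI)
    show "b \<alpha> = 0" if "\<not> composition \<alpha>" for \<alpha> using that by (simp add: b_def)
    show "b [] = 1" by (simp add: b_def left_inverse.simps)
    show "NSym_mult b c = ribbon []"
    proof (rule NSym_eqI)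
      fix n and D :: "nat set" assume D: "D \<subseteq> {0<..<n}"
      have "coeff (NSym_mult b c) n D =
          (\<Sum>k\<le>n. left_inverse c k (low_cuts k D) * coeff c (n - k) (high_cuts k D))"
        unfolding coeff_mult[OF D] by (simp add: cb[OF low_cuts_bounds[OF D]])
      also have "\<dots> = (\<Sum>k<n. left_inverse c k (low_cuts k D) * coeff c (n - k) (high_cuts k D)) +
          left_inverse c n D * coeff c 0 (high_cuts n D)"
        by (simp add: lessThan_Suc_atMost[symmetric] low_cuts_full[OF D])
      also have "high_cuts n D = {}" using high_cuts_bounds[OF D, of n] by simp
      also have "(\<Sum>k<n. left_inverse c k (low_cuts k D) * coeff c (n - k) (high_cuts k D)) +
          left_inverse c n D * coeff c 0 {} = (if n = 0 then 1 else 0)"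
        by (simp add: coeff_Nil assms left_inverse.simps[of c n])
      finally show "coeff (NSym_mult b c) n D = coeff (ribbon []) n D" by (simp add: coeff_one[OF D])
    qed (simp_all add: NSym_mult_non_composition ribbon_non_composition)
  qed
qed

text \<open>The left inverse \<open>b\<close> has constant term 1 too, so it has a left inverse
  \<open>a\<close>; associativity forces \<open>a = c\<close>, and \<open>b\<close> is
  two-sided.\<close>

lemma NSym_inverse_exists:
  assumes "c [] = (1::'k::field)" and c: "\<And>\<alpha>. \<not> composition \<alpha> \<Longrightarrow> c \<alpha> = 0"
  shows "\<exists>b. (\<forall>\<alpha>. \<not> composition \<alpha> \<longrightarrow> b \<alpha> = 0) \<and> NSym_mult b c = ribbon [] \<and> NSym_mult c b = ribbon []"
proof -
  obtain b :: "nat list \<Rightarrow> 'k" where b: "\<forall>\<alpha>. \<not> composition \<alpha> \<longrightarrow> b \<alpha> = 0" "b [] = 1" "NSym_mult b c = ribbon []"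
    using NSym_left_inverse_exists[of c, OF assms(1)] by blast
  obtain a :: "nat list \<Rightarrow> 'k" where a: "\<forall>\<alpha>. \<not> composition \<alpha> \<longrightarrow> a \<alpha> = 0" "NSym_mult a b = ribbon []"
    using NSym_left_inverse_exists[of b, OF b(2)] by blast
  have "a = NSym_mult a (NSym_mult b c)" using NSym_mult_one[of a] a(1) b(3) by simp
  also have "\<dots> = c" using NSym_one_mult[of c] c a(2) by (simp flip: NSym_mult_assoc)
  finally have "NSym_mult c b = ribbon []" using a(2) by simp
  then show ?thesis using b by blast
qed

text \<open>Invertibility is automatic from the constant term. The relation may be stated for all
  \<open>n\<close>: for \<open>n = 0\<close> it says that the constant term is 1, and for
  \<open>n = 1\<close> it is trivial.\<close>

lemma NSym_group_carrier_iff: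
  "c \<in> carrier NSym_group \<longleftrightarrow> (\<forall>\<alpha>. \<not> composition \<alpha> \<longrightarrow> c \<alpha> = 0) \<and> c [] = 1 \<and>
    (\<forall>n. fact n * coeff c n {} = coeff c 1 {} ^ n)"
proof -
  have u: "c \<in> Units NSym_completion" if c: "\<forall>\<alpha>. \<not> composition \<alpha> \<longrightarrow> c \<alpha> = 0" "c [] = 1"
  proof -
    obtain b where "\<And>\<alpha>. \<not> composition \<alpha> \<Longrightarrow> b \<alpha> = 0" "NSym_mult b c = ribbon []" "NSym_mult c b = ribbon []"
      using NSym_inverse_exists[of c] c by blast
    then show ?thesis using c(1) by (auto simp: Units_def NSym_completion_def)
  qed
  have "(\<forall>n. fact n * coeff c n {} = coeff c 1 {} ^ n) \<longleftrightarrow> (\<forall>n>1. of_nat (fact n) * c [n] = c [1] ^ n)"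
    if "c [] = 1"
  proof
    assume *: "\<forall>n>1. of_nat (fact n) * c [n] = c [1] ^ n"
    show "\<forall>n. fact n * coeff c n {} = coeff c 1 {} ^ n"
    proof
      fix n :: nat
      consider "n = 0" | "n = 1" | "n > 1" by linarith
      then show "fact n * coeff c n {} = coeff c 1 {} ^ n"
        by cases (use * that in \<open>auto simp: coeff_def comp_of_empty\<close>)
    qed
  next
    assume *: "\<forall>n. fact n * coeff c n {} = coeff c 1 {} ^ n"
    show "\<forall>n>1. of_nat (fact n) * c [n] = c [1] ^ n"
    proof (intro allI impI)
      fix n :: nat assume "n > 1"
      then show "of_nat (fact n) * c [n] = c [1] ^ n"
        using *[rule_format, of n] by (simp add: coeff_def comp_of_empty)
    qed
  qed
  then show ?thesis using u by (auto simp: NSym_group_def Units_def NSym_completion_def)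
qed

lemma coeff_mult_empty:
  "coeff (NSym_mult c d) n {} = (\<Sum>k\<le>n. coeff c k {} * coeff d (n - k) {})"
proof -
  have "low_cuts k {} = {}" "high_cuts k {} = {}" for k by (auto simp: low_cuts_def high_cuts_def)
  then show ?thesis by (simp add: coeff_mult)
qed

text \<open>The passage from ordinary to exponential generating functions: scaling by n! turns a
  convolution into a binomial one.\<close>

lemma fact_coeff_mult:
  fixes c d :: "nat list \<Rightarrow> 'k::field_char_0"
  shows "fact n * coeff (NSym_mult c d) n {} =
    (\<Sum>k\<le>n. of_nat (n choose k) * (fact k * coeff c k {}) * (fact (n - k) * coeff d (n - k) {}))"
  unfolding coeff_mult_empty sum_distrib_left
proof (rule sum.cong[OF refl])
  fix k assume "k \<in> {..n}"
  then have "(fact n :: 'k) = of_nat (n choose k) * fact k * fact (n - k)"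
    by (simp add: binomial_fact)
  then show "fact n * (coeff c k {} * coeff d (n - k) {}) =
      of_nat (n choose k) * (fact k * coeff c k {}) * (fact (n - k) * coeff d (n - k) {})" by simp
qed

text \<open>After scaling by n!, the one-part coefficients of a member are the powers of one element
  x, as in exp (x t). By the binomial theorem those of a product are the powers of a sum.\<close>

lemma NSym_group_mult_closed:
  fixes c d :: "nat list \<Rightarrow> 'k::field_char_0"
  assumes c: "c \<in> carrier NSym_group" and d: "d \<in> carrier NSym_group"
  shows "NSym_mult c d \<in> carrier NSym_group"
proof -
  note c' = c[unfolded NSym_group_carrier_iff] and d' = d[unfolded NSym_group_carrier_iff]
  have f: "fact n * coeff (NSym_mult c d) n {} = (coeff c 1 {} + coeff d 1 {}) ^ n" for n
    unfolding fact_coeff_mult binomial_ring using c' d' by simp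
  have "coeff (NSym_mult c d) 1 {} = coeff c 1 {} + coeff d 1 {}" using f[of 1] by simp
  moreover have "NSym_mult c d [] = 1"
    using f[of 0] coeff_Nil[of "NSym_mult c d"] by simp
  ultimately show ?thesis
    unfolding NSym_group_carrier_iff using f NSym_mult_non_composition[of _ c d] by simp
qed

text \<open>The inverse of exp (x t) is exp (- x t). In the induction the top term is isolated by
  comparison with the expansion of (- x + x)^n, which is zero for positive n.\<close>

lemma NSym_group_inverse:
  fixes b c :: "nat list \<Rightarrow> 'k::field_char_0"
  assumes c: "c \<in> carrier NSym_group" and b: "\<forall>\<alpha>. \<not> composition \<alpha> \<longrightarrow> b \<alpha> = 0" "b [] = 1"
    and bc: "NSym_mult b c = ribbon []"
  shows "b \<in> carrier NSym_group"
proof -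
  note c' = c[unfolded NSym_group_carrier_iff]
  define x where "x = coeff c 1 {}"
  have f: "fact n * coeff b n {} = (- x) ^ n" for n
  proof (induction n rule: less_induct)
    case (less n)
    show ?case
    proof (cases "n = 0")
      case True then show ?thesis using b(2) coeff_Nil[of b] by simp
    next
      case False
      have bin: "(\<Sum>k\<le>n. of_nat (n choose k) * (- x) ^ k * x ^ (n - k)) = 0"
        using binomial_ring[of "- x" x n] False by (simp add: zero_power)
      have "(\<Sum>k\<le>n. of_nat (n choose k) * (fact k * coeff b k {}) * (fact (n - k) * coeff c (n - k) {})) = 0"
        using fact_coeff_mult[of n b c] False by (simp add: bc coeff_one)
      then have "(\<Sum>k\<le>n. of_nat (n choose k) * (fact k * coeff b k {}) * x ^ (n - k)) = 0"
        using c' by (simp add: x_def)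
      then have "(\<Sum>k<n. of_nat (n choose k) * (- x) ^ k * x ^ (n - k)) + fact n * coeff b n {} = 0"
        using less by (simp add: lessThan_Suc_atMost[symmetric])
      then show ?thesis using bin by (simp add: lessThan_Suc_atMost[symmetric] add_eq_0_iff)
    qed
  qed
  show ?thesis unfolding NSym_group_carrier_iff using b f f[of 1] by simp
qed

lemma NSym_group_mult: "mult NSym_group = NSym_mult" and NSym_group_one: "one NSym_group = ribbon []"
  by (simp_all add: NSym_group_def NSym_completion_def)

lemma group_NSym: "group (NSym_group :: (nat list \<Rightarrow> 'k::field_char_0) monoid)"
proof (rule groupI, unfold NSym_group_mult NSym_group_one)
  show "ribbon [] \<in> carrier (NSym_group :: (nat list \<Rightarrow> 'k) monoid)"
    unfolding NSym_group_carrier_iff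
    by (auto simp: ribbon_non_composition coeff_one) (simp add: ribbon_def)
  fix c :: "nat list \<Rightarrow> 'k" assume c: "c \<in> carrier NSym_group"
  then have c': "\<And>\<alpha>. \<not> composition \<alpha> \<Longrightarrow> c \<alpha> = 0" "c [] = 1" unfolding NSym_group_carrier_iff by auto
  show "NSym_mult (ribbon []) c = c" using c'(1) by (rule NSym_one_mult)
  obtain b where b: "\<forall>\<alpha>. \<not> composition \<alpha> \<longrightarrow> b \<alpha> = 0" "b [] = 1" "NSym_mult b c = ribbon []"
    using NSym_left_inverse_exists[of c, OF c'(2)] by blast
  then show "\<exists>b\<in>carrier NSym_group. NSym_mult b c = ribbon []"
    using NSym_group_inverse[OF c b] by blast
qed (simp_all add: NSym_group_mult_closed NSym_mult_assoc)

section \<open>The isomorphism\<close>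

lemma cuts_subset: "finite B \<Longrightarrow> cuts B f \<subseteq> {0<..<card B}"
  using cuts_bounds[of B _ f] by auto

lemma cuts_empty [simp]: "cuts {} f = {}"
  using cuts_subset[of "{}" f] by simp

lemma cuts_const: "cuts B (\<lambda>_. 0) = {}"
  unfolding cuts_def by auto

text \<open>The value of the character at the orbit polytope with cuts \<open>D\<close>. The factor \<open>n!\<close> turns the
  product of ribbon functions into the binomial convolution produced by the coproduct.\<close>

definition weight :: "(nat list \<Rightarrow> 'k::field_char_0) \<Rightarrow> nat \<Rightarrow> nat set \<Rightarrow> 'k" where
  "weight c n D = fact n * coeff c n D"

lemma weight_power:
  assumes "c \<in> carrier NSym_group" shows "weight c n {} = coeff c 1 {} ^ n"
  using assms unfolding NSym_group_carrier_iff weight_def by simp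

lemma weight_0: "c \<in> carrier NSym_group \<Longrightarrow> weight c 0 {} = 1"
  by (simp add: weight_power)

text \<open>A class carries no preferred pair \<open>(r, f)\<close>, so one is chosen. The value
  does not depend on the choice when \<open>c\<close> lies in the group.\<close>

definition ribbon_character :: "(nat list \<Rightarrow> 'k::field_char_0) \<Rightarrow> ('a, 'k) collection" where
  "ribbon_character c = (\<lambda>I\<in>{I. finite I}. \<lambda>X\<in>OP I.
     let (r, f) = (SOME (r, f). equiv I r \<and> X = young_class I r f) in block_prod (weight c) I r f)"

lemma ribbon_character_young:
  assumes c: "c \<in> carrier NSym_group" and I: "finite I" "equiv I r"
  shows "ribbon_character c I (young_class I r f) = block_prod (weight c) I r f"
proof -
  define z where "z = (SOME (s, g). equiv I s \<and> young_class I r f = young_class I s g)"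
  obtain s g where sg: "z = (s, g)" by (cases z)
  have "case z of (s, g) \<Rightarrow> equiv I s \<and> young_class I r f = young_class I s g"
    unfolding z_def by (rule someI[of _ "(r, f)"]) (use I in simp)
  then have s: "equiv I s" "young_class I r f = young_class I s g" by (auto simp: sg)
  have "ribbon_character c I (young_class I r f) = block_prod (weight c) I s g"
    using I OP_iff[OF I(1)] sg by (auto simp: ribbon_character_def z_def Let_def)
  also have "\<dots> = block_prod (weight c) I r f"
    using s(2)[unfolded young_class_eq_iff[OF I s(1)]] weight_power[OF c]
    by (intro block_prod_dominates_cong[OF I(1) s(1) I(2)]) auto
  finally show ?thesis .
qed

lemma OP_one_young: "OP_one = young_class {} {} f"
proof -
  have "young {} {} f = {0}" by (auto simp: young_def shuffle_def point_def intro: permutes_id)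
  then show ?thesis by (simp add: OP_one_def young_polytope_def)
qed

text \<open>The product lemmas speak of one arrangement on both label sets; two given ones are
  glued.\<close>

lemma common_arrangement:
  assumes "S \<inter> T = {}"
  obtains k where "\<And>r. young_polytope S r f = young_polytope S r k" "\<And>s. young_polytope T s g = young_polytope T s k"
proof (rule that[of "\<lambda>i. if i \<in> S then f i else g i"])
  show "young_polytope S r f = young_polytope S r (\<lambda>i. if i \<in> S then f i else g i)" for r
    by (rule young_polytope_cong) simp
  show "young_polytope T s g = young_polytope T s (\<lambda>i. if i \<in> S then f i else g i)" for s
    by (rule young_polytope_cong) (use assms in auto)
qed

lemma ribbon_character_in_characters:
  assumes c: "c \<in> carrier (NSym_group :: (nat list \<Rightarrow> 'k::field_char_0) monoid)"
  shows "(ribbon_character c :: ('a, 'k) collection) \<in> characters"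
  unfolding characters_def
proof (intro CollectI conjI allI impI ballI)
  show "(ribbon_character c :: ('a, 'k) collection) \<in> (\<Pi>\<^sub>E I\<in>{I. finite I}. OP I \<rightarrow>\<^sub>E UNIV)"
    by (auto simp: ribbon_character_def)
  fix I J :: "'a set" and \<sigma> X assume I: "finite I" and b: "bij_betw \<sigma> I J" and "X \<in> OP I"
  then obtain r f where r: "equiv I r" and X: "X = young_class I r f" unfolding OP_iff[OF I] by blast
  define \<tau> where "\<tau> = inv_into I \<sigma>"
  have t: "\<forall>i\<in>I. \<tau> (\<sigma> i) = i" using b by (auto simp: \<tau>_def bij_betw_def)
  have J: "finite J" using b I by (auto simp: bij_betw_def)
  show "ribbon_character c J (OP_relabel \<sigma> J X) = ribbon_character c I X"
    unfolding X OP_relabel_young[OF I r b t] ribbon_character_young[OF c I r]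
      ribbon_character_young[OF c J equiv_map_prod[OF r b]] by (rule block_prod_relabel[OF I r b t])
next
  have "equiv {} ({} :: 'a rel)" by (simp add: equiv_def refl_on_def sym_def trans_def)
  then show "ribbon_character c {} (OP_one :: 'a fvec set set) = 1"
    unfolding OP_one_young[of undefined] by (subst ribbon_character_young[OF c]) (simp_all add: block_prod_def)
next
  fix S T :: "'a set" and X Y
  assume fin: "finite S" "finite T" and dis: "S \<inter> T = {}" and "X \<in> OP S" "Y \<in> OP T"
  then obtain r f s g where rs: "equiv S r" "equiv T s" and XY: "X = young_class S r f" "Y = young_class T s g"
    unfolding OP_iff[OF fin(1)] OP_iff[OF fin(2)] by blast
  obtain k where k: "\<And>r. young_polytope S r f = young_polytope S r k" "\<And>s. young_polytope T s g = young_polytope T s k"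
    using common_arrangement[OF dis] by blast
  have un: "finite (S \<union> T)" using fin by simp
  show "ribbon_character c (S \<union> T) (OP_mult S T X Y) = ribbon_character c S X * ribbon_character c T Y"
    unfolding XY k OP_mult_young[OF fin rs dis] ribbon_character_young[OF c un equiv_Un[OF rs dis]]
      ribbon_character_young[OF c fin(1) rs(1)] ribbon_character_young[OF c fin(2) rs(2)]
    by (rule block_prod_Un[OF fin rs dis])
qed

text \<open>The binomial coefficient counts the subsets of size \<open>k\<close> of a block with
  \<open>n\<close> labels, over which the convolution sums; the factor n! in \<open>weight\<close>
  produces it.\<close>

lemma weight_mult:
  assumes "D \<subseteq> {0<..<n}"
  shows "weight (NSym_mult c d) n D =
    (\<Sum>k\<le>n. of_nat (n choose k) * (weight c k (low_cuts k D) * weight d (n - k) (high_cuts k D)))"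
  unfolding weight_def coeff_mult[OF assms] sum_distrib_left
proof (rule sum.cong[OF refl])
  fix k assume "k \<in> {..n}"
  then have "(fact n :: 'a) = of_nat (n choose k) * fact k * fact (n - k)"
    by (simp add: binomial_fact)
  then show "fact n * (coeff c k (low_cuts k D) * coeff d (n - k) (high_cuts k D)) =
      of_nat (n choose k) * (fact k * coeff c k (low_cuts k D) * (fact (n - k) * coeff d (n - k) (high_cuts k D)))"
    by simp
qed

text \<open>A vertex sorted by the indicator of \<open>S\<close> puts the largest values of each
  block on the part inside \<open>S\<close>. So \<open>S\<close> cuts the composition of a block
  \<open>B\<close> after \<open>card (B \<inter> S)\<close> boxes, and the two restrictions multiply
  block by block.\<close>

lemma convolution_term:
  assumes c: "c \<in> carrier NSym_group" and d: "d \<in> carrier NSym_group"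
    and I: "finite I" "equiv I r" and S: "S \<subseteq> I"
  shows "ribbon_character c S (fst (OP_comult S (I - S) (young_class I r f))) *
      ribbon_character d (I - S) (snd (OP_comult S (I - S) (young_class I r f))) =
    (\<Prod>B\<in>I // r. weight c (card (B \<inter> S)) (low_cuts (card (B \<inter> S)) (cuts B f)) *
      weight d (card B - card (B \<inter> S)) (high_cuts (card (B \<inter> S)) (cuts B f)))"
proof -
  let ?T = "I - S"
  have un: "S \<union> ?T = I" using S by blast
  have I': "finite (S \<union> ?T)" "equiv (S \<union> ?T) r" unfolding un by fact+
  obtain g where g: "shuffle I r g f" "sorted_by r g (indicat_real S)" by (rule sorted_by_exists[OF I])
  then have g': "shuffle (S \<union> ?T) r g f" "sorted_by r g (indicat_real S)" unfolding un .
  have com: "OP_comult S ?T (young_class I r f) = (young_class S (Restr r S) g, young_class ?T (Restr r ?T) g)"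
    using OP_comult_young[OF I' _ g'] unfolding un by simp
  have fin: "finite S" "finite ?T" using I(1) S by (auto intro: finite_subset)
  have "ribbon_character c S (fst (OP_comult S ?T (young_class I r f))) *
      ribbon_character d ?T (snd (OP_comult S ?T (young_class I r f))) =
    block_prod (weight c) S (Restr r S) g * block_prod (weight d) ?T (Restr r ?T) g"
    unfolding com using ribbon_character_young[OF c fin(1) equiv_restrict[OF I(2) S]]
      ribbon_character_young[OF d fin(2) equiv_restrict[OF I(2) Diff_subset]] by simp
  also have "\<dots> = (\<Prod>B\<in>I // r. weight c (card (B \<inter> S)) (cuts (B \<inter> S) g) *
      weight d (card (B \<inter> ?T)) (cuts (B \<inter> ?T) g))"
    unfolding block_prod_restrict[OF I S, of "weight c", OF weight_0[OF c]]
      block_prod_restrict[OF I Diff_subset, of "weight d", OF weight_0[OF d]] by (simp add: prod.distrib)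
  also have "\<dots> = (\<Prod>B\<in>I // r. weight c (card (B \<inter> S)) (low_cuts (card (B \<inter> S)) (cuts B f)) *
      weight d (card B - card (B \<inter> S)) (high_cuts (card (B \<inter> S)) (cuts B f)))"
  proof (rule prod.cong[OF refl])
    fix B assume B: "B \<in> I // r"
    have BI: "B \<subseteq> I" using in_quotient_imp_subset[OF I(2) B] .
    then have fB: "finite B" using I(1) by (rule finite_subset)
    have BT: "B \<inter> ?T = B - S" using BI by blast
    have le: "g b \<le> g a" if "a \<in> B \<inter> S" "b \<in> B - S" for a b
    proof (rule ccontr)
      assume "\<not> g b \<le> g a"
      moreover have "(b, a) \<in> r" using in_quotient_imp_in_rel[OF I(2) B] that by auto
      ultimately have "indicat_real S a \<le> indicat_real S b" using g(2) unfolding sorted_by_def by auto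
      then show False using that by simp
    qed
    have cb: "cuts B g = cuts B f"
      using B cuts_shuffle[OF I g(1)] by (auto simp: quotient_def)
    have "card (B - S) = card B - card (B \<inter> S)" using fB by (simp add: card_Diff_subset_Int)
    then show "weight c (card (B \<inter> S)) (cuts (B \<inter> S) g) * weight d (card (B \<inter> ?T)) (cuts (B \<inter> ?T) g) =
        weight c (card (B \<inter> S)) (low_cuts (card (B \<inter> S)) (cuts B f)) *
        weight d (card B - card (B \<inter> S)) (high_cuts (card (B \<inter> S)) (cuts B f))"
      unfolding BT using cuts_upper_part[OF fB le] cuts_lower_part[OF fB le] by (simp add: cb)
  qed
  finally show ?thesis .
qed

text \<open>The term for \<open>S\<close> depends only on the sizes of its intersections with the
  blocks, so the sum over all \<open>S\<close> factors into one binomial sum per block, which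
  \<open>weight_mult\<close> evaluates.\<close>

lemma ribbon_character_mult:
  assumes c: "c \<in> carrier NSym_group" and d: "d \<in> carrier NSym_group"
  shows "ribbon_character (NSym_mult c d) = convolution (ribbon_character c) (ribbon_character d)"
proof (intro ext)
  fix I :: "'b set" and X
  show "ribbon_character (NSym_mult c d) I X = convolution (ribbon_character c) (ribbon_character d) I X"
  proof (cases "finite I \<and> X \<in> OP I")
    case False
    then show ?thesis by (auto simp: ribbon_character_def convolution_def)
  next
    case True
    then have fI: "finite I" by simp
    obtain r f where r: "equiv I r" and X: "X = young_class I r f" using True OP_iff[OF fI] by blast
    let ?h = "\<lambda>B k. weight c k (low_cuts k (cuts B f)) * weight d (card B - k) (high_cuts k (cuts B f))"
    have fB: "finite B" if "B \<in> I // r" for B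
      using in_quotient_imp_subset[OF r that] fI by (rule finite_subset)
    have "convolution (ribbon_character c) (ribbon_character d) I X =
        (\<Sum>(S, T)\<in>{(S, T). S \<union> T = I \<and> S \<inter> T = {}}. ribbon_character c S (fst (OP_comult S T X)) * ribbon_character d T (snd (OP_comult S T X)))"
      using True by (simp add: convolution_def)
    also have "\<dots> = (\<Sum>S\<in>Pow I. ribbon_character c S (fst (OP_comult S (I - S) X)) * ribbon_character d (I - S) (snd (OP_comult S (I - S) X)))"
    proof (rule sum.reindex_bij_witness[of _ "\<lambda>S. (S, I - S)" fst])
      fix p assume "p \<in> {(S, T). S \<union> T = I \<and> S \<inter> T = {}}"
      then obtain S T where p: "p = (S, T)" "S \<subseteq> I" "T = I - S" by blast
      then show "(fst p, I - fst p) = p" "fst p \<in> Pow I" by simp_all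
      show "ribbon_character c (fst p) (fst (OP_comult (fst p) (I - fst p) X)) *
          ribbon_character d (I - fst p) (snd (OP_comult (fst p) (I - fst p) X)) =
        (case p of (S, T) \<Rightarrow> ribbon_character c S (fst (OP_comult S T X)) *
          ribbon_character d T (snd (OP_comult S T X)))"
        by (simp add: p)
    qed auto
    also have "\<dots> = (\<Sum>S\<in>Pow I. \<Prod>B\<in>I // r. ?h B (card (B \<inter> S)))"
      unfolding X using convolution_term[OF c d fI r] by (intro sum.cong refl) auto
    also have "\<dots> = (\<Sum>S\<in>Pow (\<Union>(I // r)). \<Prod>B\<in>I // r. ?h B (card (B \<inter> S)))"
      by (simp only: Union_quotient[OF r])
    also have "\<dots> = (\<Prod>B\<in>I // r. \<Sum>U\<in>Pow B. ?h B (card U))"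
    proof (rule sum_Pow_Union)
      show "finite (I // r)" using equiv_mem[OF r] by (intro finite_quotient[OF fI]) auto
      show "B \<inter> C = {}" if "B \<in> I // r" "C \<in> I // r" "B \<noteq> C" for B C
        using quotient_disj[OF r that(1,2)] that(3) by blast
    qed (rule fB)
    also have "\<dots> = (\<Prod>B\<in>I // r. weight (NSym_mult c d) (card B) (cuts B f))"
    proof (rule prod.cong[OF refl])
      fix B assume B: "B \<in> I // r"
      show "(\<Sum>U\<in>Pow B. ?h B (card U)) = weight (NSym_mult c d) (card B) (cuts B f)"
        unfolding weight_mult[OF cuts_subset[OF fB[OF B]]] by (rule sum_Pow_card[OF fB[OF B], of "?h B"])
    qed
    also have "\<dots> = ribbon_character (NSym_mult c d) I X"
      unfolding X ribbon_character_young[OF NSym_group_mult_closed[OF c d] fI r] block_prod_def ..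
    finally show ?thesis by simp
  qed
qed

text \<open>A nonempty label set has a nonempty block, and the unit has no coefficient in positive
  degree, so one factor vanishes.\<close>

lemma ribbon_character_one: "ribbon_character (ribbon []) = counit"
proof (intro ext)
  have one: "ribbon [] \<in> carrier (NSym_group :: (nat list \<Rightarrow> 'b::field_char_0) monoid)"
    using group.is_monoid[OF group_NSym] monoid.one_closed unfolding NSym_group_one[symmetric] by blast
  fix I :: "'a set" and X
  show "ribbon_character (ribbon []) I X = (counit I X :: 'b)"
  proof (cases "finite I \<and> X \<in> OP I")
    case False
    then show ?thesis by (auto simp: ribbon_character_def counit_def)
  next
    case True
    then have fI: "finite I" by simp
    obtain r f where r: "equiv I r" and X: "X = young_class I r f" using True OP_iff[OF fI] by blast
    have "block_prod (weight (ribbon [])) I r f = (if I = {} then 1 else (0::'b))"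
    proof (cases "I = {}")
      case True
      then show ?thesis by (simp add: block_prod_def)
    next
      case False
      then obtain a where a: "a \<in> I" by blast
      have fin: "finite (I // r)" using equiv_mem[OF r] by (intro finite_quotient[OF fI]) auto
      have B: "r `` {a} \<in> I // r" using a by (rule quotientI)
      have fB: "finite (r `` {a})" using equiv_class_subset[OF r] fI by (rule finite_subset)
      have "card (r `` {a}) \<noteq> 0" using equiv_refl[OF r a] fB by auto
      then have "weight (ribbon []) (card (r `` {a})) (cuts (r `` {a}) f) = (0::'b)"
        by (simp add: weight_def coeff_one[OF cuts_subset[OF fB]])
      then show ?thesis using False fin B by (auto simp: block_prod_def intro!: prod_zero)
    qed
    then show ?thesis using True unfolding X ribbon_character_young[OF one fI r] by (simp add: counit_def)
  qed
qed

text \<open>Fixed distinct labels. An infinite label type has enough of them to realise every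
  composition by an orbit polytope.\<close>

definition label :: "nat \<Rightarrow> 'a::infinite" where
  "label = (SOME e. inj e)"

lemma inj_label: "inj (label :: nat \<Rightarrow> 'a::infinite)"
proof -
  obtain e :: "nat \<Rightarrow> 'a" where "inj e" using infinite_countable_subset[OF infinite_UNIV] by blast
  then show ?thesis unfolding label_def by (rule someI[of inj])
qed

definition labels :: "nat \<Rightarrow> 'a::infinite set" where
  "labels n = label ` {..<n}"

definition arrangement :: "nat \<Rightarrow> nat set \<Rightarrow> 'a::infinite \<Rightarrow> real" where
  "arrangement n D = steps D \<circ> inv_into {..<n} label"

lemma finite_labels: "finite (labels n)" and card_labels: "card (labels n) = n"
  by (simp_all add: labels_def card_image[OF inj_on_subset[OF inj_label subset_UNIV]])

lemma cuts_arrangement: "D \<subseteq> {0<..<n} \<Longrightarrow> cuts (labels n) (arrangement n D) = D"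
  unfolding labels_def arrangement_def using inj_label by (intro cuts_steps) (auto simp: inj_on_def)

text \<open>Evaluation at an orbit polytope on \<open>n\<close> labels with cuts \<open>D\<close>
  returns n! times a coefficient, and n! is invertible.\<close>

lemma inj_ribbon_character:
  "inj_on (ribbon_character :: _ \<Rightarrow> ('a::infinite, 'k::field_char_0) collection) (carrier NSym_group)"
proof (rule inj_onI)
  fix c d :: "nat list \<Rightarrow> 'k"
  assume c: "c \<in> carrier NSym_group" and d: "d \<in> carrier NSym_group"
    and eq: "(ribbon_character c :: ('a, 'k) collection) = ribbon_character d"
  show "c = d"
  proof (rule NSym_eqI)
    fix n and D :: "nat set" assume D: "D \<subseteq> {0<..<n}"
    let ?I = "labels n :: 'a set" and ?f = "arrangement n D"
    have *: "ribbon_character e ?I (young_class ?I (?I \<times> ?I) ?f) = weight e n D" if "e \<in> carrier NSym_group" for e :: "nat list \<Rightarrow> 'k"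
      unfolding ribbon_character_young[OF that finite_labels equiv_full]
        block_prod_full[of "weight e", OF weight_0[OF that]] cuts_arrangement[OF D] card_labels ..
    have "weight c n D = weight d n D" using *[OF c] *[OF d] eq by simp
    then show "coeff c n D = coeff d n D" by (simp add: weight_def)
  qed (use c d in \<open>auto simp: NSym_group_carrier_iff\<close>)
qed

section \<open>Characters are determined by their values on orbit polytopes\<close>

lemma charactersD:
  assumes "\<zeta> \<in> characters"
  shows "\<And>I J \<sigma> X. finite I \<Longrightarrow> bij_betw \<sigma> I J \<Longrightarrow> X \<in> OP I \<Longrightarrow> \<zeta> J (OP_relabel \<sigma> J X) = \<zeta> I X"
    and "\<zeta> {} OP_one = 1"
    and "\<And>S T X Y. finite S \<Longrightarrow> finite T \<Longrightarrow> S \<inter> T = {} \<Longrightarrow> X \<in> OP S \<Longrightarrow> Y \<in> OP T \<Longrightarrow>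
      \<zeta> (S \<union> T) (OP_mult S T X Y) = \<zeta> S X * \<zeta> T Y"
  using assms unfolding characters_def by auto

text \<open>Equal sizes and cuts give an order isomorphism. Relabelling along it makes the two
  arrangements order equivalent, and the class depends only on the order.\<close>

lemma character_orbit_eq:
  assumes z: "\<zeta> \<in> characters" and fin: "finite I" "finite J" and cd: "card I = card J" and cu: "cuts I f = cuts J g"
  shows "\<zeta> I (young_class I (I \<times> I) f) = \<zeta> J (young_class J (J \<times> J) g)"
proof -
  obtain \<sigma> where s: "bij_betw \<sigma> I J" "\<And>i j. i \<in> I \<Longrightarrow> j \<in> I \<Longrightarrow> f i < f j \<longleftrightarrow> g (\<sigma> i) < g (\<sigma> j)"
    using order_iso_of_cuts_eq[OF fin cd cu] by blast
  define \<tau> where "\<tau> = inv_into I \<sigma>"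
  have t: "\<forall>i\<in>I. \<tau> (\<sigma> i) = i" using s(1) by (auto simp: \<tau>_def bij_betw_def)
  have J: "J = \<sigma> ` I" using s(1) by (auto simp: bij_betw_def)
  have full: "map_prod \<sigma> \<sigma> ` (I \<times> I) = J \<times> J" unfolding J by (rule map_prod_surj_on) auto
  have mem: "young_class I (I \<times> I) f \<in> OP I" using OP_iff[OF fin(1)] equiv_full[of I] by blast
  have "\<zeta> I (young_class I (I \<times> I) f) = \<zeta> J (OP_relabel \<sigma> J (young_class I (I \<times> I) f))"
    using charactersD(1)[OF z fin(1) s(1) mem] by simp
  also have "OP_relabel \<sigma> J (young_class I (I \<times> I) f) = young_class J (J \<times> J) (f \<circ> \<tau>)"
    unfolding OP_relabel_young[OF fin(1) equiv_full s(1) t] full ..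
  also have "young_class J (J \<times> J) (f \<circ> \<tau>) = young_class J (J \<times> J) g"
    unfolding young_class_eq_iff[OF fin(2) equiv_full equiv_full]
    by (intro allI dominates_order_cong[OF equiv_full]) (use s(2) t in \<open>auto simp: J\<close>)
  finally show ?thesis .
qed

lemma young_polytope_zero:
  assumes "equiv I r" shows "young_polytope I r (\<lambda>_. 0) = {0}"
proof -
  have "young I r (\<lambda>_. 0) \<subseteq> {0}" by (auto simp: young_def shuffle_def point_def)
  then have "young I r (\<lambda>_. 0) = {0}" using young_nonempty[OF assms] by blast
  then show ?thesis by (simp add: young_polytope_def)
qed

text \<open>The orbit polytope of the zero vector is a point, which is the product of points on
  single labels. This is the origin of the relation between c_(n) and c_(1).\<close>

lemma character_point:
  assumes z: "\<zeta> \<in> characters" and fin: "finite I"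
  shows "\<zeta> I (young_class I (I \<times> I) (\<lambda>_. 0)) = \<zeta> {a} (young_class {a} ({a} \<times> {a}) (\<lambda>_. 0)) ^ card I"
  using fin
proof (induction I rule: finite_induct)
  case empty
  then show ?case using charactersD(2)[OF z] unfolding OP_one_young[of "\<lambda>_. 0"] by simp
next
  case (insert b I)
  let ?p = "\<lambda>I. young_class I (I \<times> I) (\<lambda>_. 0)"
  have dis: "{b} \<inter> I = {}" using insert.hyps by simp
  have fb: "finite {b}" by simp
  have "OP_mult {b} I (?p {b}) (?p I) = young_class ({b} \<union> I) ({b} \<times> {b} \<union> I \<times> I) (\<lambda>_. 0)"
    by (rule OP_mult_young[OF fb insert.hyps(1) equiv_full equiv_full dis])
  also have "\<dots> = ?p (insert b I)"
    unfolding young_polytope_zero[OF equiv_full] young_polytope_zero[OF equiv_Un[OF equiv_full equiv_full dis]]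
    by simp
  finally have mult: "OP_mult {b} I (?p {b}) (?p I) = ?p (insert b I)" .
  have mem: "?p {b} \<in> OP {b}" "?p I \<in> OP I"
    using OP_iff[OF fb] OP_iff[OF insert.hyps(1)] equiv_full[of "{b}"] equiv_full[of I] by blast+
  have "\<zeta> (insert b I) (?p (insert b I)) = \<zeta> {b} (?p {b}) * \<zeta> I (?p I)"
    using charactersD(3)[OF z fb insert.hyps(1) dis mem] by (simp only: mult insert_is_Un[symmetric])
  moreover have "\<zeta> {b} (?p {b}) = \<zeta> {a} (?p {a})"
    by (rule character_orbit_eq[OF z]) (simp_all add: cuts_const)
  ultimately show ?case using insert by simp
qed

lemma OP_class_polytope_prod:
  assumes P: "orbit_product S P" and Q: "orbit_product T Q" and dis: "S \<inter> T = {}"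
  shows "OP_class (S \<union> T) (polytope_prod P Q) = OP_mult S T (OP_class S P) (OP_class T Q)"
proof -
  obtain r f where S: "finite S" "equiv S r" "P = young_polytope S r f" using orbit_product_imp_young[OF P] by blast
  obtain s g where T: "finite T" "equiv T s" "Q = young_polytope T s g" using orbit_product_imp_young[OF Q] by blast
  obtain k where k: "\<And>r. young_polytope S r f = young_polytope S r k" "\<And>s. young_polytope T s g = young_polytope T s k"
    using common_arrangement[OF dis] by blast
  show ?thesis
    unfolding S(3) T(3) k OP_mult_young[OF S(1) T(1) S(2) T(2) dis]
      young_polytope_Un[OF S(1) T(1) S(2) T(2) dis] ..
qed

lemma surj_ribbon_character:
  fixes \<zeta> :: "('a::infinite, 'k::field_char_0) collection"
  assumes z: "\<zeta> \<in> characters"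
  shows "\<exists>c\<in>carrier NSym_group. ribbon_character c = \<zeta>"
proof -
  let ?v = "\<lambda>n D. \<zeta> (labels n) (young_class (labels n) (labels n \<times> labels n) (arrangement n D))"
  \<comment> \<open>Dividing by n! undoes the factor in \<open>weight\<close>, so that the weights
    of \<open>c\<close> are the values of the character on orbit polytopes.\<close>
  define c where "c \<alpha> = (if composition \<alpha> then ?v (sum_list \<alpha>) (psums \<alpha>) / fact (sum_list \<alpha>) else 0)" for \<alpha>
  have w: "weight c n D = ?v n D" if "D \<subseteq> {0<..<n}" for n D
    using comp_of[OF that] by (simp add: weight_def coeff_def c_def)
  have orb: "\<zeta> I (young_class I (I \<times> I) f) = weight c (card I) (cuts I f)" if "finite I" for I f
    unfolding w[OF cuts_subset[OF that]]
    by (rule character_orbit_eq[OF z that finite_labels])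
      (simp_all add: card_labels cuts_arrangement[OF cuts_subset[OF that]])
  have pow: "weight c n {} = coeff c 1 {} ^ n" for n
  proof -
    let ?I = "labels n :: 'a set" and ?a = "undefined :: 'a"
    have "weight c n {} = \<zeta> ?I (young_class ?I (?I \<times> ?I) (\<lambda>_. 0))"
      using orb[OF finite_labels, of n "\<lambda>_. 0"] by (simp add: cuts_const card_labels)
    also have "\<dots> = \<zeta> {?a} (young_class {?a} ({?a} \<times> {?a}) (\<lambda>_. 0)) ^ n"
      using character_point[OF z finite_labels, of n] by (simp add: card_labels)
    also have "\<zeta> {?a} (young_class {?a} ({?a} \<times> {?a}) (\<lambda>_. 0)) = coeff c 1 {}"
      using orb[of "{?a}" "\<lambda>_. 0"] by (simp add: cuts_const weight_def)
    finally show ?thesis .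
  qed
  have "c [] = 1" using pow[of 0] by (simp add: weight_def coeff_Nil)
  then have c: "c \<in> carrier NSym_group"
    unfolding NSym_group_carrier_iff using pow by (simp add: weight_def c_def)
  have ch: "(ribbon_character c :: ('a, 'k) collection) \<in> characters" by (rule ribbon_character_in_characters[OF c])
  \<comment> \<open>Both characters are multiplicative and agree on orbit polytopes, so induction on
    the construction of the product suffices.\<close>
  have eq: "ribbon_character c I (OP_class I P) = \<zeta> I (OP_class I P)" if "orbit_product I P" for I P
    using that
  proof (induction rule: orbit_product.induct)
    case (orbit I p)
    show ?case
      unfolding orbit_polytope_eq_young[OF orbit] ribbon_character_young[OF c orbit(1) equiv_full]
        block_prod_full[of "weight c", OF weight_0[OF c]] orb[OF orbit(1)] ..
  next
    case (prod S P T Q)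
    have fin: "finite S" "finite T" using prod.hyps orbit_product_imp_young by blast+
    have mem: "OP_class S P \<in> OP S" "OP_class T Q \<in> OP T"
      using prod.hyps by (auto simp: OP_def intro: quotientI)
    show ?case
      unfolding OP_class_polytope_prod[OF prod.hyps] charactersD(3)[OF ch fin prod.hyps(3) mem]
        charactersD(3)[OF z fin prod.hyps(3) mem] prod.IH ..
  qed
  have "ribbon_character c I X = \<zeta> I X" for I X
  proof (cases "finite I \<and> X \<in> OP I")
    case True
    then obtain P where "orbit_product I P" "X = OP_class I P" by (auto simp: OP_def quotient_def)
    then show ?thesis using eq by simp
  next
    case False
    \<comment> \<open>For infinite \<open>I\<close>, and outside the classes of \<open>I\<close>,
      extensionality fixes the same default value for all characters.\<close>
    have "\<xi> I X = (if finite I then undefined else undefined X)" if "\<xi> \<in> characters" for \<xi> :: "('a, 'k) collection"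
      using that False unfolding characters_def by (auto simp: PiE_def extensional_def Pi_def)
    then show ?thesis using ch z by metis
  qed
  then show ?thesis using c by blast
qed

theorem theorem5p5:
  shows "group (character_group :: ('a::infinite, 'k::field_char_0) collection monoid) \<and>
         group (NSym_group :: (nat list \<Rightarrow> 'k) monoid) \<and>
         (character_group :: ('a, 'k) collection monoid) \<cong> (NSym_group :: (nat list \<Rightarrow> 'k) monoid)"
proof -
  let ?X = "character_group :: ('a, 'k) collection monoid" and ?G = "NSym_group :: (nat list \<Rightarrow> 'k) monoid"
  interpret G: group ?G by (rule group_NSym)
  have im: "ribbon_character ` carrier ?G = carrier ?X"
    using ribbon_character_in_characters surj_ribbon_character by (fastforce simp: character_group_def)
  have hom: "ribbon_character \<in> hom ?G ?X"
    using im by (intro homI) (auto simp: character_group_def NSym_group_mult ribbon_character_mult)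
  \<comment> \<open>The image of a group under a homomorphism is a group, with carrier and unit
    given as images; here these are all characters and the counit. This gives associativity of the
    convolution and inverses of characters.\<close>
  have "?X\<lparr>carrier := ribbon_character ` carrier ?G, one := ribbon_character \<one>\<^bsub>?G\<^esub>\<rparr> = ?X"
    unfolding im NSym_group_one ribbon_character_one by (simp add: character_group_def)
  then have X: "group ?X" using G.hom_imp_img_group[OF hom] by simp
  have "ribbon_character \<in> iso ?G ?X"
    using hom im inj_ribbon_character by (auto simp: iso_def bij_betw_def)
  then have "?G \<cong> ?X" by (auto simp: is_iso_def)
  then show ?thesis using X group_NSym G.iso_sym by blast
qed

end
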